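(* Let $\Omega\subset\mathbb{R}^d$ ($d\ge 2$) be a bounded, simply connected Lipschitz domain. There is a constant $C>0$ such that for every mesh $\mathcal{T}$ of $\Omega$ and every $\boldsymbol{f}\in\boldsymbol{L}_2(\Omega)$ the following holds, with $\mathfrak{U}$, $\mathfrak{V}(\mathcal{T})$, $b$, $L$ as defined in the context. There exists a unique $\mathfrak{u}=(\boldsymbol{u}_1,u_2,\boldsymbol{u}_3,u_4,\hat u_1,\hat u_2,\hat u_3,\hat u_4)\in\mathfrak{U}$ such that $$b(\mathfrak{u},\mathfrak{v})=L(\mathfrak{v})\qquad\forall\,\mathfrak{v}\in\mathfrak{V}(\mathcal{T}),$$ and it satisfies $$\|\mathfrak{u}\|_{\mathfrak{U}}\le C\,\|\boldsymbol{f}\|,$$ where $C$ is independent of $\boldsymbol{f}$ and $\mathcal{T}$. Furthermore, $\boldsymbol{u}:=\boldsymbol{u}_1$ solves $$(\nabla\operatorname{div})^2\boldsymbol{u}+\boldsymbol{u}=\boldsymbol{f}\ \text{ in }\Omega,\qquad \operatorname{div}\boldsymbol{u}=\boldsymbol{u}\cdot\boldsymbol{n}=0\ \text{ on }\Gamma.$$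
   Context: $\Omega\subset\mathbb{R}^d$, $d\ge2$, is a bounded, simply connected Lipschitz domain with boundary $\Gamma$; $\boldsymbol{n}$ denotes the exterior unit normal vector. A mesh $\mathcal{T}=\{T\}$ is a finite collection of pairwise disjoint (open) Lipschitz domains $T\subset\Omega$ with $\bar\Omega=\bigcup_{T}\bar T$; its skeleton is $\mathcal{S}=\{\partial T: T\in\mathcal{T}\}$. $\boldsymbol{L}_2=(L_2)^d$; $\|\cdot\|$ is the $L_2(\Omega)$-norm (scalar or vector), $(\cdot,\cdot)$ the $L_2(\Omega)$ inner product, $(\cdot,\cdot)_{\mathcal{T}}=\sum_{T}(\cdot,\cdot)_T$ with differential operators taken piecewise. Spaces: $H^1$, $H^1_0$ are standard, $\|v\|_1^2=\|v\|^2+\|\nabla v\|^2$. $\boldsymbol{H}(\mathrm{div},\Omega)=\{\boldsymbol{v}\in\boldsymbol{L}_2(\Omega):\operatorname{div}\boldsymbol{v}\in L_2(\Omega)\}$ with $\|\boldsymbol{v}\|_{\mathrm{div}}^2=\|\boldsymbol{v}\|^2+\|\operatorname{div}\boldsymbol{v}\|^2$, and $\boldsymbol{H}_0(\mathrm{div},\Omega)$ is its subspace with $\boldsymbol{v}\cdot\boldsymbol{n}=0$ on $\Gamma$. $H^1(\mathcal{T})=\prod_T H^1(T)$ and $\boldsymbol{H}(\mathrm{div},\mathcal{T})=\prod_T\boldsymbol{H}(\mathrm{div},T)$ carry the product norms $\|\cdot\|_{1,\mathcal{T}}$, $\|\cdot\|_{\mathrm{div},\mathcal{T}}$. Traces: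 $\mathrm{tr}^{\mathrm{grad}}:H^1(\mathcal{T})\to\boldsymbol{H}(\mathrm{div},\mathcal{T})'$ and $\mathrm{tr}^{\mathrm{div}}:\boldsymbol{H}(\mathrm{div},\mathcal{T})\to H^1(\mathcal{T})'$ are defined by $\langle\mathrm{tr}^{\mathrm{grad}}(v),\boldsymbol{\tau}\rangle^{\nabla}_{\mathcal{S}}:=\langle\mathrm{tr}^{\mathrm{div}}(\boldsymbol{\tau}),v\rangle^{\mathrm{div}}_{\mathcal{S}}:=(v,\operatorname{div}\boldsymbol{\tau})_{\mathcal{T}}+(\nabla v,\boldsymbol{\tau})_{\mathcal{T}}$. Set $H^{1/2}(\mathcal{S})=\mathrm{tr}^{\mathrm{grad}}(H^1(\Omega))$, $H^{1/2}_0(\mathcal{S})=\mathrm{tr}^{\mathrm{grad}}(H^1_0(\Omega))$, $H^{-1/2}(\mathcal{S})=\mathrm{tr}^{\mathrm{div}}(\boldsymbol{H}(\mathrm{div},\Omega))$, $H^{-1/2}_0(\mathcal{S})=\mathrm{tr}^{\mathrm{div}}(\boldsymbol{H}_0(\mathrm{div},\Omega))$, with norms $\|\hat v\|_{1/2,\mathcal{S}}=\inf\{\|v\|_1: v\in H^1(\Omega),\ \mathrm{tr}^{\mathrm{grad}}(v)=\hat v\}$ and $\|\hat\tau\|_{-1/2,\mathcal{S}}=\inf\{\|\boldsymbol{\tau}\|_{\mathrm{div}}:\boldsymbol{\tau}\in\boldsymbol{H}(\mathrm{div},\Omega),\ \mathrm{tr}^{\mathrm{div}}(\boldsymbol{\tau})=\hat\tau\}$.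 The pairings $\langle\hat v,\boldsymbol{\tau}\rangle^{\nabla}_{\mathcal{S}}$ and $\langle\hat\tau,v\rangle^{\mathrm{div}}_{\mathcal{S}}$ are the evaluations of these functionals on $\boldsymbol{\tau}\in\boldsymbol{H}(\mathrm{div},\mathcal{T})$ and $v\in H^1(\mathcal{T})$. Formulation: $\mathfrak{U}=\mathfrak{U}_0\times\widehat{\mathfrak{U}}$ with $\mathfrak{U}_0=\boldsymbol{L}_2(\Omega)\times L_2(\Omega)\times\boldsymbol{L}_2(\Omega)\times L_2(\Omega)$, $\widehat{\mathfrak{U}}=H^{-1/2}_0(\mathcal{S})\times H^{1/2}_0(\mathcal{S})\times H^{-1/2}(\mathcal{S})\times H^{1/2}(\mathcal{S})$, $\|\mathfrak{u}\|_{\mathfrak{U}}^2=\|\boldsymbol{u}_1\|^2+\|u_2\|^2+\|\boldsymbol{u}_3\|^2+\|u_4\|^2+\|\hat u_1\|_{-1/2,\mathcal{S}}^2+\|\hat u_2\|_{1/2,\mathcal{S}}^2+\|\hat u_3\|_{-1/2,\mathcal{S}}^2+\|\hat u_4\|_{1/2,\mathcal{S}}^2$. Test space $\mathfrak{V}(\mathcal{T})=\boldsymbol{H}(\mathrm{div},\mathcal{T})\times H^1(\mathcal{T})\times\boldsymbol{H}(\mathrm{div},\mathcal{T})\times H^1(\mathcal{T})$ with the product norm. For $\mathfrak{v}=(\boldsymbol{v}_1,v_2,\boldsymbol{v}_3,v_4)$, $$b(\mathfrak{u},\mathfrak{v})=(\boldsymbol{u}_1,\boldsymbol{v}_1-\nabla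 v_4)_{\mathcal{T}}-(u_2,v_4+\operatorname{div}\boldsymbol{v}_3)_{\mathcal{T}}-(\boldsymbol{u}_3,\boldsymbol{v}_3+\nabla v_2)_{\mathcal{T}}-(u_4,v_2+\operatorname{div}\boldsymbol{v}_1)_{\mathcal{T}}+\langle\hat u_1,v_4\rangle^{\mathrm{div}}_{\mathcal{S}}+\langle\hat u_2,\boldsymbol{v}_3\rangle^{\nabla}_{\mathcal{S}}+\langle\hat u_3,v_2\rangle^{\mathrm{div}}_{\mathcal{S}}+\langle\hat u_4,\boldsymbol{v}_1\rangle^{\nabla}_{\mathcal{S}},$$ $L(\mathfrak{v})=(\boldsymbol{f},\boldsymbol{v}_1)$. The boundary value problem is understood as: $\boldsymbol{u},\nabla\operatorname{div}\boldsymbol{u}\in\boldsymbol{L}_2(\Omega)$ (so $\boldsymbol{u}\in\boldsymbol{H}(\mathrm{div},\Omega)$ and $\operatorname{div}\boldsymbol{u}\in H^1(\Omega)$), the boundary conditions hold in the sense of traces, and the equation holds in the sense of distributions. *)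

theory Defs
  imports "HOL-Analysis.Analysis"
begin

section \<open>Lipschitz domains and meshes\<close>

text \<open>
  A Lipschitz domain is locally, in some open neighbourhood \<open>U\<close> of each boundary point and after
  choosing a direction \<open>e\<close>, the strict hypograph of a Lipschitz function \<open>g\<close> on the hyperplane
  orthogonal to \<open>e\<close>. The vector \<open>x - (x \<bullet> e) *\<^sub>R e\<close> is the projection of \<open>x\<close> onto that hyperplane.
\<close>

definition lipschitz_boundary :: "'a::euclidean_space set \<Rightarrow> bool" where
  "lipschitz_boundary S \<longleftrightarrow>
     (\<forall>p\<in>frontier S. \<exists>U e g K. open U \<and> p \<in> U \<and> norm e = 1 \<and>
        K-lipschitz_on {y. y \<bullet> e = 0} (g :: 'a \<Rightarrow> real) \<and>
        S \<inter> U = {x \<in> U. x \<bullet> e < g (x - (x \<bullet> e) *\<^sub>R e)})"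

definition lipschitz_domain :: "'a::euclidean_space set \<Rightarrow> bool" where
  "lipschitz_domain S \<longleftrightarrow> open S \<and> connected S \<and> S \<noteq> {} \<and> lipschitz_boundary S"

definition mesh :: "'a::euclidean_space set \<Rightarrow> 'a set set \<Rightarrow> bool" where
  "mesh \<Omega> \<T> \<longleftrightarrow> finite \<T> \<and> pairwise disjnt \<T> \<and>
     (\<forall>T\<in>\<T>. lipschitz_domain T \<and> T \<subseteq> \<Omega>) \<and> closure \<Omega> = (\<Union>T\<in>\<T>. closure T)"


section \<open>Test functions and classical differential operators\<close>

text \<open>Since the domain is finite-dimensional, \<open>Ck (Suc k) f\<close> says that \<open>f\<close> is everywhere
  differentiable and all its directional derivatives are of class \<open>Ck k\<close>.\<close>

primrec Ck :: "nat \<Rightarrow> ('a::euclidean_space \<Rightarrow> 'b::euclidean_space) \<Rightarrow> bool" where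
  "Ck 0 f \<longleftrightarrow> continuous_on UNIV f"
| "Ck (Suc k) f \<longleftrightarrow> (\<forall>x. f differentiable (at x)) \<and>
     (\<forall>h. Ck k (\<lambda>x. frechet_derivative f (at x) h))"

definition test_fun :: "'a::euclidean_space set \<Rightarrow> ('a \<Rightarrow> 'b::euclidean_space) set" where
  "test_fun S = {\<phi>. (\<forall>k. Ck k \<phi>) \<and> compact (closure {x. \<phi> x \<noteq> 0}) \<and> closure {x. \<phi> x \<noteq> 0} \<subseteq> S}"

definition cgrad :: "('a::euclidean_space \<Rightarrow> real) \<Rightarrow> 'a \<Rightarrow> 'a" where
  "cgrad \<phi> x = (\<Sum>i\<in>Basis. frechet_derivative \<phi> (at x) i *\<^sub>R i)"

definition cdiv :: "('a::euclidean_space \<Rightarrow> 'a) \<Rightarrow> 'a \<Rightarrow> real" where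
  "cdiv \<phi> x = (\<Sum>i\<in>Basis. frechet_derivative \<phi> (at x) i \<bullet> i)"

abbreviation cgrad_div :: "('a::euclidean_space \<Rightarrow> 'a) \<Rightarrow> 'a \<Rightarrow> 'a" where
  "cgrad_div \<phi> \<equiv> cgrad (cdiv \<phi>)"


section \<open>Square-integrable functions\<close>

text \<open>Elements of \<open>L2\<close>-type spaces are represented by functions on the whole space, of which only the
  values on \<open>S\<close> matter; equality in these spaces is equality almost everywhere on \<open>S\<close>.\<close>

definition L2 :: "'a::euclidean_space set \<Rightarrow> ('a \<Rightarrow> 'b::euclidean_space) set" where
  "L2 S = {f \<in> borel_measurable (lebesgue_on S). integrable (lebesgue_on S) (\<lambda>x. (norm (f x))\<^sup>2)}"

definition L2_inner ::
  "'a::euclidean_space set \<Rightarrow> ('a \<Rightarrow> 'b::euclidean_space) \<Rightarrow> ('a \<Rightarrow> 'b) \<Rightarrow> real" where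
  "L2_inner S f g = (LINT x|lebesgue_on S. f x \<bullet> g x)"

definition L2_norm :: "'a::euclidean_space set \<Rightarrow> ('a \<Rightarrow> 'b::euclidean_space) \<Rightarrow> real" where
  "L2_norm S f = sqrt (L2_inner S f f)"

definition ae_eq ::
  "'a::euclidean_space set \<Rightarrow> ('a \<Rightarrow> 'b::euclidean_space) \<Rightarrow> ('a \<Rightarrow> 'b) \<Rightarrow> bool" where
  "ae_eq S f g \<longleftrightarrow> (AE x in lebesgue_on S. f x = g x)"


section \<open>Weak derivatives and Sobolev spaces\<close>

definition is_weak_grad ::
  "'a::euclidean_space set \<Rightarrow> ('a \<Rightarrow> real) \<Rightarrow> ('a \<Rightarrow> 'a) \<Rightarrow> bool" where
  "is_weak_grad S v g \<longleftrightarrow> g \<in> L2 S \<and> (\<forall>\<phi>\<in>test_fun S. L2_inner S g \<phi> = - L2_inner S v (cdiv \<phi>))"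

definition is_weak_div ::
  "'a::euclidean_space set \<Rightarrow> ('a \<Rightarrow> 'a) \<Rightarrow> ('a \<Rightarrow> real) \<Rightarrow> bool" where
  "is_weak_div S \<tau> q \<longleftrightarrow> q \<in> L2 S \<and> (\<forall>\<phi>\<in>test_fun S. L2_inner S q \<phi> = - L2_inner S \<tau> (cgrad \<phi>))"

definition H1 :: "'a::euclidean_space set \<Rightarrow> ('a \<Rightarrow> real) set" where
  "H1 S = {v \<in> L2 S. \<exists>g. is_weak_grad S v g}"

definition Hdiv :: "'a::euclidean_space set \<Rightarrow> ('a \<Rightarrow> 'a) set" where
  "Hdiv S = {\<tau> \<in> L2 S. \<exists>q. is_weak_div S \<tau> q}"

text \<open>Weak derivatives are unique up to null sets of \<open>S\<close>, so all integrals below are independent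
  of the chosen representative.\<close>

definition wgrad :: "'a::euclidean_space set \<Rightarrow> ('a \<Rightarrow> real) \<Rightarrow> 'a \<Rightarrow> 'a" where
  "wgrad S v = (SOME g. is_weak_grad S v g)"

definition wdiv :: "'a::euclidean_space set \<Rightarrow> ('a \<Rightarrow> 'a) \<Rightarrow> 'a \<Rightarrow> real" where
  "wdiv S \<tau> = (SOME q. is_weak_div S \<tau> q)"

definition H1_norm :: "'a::euclidean_space set \<Rightarrow> ('a \<Rightarrow> real) \<Rightarrow> real" where
  "H1_norm S v = sqrt ((L2_norm S v)\<^sup>2 + (L2_norm S (wgrad S v))\<^sup>2)"

definition Hdiv_norm :: "'a::euclidean_space set \<Rightarrow> ('a \<Rightarrow> 'a) \<Rightarrow> real" where
  "Hdiv_norm S \<tau> = sqrt ((L2_norm S \<tau>)\<^sup>2 + (L2_norm S (wdiv S \<tau>))\<^sup>2)"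

text \<open>\<open>H1_0\<close> is the closure of the test functions in \<open>H1\<close>.\<close>

definition H1_0 :: "'a::euclidean_space set \<Rightarrow> ('a \<Rightarrow> real) set" where
  "H1_0 S = {v \<in> H1 S. \<forall>\<epsilon>>0. \<exists>\<phi>\<in>test_fun S. H1_norm S (\<lambda>x. v x - \<phi> x) < \<epsilon>}"

text \<open>The normal trace of \<open>\<tau> \<in> Hdiv S\<close> on the boundary, as a functional acting on \<open>H1 S\<close>
  by Green's formula.\<close>

definition normal_trace :: "'a::euclidean_space set \<Rightarrow> ('a \<Rightarrow> 'a) \<Rightarrow> ('a \<Rightarrow> real) \<Rightarrow> real" where
  "normal_trace S \<tau> v = L2_inner S v (wdiv S \<tau>) + L2_inner S (wgrad S v) \<tau>"

definition Hdiv_0 :: "'a::euclidean_space set \<Rightarrow> ('a \<Rightarrow> 'a) set" where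
  "Hdiv_0 S = {\<tau> \<in> Hdiv S. \<forall>v\<in>H1 S. normal_trace S \<tau> v = 0}"


section \<open>Product spaces and traces on a mesh\<close>

text \<open>An element of a product space over \<open>\<T>\<close> is a family of functions indexed by the elements of
  \<open>\<T>\<close>; a function \<open>v\<close> on \<open>\<Omega>\<close> is identified with the constant family \<open>\<lambda>T. v\<close>.\<close>

definition H1_mesh :: "'a::euclidean_space set set \<Rightarrow> ('a set \<Rightarrow> 'a \<Rightarrow> real) set" where
  "H1_mesh \<T> = Pi \<T> H1"

definition Hdiv_mesh :: "'a::euclidean_space set set \<Rightarrow> ('a set \<Rightarrow> 'a \<Rightarrow> 'a) set" where
  "Hdiv_mesh \<T> = Pi \<T> Hdiv"

definition mesh_inner :: "'a::euclidean_space set set \<Rightarrow>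
    ('a set \<Rightarrow> 'a \<Rightarrow> 'b::euclidean_space) \<Rightarrow> ('a set \<Rightarrow> 'a \<Rightarrow> 'b) \<Rightarrow> real" where
  "mesh_inner \<T> f g = (\<Sum>T\<in>\<T>. L2_inner T (f T) (g T))"

definition mesh_grad :: "('a::euclidean_space set \<Rightarrow> 'a \<Rightarrow> real) \<Rightarrow> 'a set \<Rightarrow> 'a \<Rightarrow> 'a" where
  "mesh_grad v T = wgrad T (v T)"

definition mesh_div :: "('a::euclidean_space set \<Rightarrow> 'a \<Rightarrow> 'a) \<Rightarrow> 'a set \<Rightarrow> 'a \<Rightarrow> real" where
  "mesh_div \<tau> T = wdiv T (\<tau> T)"

text \<open>Functionals on the product spaces. By the restriction they are \<open>undefined\<close> outside the
  respective space, so that equality of functionals is equality in HOL.\<close>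

type_synonym 'a Hdiv_functional = "('a set \<Rightarrow> 'a \<Rightarrow> 'a) \<Rightarrow> real"
type_synonym 'a H1_functional = "('a set \<Rightarrow> 'a \<Rightarrow> real) \<Rightarrow> real"

definition tr_grad ::
  "'a::euclidean_space set set \<Rightarrow> ('a set \<Rightarrow> 'a \<Rightarrow> real) \<Rightarrow> 'a Hdiv_functional" where
  "tr_grad \<T> v =
     (\<lambda>\<tau>\<in>Hdiv_mesh \<T>. mesh_inner \<T> v (mesh_div \<tau>) + mesh_inner \<T> (mesh_grad v) \<tau>)"

definition tr_div ::
  "'a::euclidean_space set set \<Rightarrow> ('a set \<Rightarrow> 'a \<Rightarrow> 'a) \<Rightarrow> 'a H1_functional" where
  "tr_div \<T> \<tau> =
     (\<lambda>v\<in>H1_mesh \<T>. mesh_inner \<T> v (mesh_div \<tau>) + mesh_inner \<T> (mesh_grad v) \<tau>)"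

definition Hhalf :: "'a::euclidean_space set \<Rightarrow> 'a set set \<Rightarrow> 'a Hdiv_functional set" where
  "Hhalf \<Omega> \<T> = (\<lambda>v. tr_grad \<T> (\<lambda>T. v)) ` H1 \<Omega>"

definition Hhalf_0 :: "'a::euclidean_space set \<Rightarrow> 'a set set \<Rightarrow> 'a Hdiv_functional set" where
  "Hhalf_0 \<Omega> \<T> = (\<lambda>v. tr_grad \<T> (\<lambda>T. v)) ` H1_0 \<Omega>"

definition Hmhalf :: "'a::euclidean_space set \<Rightarrow> 'a set set \<Rightarrow> 'a H1_functional set" where
  "Hmhalf \<Omega> \<T> = (\<lambda>\<tau>. tr_div \<T> (\<lambda>T. \<tau>)) ` Hdiv \<Omega>"

definition Hmhalf_0 :: "'a::euclidean_space set \<Rightarrow> 'a set set \<Rightarrow> 'a H1_functional set" where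
  "Hmhalf_0 \<Omega> \<T> = (\<lambda>\<tau>. tr_div \<T> (\<lambda>T. \<tau>)) ` Hdiv_0 \<Omega>"

definition Hhalf_norm ::
  "'a::euclidean_space set \<Rightarrow> 'a set set \<Rightarrow> 'a Hdiv_functional \<Rightarrow> real" where
  "Hhalf_norm \<Omega> \<T> vh = Inf {H1_norm \<Omega> v | v. v \<in> H1 \<Omega> \<and> tr_grad \<T> (\<lambda>T. v) = vh}"

definition Hmhalf_norm ::
  "'a::euclidean_space set \<Rightarrow> 'a set set \<Rightarrow> 'a H1_functional \<Rightarrow> real" where
  "Hmhalf_norm \<Omega> \<T> \<tau>h = Inf {Hdiv_norm \<Omega> \<tau> | \<tau>. \<tau> \<in> Hdiv \<Omega> \<and> tr_div \<T> (\<lambda>T. \<tau>) = \<tau>h}"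


section \<open>The ultraweak formulation\<close>

type_synonym 'a trial =
  "('a \<Rightarrow> 'a) \<times> ('a \<Rightarrow> real) \<times> ('a \<Rightarrow> 'a) \<times> ('a \<Rightarrow> real) \<times>
   'a H1_functional \<times> 'a Hdiv_functional \<times> 'a H1_functional \<times> 'a Hdiv_functional"

type_synonym 'a test =
  "('a set \<Rightarrow> 'a \<Rightarrow> 'a) \<times> ('a set \<Rightarrow> 'a \<Rightarrow> real) \<times> ('a set \<Rightarrow> 'a \<Rightarrow> 'a) \<times> ('a set \<Rightarrow> 'a \<Rightarrow> real)"

definition U_space :: "'a::euclidean_space set \<Rightarrow> 'a set set \<Rightarrow> 'a trial set" where
  "U_space \<Omega> \<T> = L2 \<Omega> \<times> L2 \<Omega> \<times> L2 \<Omega> \<times> L2 \<Omega> \<times>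
     Hmhalf_0 \<Omega> \<T> \<times> Hhalf_0 \<Omega> \<T> \<times> Hmhalf \<Omega> \<T> \<times> Hhalf \<Omega> \<T>"

definition V_space :: "'a::euclidean_space set set \<Rightarrow> 'a test set" where
  "V_space \<T> = Hdiv_mesh \<T> \<times> H1_mesh \<T> \<times> Hdiv_mesh \<T> \<times> H1_mesh \<T>"

text \<open>Equality in \<open>U_space \<Omega> \<T>\<close>.\<close>

fun U_eq :: "'a::euclidean_space set \<Rightarrow> 'a trial \<Rightarrow> 'a trial \<Rightarrow> bool" where
  "U_eq \<Omega> (u1, u2, u3, u4, uh1, uh2, uh3, uh4) (w1, w2, w3, w4, wh1, wh2, wh3, wh4) \<longleftrightarrow>
     ae_eq \<Omega> u1 w1 \<and> ae_eq \<Omega> u2 w2 \<and> ae_eq \<Omega> u3 w3 \<and> ae_eq \<Omega> u4 w4 \<and>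
     uh1 = wh1 \<and> uh2 = wh2 \<and> uh3 = wh3 \<and> uh4 = wh4"

fun U_norm :: "'a::euclidean_space set \<Rightarrow> 'a set set \<Rightarrow> 'a trial \<Rightarrow> real" where
  "U_norm \<Omega> \<T> (u1, u2, u3, u4, uh1, uh2, uh3, uh4) =
     sqrt ((L2_norm \<Omega> u1)\<^sup>2 + (L2_norm \<Omega> u2)\<^sup>2 + (L2_norm \<Omega> u3)\<^sup>2 + (L2_norm \<Omega> u4)\<^sup>2 +
           (Hmhalf_norm \<Omega> \<T> uh1)\<^sup>2 + (Hhalf_norm \<Omega> \<T> uh2)\<^sup>2 +
           (Hmhalf_norm \<Omega> \<T> uh3)\<^sup>2 + (Hhalf_norm \<Omega> \<T> uh4)\<^sup>2)"

fun b_form :: "'a::euclidean_space set set \<Rightarrow> 'a trial \<Rightarrow> 'a test \<Rightarrow> real" where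
  "b_form \<T> (u1, u2, u3, u4, uh1, uh2, uh3, uh4) (v1, v2, v3, v4) =
     mesh_inner \<T> (\<lambda>T. u1) (\<lambda>T x. v1 T x - mesh_grad v4 T x)
     - mesh_inner \<T> (\<lambda>T. u2) (\<lambda>T x. v4 T x + mesh_div v3 T x)
     - mesh_inner \<T> (\<lambda>T. u3) (\<lambda>T x. v3 T x + mesh_grad v2 T x)
     - mesh_inner \<T> (\<lambda>T. u4) (\<lambda>T x. v2 T x + mesh_div v1 T x)
     + uh1 v4 + uh2 v3 + uh3 v2 + uh4 v1"

fun L_form :: "'a::euclidean_space set set \<Rightarrow> ('a \<Rightarrow> 'a) \<Rightarrow> 'a test \<Rightarrow> real" where
  "L_form \<T> f (v1, v2, v3, v4) = mesh_inner \<T> (\<lambda>T. f) v1"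


section \<open>The boundary value problem\<close>

text \<open>
  The differential equation is taken in the sense of distributions: for \<open>u \<in> L2 \<Omega>\<close>, the operator
  \<open>grad div\<close> being formally self-adjoint, the distribution \<open>(grad div)\<^sup>2 u\<close> maps a test field \<open>\<phi>\<close> to
  \<open>(u, (grad div)\<^sup>2 \<phi>)\<close>. The boundary conditions are \<open>div u = 0\<close> and \<open>u \<bullet> n = 0\<close> in the sense
  of traces.
\<close>

definition solves_bvp :: "'a::euclidean_space set \<Rightarrow> ('a \<Rightarrow> 'a) \<Rightarrow> ('a \<Rightarrow> 'a) \<Rightarrow> bool" where
  "solves_bvp \<Omega> f u \<longleftrightarrow>
     u \<in> Hdiv \<Omega> \<and> wdiv \<Omega> u \<in> H1 \<Omega> \<and>
     (\<forall>\<phi>\<in>test_fun \<Omega>.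
        L2_inner \<Omega> u (cgrad_div (cgrad_div \<phi>)) + L2_inner \<Omega> u \<phi> = L2_inner \<Omega> f \<phi>) \<and>
     wdiv \<Omega> u \<in> H1_0 \<Omega> \<and> u \<in> Hdiv_0 \<Omega>"

end

theory Submission
  imports Defs "HOL-Computational_Algebra.Polynomial"
begin

text \<open>
  The formulation is equivalent to the first-order system \<open>div u1 = u2\<close>, \<open>grad u2 = u3\<close>,
  \<open>div u3 = u4\<close>, \<open>u1 + grad u4 = f\<close> with \<open>u1 \<in> Hdiv_0\<close>, \<open>u2 \<in> H1_0\<close>, \<open>u3 \<in> Hdiv\<close>, \<open>u4 \<in> H1\<close>, where
  the skeleton unknowns are the traces of \<open>u1\<close>, \<open>u2\<close>, \<open>u3\<close>, \<open>u4\<close>. One direction is elementwise integration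
  by parts. For the other one, global test functions reveal the weak derivatives (the skeleton is a
  null set), and the boundary conditions are recovered because a function in \<open>H1\<close> whose trace
  vanishes on \<open>Hdiv\<close> belongs to \<open>H1_0\<close>. Hence the constant depends on the system only, not on the mesh.

  The system is solved by minimising \<open>\<parallel>\<tau>\<parallel>\<^sup>2 + \<parallel>grad div \<tau> - f\<parallel>\<^sup>2\<close> over all \<open>\<tau>\<close> with \<open>div \<tau> \<in> H1\<close>.
  The analytic core is the estimate \<open>\<parallel>div \<tau>\<parallel> \<le> C (\<parallel>\<tau>\<parallel> + \<parallel>grad div \<tau>\<parallel>)\<close>, which makes this space complete
  and bounds \<open>u4 = div u3\<close>. It is a local statement that follows from
  \<open>\<parallel>p(\<cdot> + h) - p\<parallel> \<le> |h| \<parallel>grad p\<parallel>\<close>; neither a density nor a compactness theorem for Sobolev spaces is needed.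
\<close>

section \<open>Spaces of functions with a semi-inner product\<close>

text \<open>The boundary value problem has the form \<open>A' A u1 + u1 = f\<close>, where
  \<open>A\<close> is \<open>grad div\<close> with both boundary conditions and \<open>A'\<close> is
  \<open>grad div\<close> on its maximal domain. Minimising over \<open>u1\<close> would yield
  \<open>u3 = grad div u1\<close> with only the distribution \<open>grad div u3\<close> known to lie
  in \<open>L2\<close>; splitting this into \<open>u3 \<in> Hdiv\<close> and
  \<open>div u3 \<in> H1\<close> would require a regularity theorem for distributions with gradient
  in \<open>L2\<close>. With \<open>u3\<close> as the variational unknown both memberships are part
  of the space, and the conditions on \<open>u1\<close> and \<open>u2\<close> come out as natural
  ones because the test fields are unrestricted. The price is completeness of the maximal domain
  under a norm that does not contain \<open>div \<tau>\<close>. A purely interior bound for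
  \<open>div \<tau>\<close> would degenerate at the boundary; the Lipschitz charts supply a
  direction in which a boundary strip can be pushed inwards by a fixed distance.

  All functions are representatives and weak derivatives are chosen by \<open>SOME\<close>, so
  identities between them hold almost everywhere only; this is the reason for the many congruence
  lemmas.\<close>

definition nrm :: "('v \<Rightarrow> 'v \<Rightarrow> real) \<Rightarrow> 'v \<Rightarrow> real" where
  "nrm B u = sqrt (B u u)"

text \<open>Elements are functions rather than classes modulo null sets, so \<open>B u u = 0\<close>
  does not force \<open>u = 0\<close> and \<open>nrm\<close> is only a seminorm. The carrier is an
  explicit set because the spaces to be used depend on a set \<open>S\<close> and share their
  function types.\<close>

locale pre_hilbert =
  fixes V :: "('x \<Rightarrow> 'b::real_vector) set" and B :: "('x \<Rightarrow> 'b) \<Rightarrow> ('x \<Rightarrow> 'b) \<Rightarrow> real"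
  assumes zero: "(\<lambda>x. 0) \<in> V"
    and add: "\<And>u v. u \<in> V \<Longrightarrow> v \<in> V \<Longrightarrow> (\<lambda>x. u x + v x) \<in> V"
    and scale: "\<And>c u. u \<in> V \<Longrightarrow> (\<lambda>x. c *\<^sub>R u x) \<in> V"
    and B_add: "\<And>u v w. u \<in> V \<Longrightarrow> v \<in> V \<Longrightarrow> w \<in> V \<Longrightarrow> B (\<lambda>x. u x + v x) w = B u w + B v w"
    and B_scale: "\<And>c u w. u \<in> V \<Longrightarrow> w \<in> V \<Longrightarrow> B (\<lambda>x. c *\<^sub>R u x) w = c * B u w"
    and B_sym: "\<And>u v. u \<in> V \<Longrightarrow> v \<in> V \<Longrightarrow> B u v = B v u"
    and B_nonneg: "\<And>u. u \<in> V \<Longrightarrow> 0 \<le> B u u"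
begin

lemma diff: "u \<in> V \<Longrightarrow> v \<in> V \<Longrightarrow> (\<lambda>x. u x - v x) \<in> V"
  using add[of u "\<lambda>x. (-1) *\<^sub>R v x"] scale[of v "-1"] by simp

lemma B_diff:
  assumes "u \<in> V" "v \<in> V" "w \<in> V"
  shows "B (\<lambda>x. u x - v x) w = B u w - B v w"
  using B_add[OF assms(1) scale[OF assms(2), of "-1"] assms(3)] B_scale[OF assms(2,3), of "-1"]
  by simp

lemma B_zero: "w \<in> V \<Longrightarrow> B (\<lambda>x. 0) w = 0"
  using B_scale[OF zero, of w 0] by simp

lemma B_add2:
  "u \<in> V \<Longrightarrow> v \<in> V \<Longrightarrow> w \<in> V \<Longrightarrow> B w (\<lambda>x. u x + v x) = B w u + B w v"
  by (simp add: B_sym[of w] add B_add)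

lemma B_diff2:
  "u \<in> V \<Longrightarrow> v \<in> V \<Longrightarrow> w \<in> V \<Longrightarrow> B w (\<lambda>x. u x - v x) = B w u - B w v"
  by (simp add: B_sym[of w] diff B_diff)

lemma B_scale2: "u \<in> V \<Longrightarrow> w \<in> V \<Longrightarrow> B w (\<lambda>x. c *\<^sub>R u x) = c * B w u"
  by (simp add: B_sym[of w] scale B_scale)

lemma nrm_nonneg [simp]: "u \<in> V \<Longrightarrow> 0 \<le> nrm B u"
  by (simp add: nrm_def B_nonneg)

lemma nrm_sq: "u \<in> V \<Longrightarrow> (nrm B u)\<^sup>2 = B u u"
  by (simp add: nrm_def B_nonneg)

lemma expand_line:
  assumes "u \<in> V" "v \<in> V"
  shows "B (\<lambda>x. u x + t *\<^sub>R v x) (\<lambda>x. u x + t *\<^sub>R v x) = B u u + 2 * t * B u v + t\<^sup>2 * B v v"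
  using assms by (simp add: B_add B_add2 B_scale B_scale2 add scale B_sym[of v u]
      power2_eq_square algebra_simps)

lemma cs_sq:
  assumes "u \<in> V" "v \<in> V"
  shows "(B u v)\<^sup>2 \<le> B u u * B v v"
proof -
  have pos: "0 \<le> B u u + 2 * t * B u v + t\<^sup>2 * B v v" for t
    using B_nonneg[OF add[OF assms(1) scale[OF assms(2), of t]]] expand_line[OF assms, of t] by simp
  show ?thesis
  proof (cases "B v v = 0")
    case True
    \<comment> \<open>\<open>B v v = 0\<close> need not mean \<open>v = 0\<close>. The quadratic is
      now affine in \<open>t\<close> and bounded below, so its slope vanishes; otherwise the
      \<open>t\<close> used here would give it the value -1.\<close>
    have "B u v = 0"
    proof (rule ccontr)
      assume ne: "B u v \<noteq> 0"
      have "0 \<le> B u u + 2 * (-(B u u + 1) / (2 * B u v)) * B u v"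
        using pos[of "-(B u u + 1) / (2 * B u v)"] True by simp
      also have "2 * (-(B u u + 1) / (2 * B u v)) * B u v = -(B u u + 1)"
        using ne by (simp add: field_simps)
      finally show False by simp
    qed
    then show ?thesis using True by simp
  next
    case False
    then have pv: "B v v > 0" using B_nonneg[OF assms(2)] by simp
    \<comment> \<open>This \<open>t\<close> is the minimiser of the quadratic.\<close>
    have "0 \<le> B u u + 2 * (- B u v / B v v) * B u v + (- B u v / B v v)\<^sup>2 * B v v"
      by (rule pos)
    also have "\<dots> = B u u - (B u v)\<^sup>2 / B v v"
      using pv by (simp add: power2_eq_square field_simps)
    finally have "(B u v)\<^sup>2 / B v v \<le> B u u" by simp
    then show ?thesis using pv by (simp add: pos_divide_le_eq)
  qed
qed

lemma cs:
  assumes "u \<in> V" "v \<in> V"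
  shows "\<bar>B u v\<bar> \<le> nrm B u * nrm B v"
  using real_sqrt_le_mono[OF cs_sq[OF assms]] by (simp add: nrm_def real_sqrt_mult)

lemma nrm_add:
  assumes "u \<in> V" "v \<in> V"
  shows "nrm B (\<lambda>x. u x + v x) \<le> nrm B u + nrm B v"
proof (rule power2_le_imp_le)
  have "(nrm B (\<lambda>x. u x + v x))\<^sup>2 = B u u + 2 * B u v + B v v"
    using expand_line[OF assms, of 1] nrm_sq[OF add[OF assms]] by simp
  also have "\<dots> \<le> (nrm B u + nrm B v)\<^sup>2"
    using cs[OF assms] nrm_sq[OF assms(1)] nrm_sq[OF assms(2)] by (simp add: power2_sum)
  finally show "(nrm B (\<lambda>x. u x + v x))\<^sup>2 \<le> (nrm B u + nrm B v)\<^sup>2" .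
qed (use assms in simp)

lemma nrm_scale: "u \<in> V \<Longrightarrow> nrm B (\<lambda>x. c *\<^sub>R u x) = \<bar>c\<bar> * nrm B u"
  by (simp add: nrm_def B_scale B_scale2 scale real_sqrt_mult flip: power2_eq_square mult.assoc)

lemma nrm_minus_commute:
  assumes "u \<in> V" "v \<in> V"
  shows "nrm B (\<lambda>x. u x - v x) = nrm B (\<lambda>x. v x - u x)"
  using nrm_scale[OF diff[OF assms], of "-1"] by simp

lemma nrm_triangle:
  assumes "u \<in> V" "v \<in> V" "w \<in> V"
  shows "nrm B (\<lambda>x. u x - w x) \<le> nrm B (\<lambda>x. u x - v x) + nrm B (\<lambda>x. v x - w x)"
  using nrm_add[OF diff[OF assms(1,2)] diff[OF assms(2,3)]] by simp

section \<open>Completeness, limits and the Riesz representation\<close>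

definition Cauchy_seq :: "(nat \<Rightarrow> 'x \<Rightarrow> 'b) \<Rightarrow> bool" where
  "Cauchy_seq X \<longleftrightarrow> (\<forall>n. X n \<in> V) \<and>
     (\<forall>e>0. \<exists>N. \<forall>m\<ge>N. \<forall>n\<ge>N. nrm B (\<lambda>x. X m x - X n x) < e)"

definition complete_space :: bool where
  "complete_space \<longleftrightarrow>
     (\<forall>X. Cauchy_seq X \<longrightarrow> (\<exists>u\<in>V. (\<lambda>n. nrm B (\<lambda>x. X n x - u x)) \<longlonglongrightarrow> 0))"

lemma complete_spaceD:
  assumes complete_space "Cauchy_seq X"
  obtains u where "u \<in> V" "(\<lambda>n. nrm B (\<lambda>x. X n x - u x)) \<longlonglongrightarrow> 0"
  using assms unfolding complete_space_def by blast

lemma nrm_tendsto: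
  assumes "\<And>n. X n \<in> V" "u \<in> V" and lim: "(\<lambda>n. nrm B (\<lambda>x. X n x - u x)) \<longlonglongrightarrow> 0"
  shows "(\<lambda>n. nrm B (X n)) \<longlonglongrightarrow> nrm B u"
proof -
  have "\<bar>nrm B (X n) - nrm B u\<bar> \<le> nrm B (\<lambda>x. X n x - u x)" for n
    using nrm_add[OF diff[OF assms(1,2)] assms(2), of n]
      nrm_add[OF diff[OF assms(2) assms(1)] assms(1), of n n] nrm_minus_commute[OF assms(1,2), of n]
    by simp
  then have "(\<lambda>n. nrm B (X n) - nrm B u) \<longlonglongrightarrow> 0"
    by (intro Lim_null_comparison[OF _ lim]) simp
  then show ?thesis by (simp add: LIM_zero_iff)
qed

lemma B_tendsto:
  assumes "\<And>n. X n \<in> V" "u \<in> V" "v \<in> V" and lim: "(\<lambda>n. nrm B (\<lambda>x. X n x - u x)) \<longlonglongrightarrow> 0"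
  shows "(\<lambda>n. B (X n) v) \<longlonglongrightarrow> B u v"
proof -
  have "\<bar>B (X n) v - B u v\<bar> \<le> nrm B (\<lambda>x. X n x - u x) * nrm B v" for n
    using cs[OF diff[OF assms(1,2)] assms(3), of n] assms by (simp add: B_diff)
  moreover have "(\<lambda>n. nrm B (\<lambda>x. X n x - u x) * nrm B v) \<longlonglongrightarrow> 0"
    using tendsto_mult_right[OF lim, of "nrm B v"] by simp
  ultimately have "(\<lambda>n. B (X n) v - B u v) \<longlonglongrightarrow> 0"
    by (intro Lim_null_comparison[of "\<lambda>n. B (X n) v - B u v"] always_eventually) simp_all
  then show ?thesis by (simp add: LIM_zero_iff)
qed

text \<open>The midpoint stays visible as a member of \<open>V\<close>, since \<open>riesz\<close>
  compares its value with the infimum.\<close>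

lemma parallelogram:
  assumes "u \<in> V" "v \<in> V"
  shows "B (\<lambda>x. u x - v x) (\<lambda>x. u x - v x) =
    2 * B u u + 2 * B v v - 4 * B (\<lambda>x. (1/2) *\<^sub>R (u x + v x)) (\<lambda>x. (1/2) *\<^sub>R (u x + v x))"
  using assms by (simp add: B_diff B_diff2 diff B_add B_add2 add scale B_scale B_scale2 B_sym[of v u]) (simp add: field_simps)

text \<open>The representing element minimises \<open>B v v - 2 * l v\<close>; by the parallelogram identity
  every minimising sequence is a Cauchy sequence.\<close>

theorem riesz:
  assumes complete_space
    and l_add: "\<And>u v. u \<in> V \<Longrightarrow> v \<in> V \<Longrightarrow> l (\<lambda>x. u x + v x) = l u + l v"
    and l_scale: "\<And>c u. u \<in> V \<Longrightarrow> l (\<lambda>x. c *\<^sub>R u x) = c * l u"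
    and l_bound: "\<And>u. u \<in> V \<Longrightarrow> \<bar>l u\<bar> \<le> M * nrm B u"
  obtains u where "u \<in> V" "\<And>v. v \<in> V \<Longrightarrow> B u v = l v"
proof -
  define J where "J v = B v v - 2 * l v" for v
  define m where "m = Inf (J ` V)"
  have J_lower: "- M\<^sup>2 \<le> J v" if "v \<in> V" for v
  proof -
    have "0 \<le> (nrm B v - M)\<^sup>2" by simp
    then show ?thesis
      using l_bound[OF that] nrm_sq[OF that] unfolding J_def by (simp add: power2_diff algebra_simps)
  qed
  have bdd: "bdd_below (J ` V)" using J_lower by (auto intro!: bdd_belowI)
  have m_le: "m \<le> J v" if "v \<in> V" for v
    unfolding m_def using bdd that by (auto intro: cInf_lower)
  have "\<exists>v\<in>V. J v < m + 1 / real (Suc n)" for n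
    using cInf_lessD[of "J ` V" "m + 1 / real (Suc n)"] zero unfolding m_def by force
  then obtain X where X: "\<And>n. X n \<in> V" "\<And>n. J (X n) < m + 1 / real (Suc n)" by metis
  \<comment> \<open>\<open>J\<close> at the midpoint is at least \<open>m\<close>; its linear part
    turns the right-hand side of the parallelogram identity into values of \<open>J\<close>.\<close>
  have J_mid: "B (\<lambda>x. u x - v x) (\<lambda>x. u x - v x) \<le> 2 * (J u - m) + 2 * (J v - m)"
    if "u \<in> V" "v \<in> V" for u v
  proof -
    have "m \<le> J (\<lambda>x. (1/2) *\<^sub>R (u x + v x))"
      by (intro m_le scale add that)
    then show ?thesis
      unfolding J_def parallelogram[OF that] using that by (simp only: l_scale l_add add) (simp add: field_simps)
  qed
  have "Cauchy_seq X"
    unfolding Cauchy_seq_def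
  proof (intro conjI allI impI X)
    fix e :: real assume "e > 0"
    obtain N where N: "4 / real (Suc N) < e\<^sup>2"
      using reals_Archimedean[of "e\<^sup>2/4"] \<open>e > 0\<close> by (auto simp: field_simps)
    show "\<exists>N. \<forall>m\<ge>N. \<forall>n\<ge>N. nrm B (\<lambda>x. X m x - X n x) < e"
    proof (intro exI allI impI)
      fix i j assume ij: "N \<le> i" "N \<le> j"
      have le: "1 / real (Suc i) \<le> 1 / real (Suc N)" "1 / real (Suc j) \<le> 1 / real (Suc N)"
        using ij by (auto intro!: divide_left_mono)
      have "B (\<lambda>x. X i x - X j x) (\<lambda>x. X i x - X j x) \<le> 2 * (J (X i) - m) + 2 * (J (X j) - m)"
        by (rule J_mid; rule X)
      also have "\<dots> < 4 / real (Suc N)"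
        using X(2)[of i] X(2)[of j] le by simp
      also have "\<dots> < e\<^sup>2" by (rule N)
      finally show "nrm B (\<lambda>x. X i x - X j x) < e"
        unfolding nrm_def using \<open>e > 0\<close> by (simp add: real_less_lsqrt)
    qed
  qed
  then obtain u where u: "u \<in> V" "(\<lambda>n. nrm B (\<lambda>x. X n x - u x)) \<longlonglongrightarrow> 0"
    using complete_spaceD assms(1) by blast
  have "(\<lambda>n. (nrm B (X n))\<^sup>2 - 2 * l (X n)) \<longlonglongrightarrow> (nrm B u)\<^sup>2 - 2 * l u"
  proof (intro tendsto_intros nrm_tendsto X u)
    have bound: "\<bar>l (X n) - l u\<bar> \<le> M * nrm B (\<lambda>x. X n x - u x)" for n
      using l_bound[OF diff[OF X(1) u(1)], of n] l_add[OF diff[OF X(1) u(1)] u(1), of n] by simp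
    have "(\<lambda>n. M * nrm B (\<lambda>x. X n x - u x)) \<longlonglongrightarrow> 0"
      using tendsto_mult_left[OF u(2), of M] by simp
    then have "(\<lambda>n. l (X n) - l u) \<longlonglongrightarrow> 0"
      using bound by (intro Lim_null_comparison[of "\<lambda>n. l (X n) - l u"]) simp_all
    then show "(\<lambda>n. l (X n)) \<longlonglongrightarrow> l u" by (simp add: LIM_zero_iff)
  qed
  then have JX: "(\<lambda>n. J (X n)) \<longlonglongrightarrow> J u" using X u by (simp add: J_def nrm_sq)
  have "(\<lambda>n. m + 1 / real (Suc n)) \<longlonglongrightarrow> m + 0"
    by (intro tendsto_intros LIMSEQ_Suc[OF lim_1_over_n])
  then have J_u: "J u \<le> m"
    by (intro LIMSEQ_le[OF JX]) (use X(2) less_imp_le in auto)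
  have "B u v = l v" if v: "v \<in> V" for v
  proof -
    have pos: "0 \<le> 2 * t * (B u v - l v) + t\<^sup>2 * B v v" for t
      using J_u m_le[OF add[OF u(1) scale[OF v, of t]]]
      unfolding J_def expand_line[OF u(1) v] by (simp add: l_add l_scale u v scale algebra_simps)
    have "B u v - l v = 0"
    proof (rule ccontr)
      define d where "d = B u v - l v"
      assume "B u v - l v \<noteq> 0"
      then have d: "d \<noteq> 0" by (simp add: d_def)
      \<comment> \<open>The optimal value would be \<open>- d / B v v\<close>; the added 1 keeps the
        denominator positive when \<open>B v v = 0\<close>. The quadratic is then multiplied by the
        square of that denominator to avoid fractions.\<close>
      define t where "t = - d / (B v v + 1)"
      have Bp: "B v v + 1 > 0" using B_nonneg[OF v] by simp
      have "0 \<le> (B v v + 1)\<^sup>2 * (2 * t * d + t\<^sup>2 * B v v)"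
        using pos[of t] by (simp add: d_def)
      also have "\<dots> = - 2 * d\<^sup>2 * (B v v + 1) + d\<^sup>2 * B v v"
      proof -
        have tb: "t * (B v v + 1) = - d" using Bp by (simp add: t_def)
        have "(B v v + 1)\<^sup>2 * (2 * t * d + t\<^sup>2 * B v v) =
            2 * (t * (B v v + 1)) * d * (B v v + 1) + (t * (B v v + 1))\<^sup>2 * B v v"
          by (simp add: power2_eq_square algebra_simps)
        then show ?thesis unfolding tb by (simp add: power2_eq_square)
      qed
      also have "\<dots> = - d\<^sup>2 * (B v v + 2)" by (simp add: algebra_simps)
      also have "\<dots> < 0" using d B_nonneg[OF v]
        by (metis add_nonneg_pos mult_minus_left mult_pos_pos neg_less_0_iff_less zero_less_numeral zero_less_power2)
      finally show False by simp
    qed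
    then show ?thesis by simp
  qed
  with u(1) show thesis by (rule that)
qed

section \<open>Subspaces and closures\<close>

lemma subspace_pre_hilbert:
  assumes "W \<subseteq> V" "(\<lambda>x. 0) \<in> W"
    and "\<And>u v. u \<in> W \<Longrightarrow> v \<in> W \<Longrightarrow> (\<lambda>x. u x + v x) \<in> W"
    and "\<And>c u. u \<in> W \<Longrightarrow> (\<lambda>x. c *\<^sub>R u x) \<in> W"
  shows "pre_hilbert W B"
  by (rule pre_hilbert.intro)
    (use assms B_add B_scale B_sym B_nonneg in \<open>auto simp: subset_iff\<close>)

text \<open>The closure in the seminorm, written with the same quantifiers as \<open>H1_0\<close>,
  which is the adherence of the test functions in \<open>H1\<close>.\<close>

definition adherence :: "('x \<Rightarrow> 'b) set \<Rightarrow> ('x \<Rightarrow> 'b) set" where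
  "adherence W = {v \<in> V. \<forall>e>0. \<exists>w\<in>W. nrm B (\<lambda>x. v x - w x) < e}"

lemma adherenceD: "v \<in> adherence W \<Longrightarrow> e > 0 \<Longrightarrow> \<exists>w\<in>W. nrm B (\<lambda>x. v x - w x) < e"
  by (simp add: adherence_def)

lemma adherence_seq:
  assumes "v \<in> adherence W" "W \<subseteq> V"
  obtains X where "\<And>n. X n \<in> W" "(\<lambda>n. nrm B (\<lambda>x. v x - X n x)) \<longlonglongrightarrow> 0"
proof -
  have "\<exists>w\<in>W. nrm B (\<lambda>x. v x - w x) < 1 / real (Suc n)" for n
    using assms unfolding adherence_def by simp
  then obtain X where X: "\<And>n. X n \<in> W" "\<And>n. nrm B (\<lambda>x. v x - X n x) < 1 / real (Suc n)" by metis
  show thesis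
  proof (rule that[of X])
    have "v \<in> V" "X n \<in> V" for n using assms X by (auto simp: adherence_def)
    then have "norm (nrm B (\<lambda>x. v x - X n x)) \<le> 1 / real (Suc n)" for n
      using X(2)[of n] by (simp add: diff less_imp_le)
    then show "(\<lambda>n. nrm B (\<lambda>x. v x - X n x)) \<longlonglongrightarrow> 0"
      by (intro Lim_null_comparison[OF _ LIMSEQ_Suc[OF lim_1_over_n]]) (simp del: of_nat_Suc)
  qed (use X in auto)
qed

lemma closure_pre_hilbert:
  assumes W: "W \<subseteq> V" "(\<lambda>x. 0) \<in> W"
    and W_add: "\<And>u v. u \<in> W \<Longrightarrow> v \<in> W \<Longrightarrow> (\<lambda>x. u x + v x) \<in> W"
    and W_scale: "\<And>c u. u \<in> W \<Longrightarrow> (\<lambda>x. c *\<^sub>R u x) \<in> W"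
  shows "pre_hilbert (adherence W) B"
proof (rule subspace_pre_hilbert)
  show "adherence W \<subseteq> V" by (auto simp: adherence_def)
  show "(\<lambda>x. 0) \<in> adherence W"
    using zero W(2) by (auto simp: adherence_def nrm_def B_zero intro!: bexI[of _ "\<lambda>x. 0"])
next
  fix u v assume uv: "u \<in> adherence W" "v \<in> adherence W"
  then have V: "u \<in> V" "v \<in> V" by (auto simp: adherence_def)
  have "\<exists>w\<in>W. nrm B (\<lambda>x. u x + v x - w x) < e" if "e > 0" for e
  proof -
    obtain a b where ab: "a \<in> W" "b \<in> W" "nrm B (\<lambda>x. u x - a x) < e/2" "nrm B (\<lambda>x. v x - b x) < e/2"
      using adherenceD[OF uv(1), of "e/2"] adherenceD[OF uv(2), of "e/2"] \<open>e > 0\<close> by auto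
    have "nrm B (\<lambda>x. (u x - a x) + (v x - b x)) < e"
      using nrm_add[OF diff diff, of u a v b] V ab W by (force simp: subset_iff)
    then show ?thesis using W_add[OF ab(1,2)] by (intro bexI[of _ "\<lambda>x. a x + b x"]) (simp_all add: algebra_simps)
  qed
  then show "(\<lambda>x. u x + v x) \<in> adherence W" using V by (auto simp: adherence_def add)
next
  fix c u assume u: "u \<in> adherence W"
  then have V: "u \<in> V" by (auto simp: adherence_def)
  have "\<exists>w\<in>W. nrm B (\<lambda>x. c *\<^sub>R u x - w x) < e" if "e > 0" for e
  proof -
    \<comment> \<open>The added 1 covers \<open>c = 0\<close>.\<close>
    obtain a where a: "a \<in> W" "nrm B (\<lambda>x. u x - a x) < e/(\<bar>c\<bar> + 1)"
      using adherenceD[OF u, of "e/(\<bar>c\<bar> + 1)"] \<open>e > 0\<close> by auto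
    have "a \<in> V" using a W by auto
    have "nrm B (\<lambda>x. c *\<^sub>R (u x - a x)) \<le> \<bar>c\<bar> * (e/(\<bar>c\<bar> + 1))"
      unfolding nrm_scale[OF diff[OF V \<open>a \<in> V\<close>]] using a by (intro mult_left_mono) auto
    also have "\<dots> < e" using \<open>e > 0\<close> by (simp add: field_simps add_strict_increasing)
    finally show ?thesis using W_scale[OF a(1), of c]
      by (intro bexI[of _ "\<lambda>x. c *\<^sub>R a x"]) (simp_all add: scaleR_diff_right)
  qed
  then show "(\<lambda>x. c *\<^sub>R u x) \<in> adherence W" using V by (auto simp: adherence_def scale)
qed

lemma closure_complete:
  assumes complete_space "W \<subseteq> V" "pre_hilbert (adherence W) B"
  shows "pre_hilbert.complete_space (adherence W) B"
proof -
  interpret C: pre_hilbert "adherence W" B by fact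
  have sub: "adherence W \<subseteq> V" by (auto simp: adherence_def)
  show ?thesis unfolding C.complete_space_def
  proof (intro allI impI)
    fix X assume X: "C.Cauchy_seq X"
    then have XC: "X n \<in> adherence W" and XV: "X n \<in> V" for n
      using sub by (auto simp: C.Cauchy_seq_def)
    have "Cauchy_seq X" using X XV by (simp add: C.Cauchy_seq_def Cauchy_seq_def)
    then obtain u where u: "u \<in> V" "(\<lambda>n. nrm B (\<lambda>x. X n x - u x)) \<longlonglongrightarrow> 0"
      using complete_spaceD assms(1) by blast
    have "\<exists>w\<in>W. nrm B (\<lambda>x. u x - w x) < e" if "e > 0" for e
    proof -
      obtain n where n: "nrm B (\<lambda>x. X n x - u x) < e/2"
        using order_tendstoD(2)[OF u(2), of "e/2"] \<open>e > 0\<close> by (auto simp: eventually_sequentially)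
      obtain w where w: "w \<in> W" "nrm B (\<lambda>x. X n x - w x) < e/2"
        using adherenceD[OF XC, of "e/2" n] \<open>e > 0\<close> by auto
      have "w \<in> V" using w assms(2) by auto
      then have "nrm B (\<lambda>x. u x - w x) < e"
        using nrm_triangle[OF u(1) XV, of w n] n w(2) nrm_minus_commute[OF u(1) XV, of n] by simp
      with w(1) show ?thesis by auto
    qed
    then have "u \<in> adherence W" using u(1) by (auto simp: adherence_def)
    then show "\<exists>u\<in>adherence W. (\<lambda>n. nrm B (\<lambda>x. X n x - u x)) \<longlonglongrightarrow> 0" using u(2) by blast
  qed
qed

end

section \<open>The spaces \<open>L2\<close>\<close>

lemma L2_measurable: "f \<in> L2 S \<Longrightarrow> f \<in> borel_measurable (lebesgue_on S)"
  by (simp add: L2_def)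

lemma L2_integrable_sq: "f \<in> L2 S \<Longrightarrow> integrable (lebesgue_on S) (\<lambda>x. (norm (f x))\<^sup>2)"
  by (simp add: L2_def)

lemma L2_integrable_inner:
  assumes f: "f \<in> L2 S" and g: "g \<in> L2 S"
  shows "integrable (lebesgue_on S) (\<lambda>x. f x \<bullet> g x)"
proof (rule Bochner_Integration.integrable_bound)
  show "integrable (lebesgue_on S) (\<lambda>x. (norm (f x))\<^sup>2 + (norm (g x))\<^sup>2)"
    using assms by (intro Bochner_Integration.integrable_add L2_integrable_sq)
  show "(\<lambda>x. f x \<bullet> g x) \<in> borel_measurable (lebesgue_on S)"
    using assms by (intro borel_measurable_inner L2_measurable)
  have "\<bar>a \<bullet> b\<bar> \<le> (norm a)\<^sup>2 + (norm b)\<^sup>2" for a b :: 'b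
  proof -
    have "0 \<le> (norm a - norm b)\<^sup>2" by simp
    then have "2 * (norm a * norm b) \<le> (norm a)\<^sup>2 + (norm b)\<^sup>2" by (simp add: power2_diff)
    moreover have "0 \<le> norm a * norm b" by simp
    ultimately show ?thesis using Cauchy_Schwarz_ineq2[of a b] by linarith
  qed
  then show "AE x in lebesgue_on S. norm (f x \<bullet> g x) \<le> norm ((norm (f x))\<^sup>2 + (norm (g x))\<^sup>2)"
    by simp
qed

lemma L2_add: 
  assumes f: "f \<in> L2 S" and g: "g \<in> L2 S"
  shows "(\<lambda>x. f x + g x) \<in> L2 S"
proof -
  have "(\<lambda>x. (norm (f x + g x))\<^sup>2) = (\<lambda>x. (norm (f x))\<^sup>2 + 2 * (f x \<bullet> g x) + (norm (g x))\<^sup>2)"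
    by (simp add: power2_norm_eq_inner inner_add_left inner_add_right inner_commute fun_eq_iff)
  then show ?thesis
    using assms L2_integrable_inner[OF assms] by (auto simp: L2_def)
qed

lemma L2_zero [simp]: "(\<lambda>x. 0) \<in> L2 S"
  by (simp add: L2_def)

lemma L2_scale: "f \<in> L2 S \<Longrightarrow> (\<lambda>x. c *\<^sub>R f x) \<in> L2 S"
  by (auto simp: L2_def power_mult_distrib)

lemma pre_hilbert_L2: "pre_hilbert (L2 S) (L2_inner S)"
proof
  fix u v w :: "'a \<Rightarrow> 'b" and c :: real
  assume u: "u \<in> L2 S" and v: "v \<in> L2 S" and w: "w \<in> L2 S"
  show "L2_inner S (\<lambda>x. u x + v x) w = L2_inner S u w + L2_inner S v w"
    using u v w by (simp add: L2_inner_def inner_add_left L2_integrable_inner)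
qed (auto simp: L2_inner_def L2_add L2_scale inner_commute)

lemma nrm_L2: "nrm (L2_inner S) = L2_norm S"
  by (simp add: nrm_def L2_norm_def fun_eq_iff)

lemmas L2_diff = pre_hilbert.diff[OF pre_hilbert_L2]
  and L2_inner_add = pre_hilbert.B_add[OF pre_hilbert_L2]
  and L2_inner_add2 = pre_hilbert.B_add2[OF pre_hilbert_L2]
  and L2_inner_diff = pre_hilbert.B_diff[OF pre_hilbert_L2]
  and L2_inner_diff2 = pre_hilbert.B_diff2[OF pre_hilbert_L2]
  and L2_inner_nonneg = pre_hilbert.B_nonneg[OF pre_hilbert_L2]
  and L2_cs = pre_hilbert.cs[OF pre_hilbert_L2, unfolded nrm_L2]
  and L2_norm_nonneg = pre_hilbert.nrm_nonneg[OF pre_hilbert_L2, unfolded nrm_L2]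
  and L2_norm_sq = pre_hilbert.nrm_sq[OF pre_hilbert_L2, unfolded nrm_L2]
  and L2_norm_add = pre_hilbert.nrm_add[OF pre_hilbert_L2, unfolded nrm_L2]
  and L2_norm_minus_commute = pre_hilbert.nrm_minus_commute[OF pre_hilbert_L2, unfolded nrm_L2]
  and L2_inner_tendsto = pre_hilbert.B_tendsto[OF pre_hilbert_L2, unfolded nrm_L2]

lemma L2_inner_scale: "L2_inner S (\<lambda>x. c *\<^sub>R u x) w = c * L2_inner S u w"
  by (simp add: L2_inner_def)

lemma L2_inner_scale2: "L2_inner S u (\<lambda>x. c *\<^sub>R w x) = c * L2_inner S u w"
  by (simp add: L2_inner_def)

lemma L2_inner_commute: "L2_inner S u w = L2_inner S w u"
  by (simp add: L2_inner_def inner_commute)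

lemma L2_norm_scale: "L2_norm S (\<lambda>x. c *\<^sub>R u x) = \<bar>c\<bar> * L2_norm S u"
  by (simp add: L2_norm_def L2_inner_scale L2_inner_scale2 real_sqrt_mult
      flip: power2_eq_square mult.assoc)

lemma L2_inner_zero [simp]: "L2_inner S (\<lambda>x. 0) w = 0" "L2_inner S w (\<lambda>x. 0) = 0"
  by (simp_all add: L2_inner_def)

lemma L2_norm_zero [simp]: "L2_norm S (\<lambda>x. 0) = 0"
  by (simp add: L2_norm_def)

lemma ae_eq_refl [simp]: "ae_eq S f f"
  by (simp add: ae_eq_def)

lemma ae_eq_sym: "ae_eq S f g \<Longrightarrow> ae_eq S g f"
  by (auto simp: ae_eq_def)

lemma ae_eq_trans: "ae_eq S f g \<Longrightarrow> ae_eq S g h \<Longrightarrow> ae_eq S f h"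
  unfolding ae_eq_def by (auto elim: AE_mp)

lemma ae_eq_add: "ae_eq S f g \<Longrightarrow> ae_eq S f' g' \<Longrightarrow> ae_eq S (\<lambda>x. f x + f' x) (\<lambda>x. g x + g' x)"
  unfolding ae_eq_def by (auto elim: AE_mp)

lemma ae_eq_diff: "ae_eq S f g \<Longrightarrow> ae_eq S f' g' \<Longrightarrow> ae_eq S (\<lambda>x. f x - f' x) (\<lambda>x. g x - g' x)"
  unfolding ae_eq_def by (auto elim: AE_mp)

lemma L2_inner_cong:
  assumes "ae_eq S f f'" "ae_eq S g g'" "f \<in> L2 S" "f' \<in> L2 S" "g \<in> L2 S" "g' \<in> L2 S"
  shows "L2_inner S f g = L2_inner S f' g'"
  unfolding L2_inner_def
proof (rule integral_cong_AE)
  show "AE x in lebesgue_on S. f x \<bullet> g x = f' x \<bullet> g' x"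
    using assms(1,2) unfolding ae_eq_def by (auto elim: AE_mp)
qed (use assms in \<open>auto intro!: borel_measurable_inner intro: L2_measurable\<close>)

lemma L2_norm_cong: "ae_eq S f g \<Longrightarrow> f \<in> L2 S \<Longrightarrow> g \<in> L2 S \<Longrightarrow> L2_norm S f = L2_norm S g"
  unfolding L2_norm_def using L2_inner_cong[of S f g f g] by simp

lemma L2_norm_eq_0_iff:
  assumes "f \<in> L2 S"
  shows "L2_norm S f = 0 \<longleftrightarrow> ae_eq S f (\<lambda>x. 0)"
proof -
  have "L2_norm S f = 0 \<longleftrightarrow> L2_inner S f f = 0" by (simp add: L2_norm_def)
  also have "\<dots> \<longleftrightarrow> (AE x in lebesgue_on S. f x \<bullet> f x = 0)"
    unfolding L2_inner_def
    by (rule integral_nonneg_eq_0_iff_AE[OF L2_integrable_inner]) (use assms in auto)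
  finally show ?thesis by (simp add: ae_eq_def)
qed

lemma L2_norm_diff_0_iff:
  assumes "f \<in> L2 S" "g \<in> L2 S"
  shows "L2_norm S (\<lambda>x. f x - g x) = 0 \<longleftrightarrow> ae_eq S f g"
  using L2_norm_eq_0_iff[OF L2_diff[OF assms]] by (simp add: ae_eq_def)

lemma L2_restrict:
  assumes "T \<subseteq> S" "T \<in> sets lebesgue" "S \<in> sets lebesgue" "f \<in> L2 S"
  shows "f \<in> L2 T"
proof -
  have eq: "lebesgue_on T = restrict_space (lebesgue_on S) T"
    using assms by (simp add: restrict_restrict_space Int_absorb1)
  have "integrable (lebesgue_on T) (\<lambda>x. (norm (f x))\<^sup>2)"
    unfolding eq using assms integrable_mult_indicator[OF _ L2_integrable_sq[OF assms(4)], of T]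
    by (subst integrable_restrict_space) (auto simp: sets_restrict_space space_restrict_space)
  then show ?thesis
    using assms L2_measurable[OF assms(4)] unfolding L2_def
    by (auto intro: measurable_restrict_mono)
qed

lemma ae_eq_restrict:
  assumes "T \<subseteq> S" "T \<in> sets lebesgue" "S \<in> sets lebesgue" "ae_eq S f g"
  shows "ae_eq T f g"
  using assms(4) unfolding ae_eq_def
  using assms(1-3) by (subst (asm) AE_restrict_space_iff, simp, subst AE_restrict_space_iff) auto

lemma L2_inner_indicator:
  "S \<in> sets lebesgue \<Longrightarrow> L2_inner S f g = (LINT x|lebesgue. indicator S x *\<^sub>R (f x \<bullet> g x))"
  unfolding L2_inner_def by (subst integral_restrict_space) auto

lemma L2_inner_support:
  assumes "T \<subseteq> S" "T \<in> sets lebesgue" "S \<in> sets lebesgue" "\<And>x. x \<notin> T \<Longrightarrow> g x = 0"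
  shows "L2_inner S f g = L2_inner T f g"
  unfolding L2_inner_indicator[OF assms(2)] L2_inner_indicator[OF assms(3)]
  by (rule Bochner_Integration.integral_cong) (use assms in \<open>auto simp: indicator_def\<close>)

lemma L2_norm_fun:
  "f \<in> L2 S \<Longrightarrow> (\<lambda>x. norm (f x)) \<in> L2 S"
  "L2_norm S (\<lambda>x. norm (f x)) = L2_norm S f"
  by (auto simp: L2_def L2_norm_def L2_inner_def power2_norm_eq_inner simp flip: power2_eq_square)

lemma const_in_L2:
  assumes "S \<in> lmeasurable"
  shows "(\<lambda>x. c) \<in> L2 S"
  using finite_measure.integrable_const[OF finite_measure_lebesgue_on[OF assms]] by (simp add: L2_def)

lemma L2_integrable:
  assumes "S \<in> lmeasurable" "f \<in> L2 S"
  shows "integrable (lebesgue_on S) f"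
proof (rule Bochner_Integration.integrable_bound)
  show "integrable (lebesgue_on S) (\<lambda>x. norm (f x) \<bullet> (1::real))"
    using assms by (intro L2_integrable_inner L2_norm_fun const_in_L2)
qed (use assms in \<open>auto simp: L2_measurable\<close>)

text \<open>Riesz-Fischer. On a set of finite measure an \<open>L2\<close> Cauchy sequence is Cauchy
  in \<open>L1\<close> and so has a subsequence converging almost everywhere; Fatou's lemma upgrades
  the limit to one in \<open>L2\<close>.\<close>

lemma L2_complete:
  assumes S: "S \<in> lmeasurable"
  shows "pre_hilbert.complete_space (L2 S :: ('a::euclidean_space \<Rightarrow> 'b::euclidean_space) set) (L2_inner S)"
  unfolding pre_hilbert.complete_space_def[OF pre_hilbert_L2] nrm_L2
proof (intro allI impI)
  fix X :: "nat \<Rightarrow> 'a \<Rightarrow> 'b"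
  assume "pre_hilbert.Cauchy_seq (L2 S) (L2_inner S) X"
  then have X: "\<And>n. X n \<in> L2 S"
    and cau: "\<And>e. e > 0 \<Longrightarrow> \<exists>N. \<forall>m\<ge>N. \<forall>n\<ge>N. L2_norm S (\<lambda>x. X m x - X n x) < e"
    by (auto simp: pre_hilbert.Cauchy_seq_def[OF pre_hilbert_L2] nrm_L2)
  have [measurable]: "X n \<in> borel_measurable (lebesgue_on S)" for n using X by (rule L2_measurable)
  let ?c = "L2_norm S (\<lambda>x. 1 :: real)"
  have c: "?c \<ge> 0" by (simp add: L2_norm_nonneg const_in_L2[OF S])
  \<comment> \<open>Cauchy-Schwarz against the constant 1.\<close>
  have L1: "LINT x|lebesgue_on S. norm (X m x - X n x) \<le> L2_norm S (\<lambda>x. X m x - X n x) * ?c" for m n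
    using L2_cs[OF L2_norm_fun(1)[OF L2_diff[OF X X]] const_in_L2[OF S, of "1::real"], of m n]
    by (simp add: L2_norm_fun(2)) (simp add: L2_inner_def)
  obtain r where r: "strict_mono r" "AE x in lebesgue_on S. Cauchy (\<lambda>i. X (r i) x)"
  proof (rule cauchy_L1_AE_cauchy_subseq[of "lebesgue_on S" X])
    show "integrable (lebesgue_on S) (X n)" for n by (rule L2_integrable[OF S X])
    fix e :: real assume "e > 0"
    then obtain N where N: "\<forall>m\<ge>N. \<forall>n\<ge>N. L2_norm S (\<lambda>x. X m x - X n x) < e / (?c + 1)"
      using cau[of "e / (?c + 1)"] c by auto
    have "LINT x|lebesgue_on S. norm (X m x - X n x) < e" if "m \<ge> N" "n \<ge> N" for m n
    proof -
      have "L2_norm S (\<lambda>x. X m x - X n x) * ?c \<le> e / (?c + 1) * ?c"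
        using N that c by (intro mult_right_mono) (auto intro: less_imp_le)
      also have "\<dots> < e" using c \<open>e > 0\<close> by (simp add: field_simps)
      finally show ?thesis using L1[of m n] by simp
    qed
    then show "\<exists>N. \<forall>i\<ge>N. \<forall>j\<ge>N. LINT x|lebesgue_on S. norm (X i x - X j x) < e" by blast
  qed (use that in blast)
  define u where "u x = lim (\<lambda>i. X (r i) x)" for x
  have u_meas [measurable]: "u \<in> borel_measurable (lebesgue_on S)"
    unfolding u_def by measurable
  have lim: "AE x in lebesgue_on S. (\<lambda>i. X (r i) x) \<longlonglongrightarrow> u x"
    using r(2) by eventually_elim (simp add: u_def Cauchy_convergent convergent_LIMSEQ_iff[symmetric])
  \<comment> \<open>Fatou along the subsequence, in the second index. The bound serves twice: it
    puts \<open>X m - u\<close> into \<open>L2\<close> and shows that its norm is small.\<close>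
  have nn: "(\<integral>\<^sup>+x. ennreal ((norm (X m x - u x))\<^sup>2) \<partial>lebesgue_on S) \<le> ennreal (e\<^sup>2)"
    if N: "\<forall>m\<ge>N. \<forall>n\<ge>N. L2_norm S (\<lambda>x. X m x - X n x) < e" and "m \<ge> N" for m N e
  proof -
    have "(\<integral>\<^sup>+x. ennreal ((norm (X m x - u x))\<^sup>2) \<partial>lebesgue_on S)
        = (\<integral>\<^sup>+x. liminf (\<lambda>i. ennreal ((norm (X m x - X (r i) x))\<^sup>2)) \<partial>lebesgue_on S)"
    proof (rule nn_integral_cong_AE)
      show "AE x in lebesgue_on S. ennreal ((norm (X m x - u x))\<^sup>2) =
          liminf (\<lambda>i. ennreal ((norm (X m x - X (r i) x))\<^sup>2))"
        using lim
      proof eventually_elim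
        case (elim x)
        have "(\<lambda>i. ennreal ((norm (X m x - X (r i) x))\<^sup>2)) \<longlonglongrightarrow> ennreal ((norm (X m x - u x))\<^sup>2)"
          by (intro tendsto_ennrealI tendsto_intros elim)
        then show ?case by (simp only: lim_imp_Liminf trivial_limit_sequentially not_False_eq_True)
      qed
    qed
    also have "\<dots> \<le> liminf (\<lambda>i. \<integral>\<^sup>+x. ennreal ((norm (X m x - X (r i) x))\<^sup>2) \<partial>lebesgue_on S)"
      by (rule nn_integral_liminf) simp
    also have "\<dots> \<le> ennreal (e\<^sup>2)"
    proof (rule Liminf_le)
      have "(\<integral>\<^sup>+x. ennreal ((norm (X m x - X (r i) x))\<^sup>2) \<partial>lebesgue_on S) \<le> ennreal (e\<^sup>2)" if "i \<ge> N" for i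
      proof -
        have "r i \<ge> N" using that seq_suble[OF r(1), of i] by simp
        then have "(L2_norm S (\<lambda>x. X m x - X (r i) x))\<^sup>2 \<le> e\<^sup>2"
          using N \<open>m \<ge> N\<close> by (intro power_mono L2_norm_nonneg L2_diff X less_imp_le) auto
        then have "L2_inner S (\<lambda>x. X m x - X (r i) x) (\<lambda>x. X m x - X (r i) x) \<le> e\<^sup>2"
          by (simp add: L2_norm_sq L2_diff X)
        then show ?thesis
          by (subst nn_integral_eq_integral[OF L2_integrable_sq[OF L2_diff[OF X X]]])
            (auto simp: L2_inner_def power2_norm_eq_inner intro!: ennreal_leI)
      qed
      then show "\<forall>\<^sub>F i in sequentially.
          (\<integral>\<^sup>+x. ennreal ((norm (X m x - X (r i) x))\<^sup>2) \<partial>lebesgue_on S) \<le> ennreal (e\<^sup>2)"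
        unfolding eventually_sequentially by blast
    qed simp
    finally show ?thesis .
  qed
  have diff: "(\<lambda>x. X m x - u x) \<in> L2 S" "L2_norm S (\<lambda>x. X m x - u x) \<le> e"
    if N: "\<forall>m\<ge>N. \<forall>n\<ge>N. L2_norm S (\<lambda>x. X m x - X n x) < e" and "m \<ge> N" "e > 0" for m N e
  proof -
    have int: "integrable (lebesgue_on S) (\<lambda>x. (norm (X m x - u x))\<^sup>2)"
      by (rule integrableI_bounded)
        (use nn[OF that(1,2)] in \<open>auto intro: le_less_trans[OF _ ennreal_less_top]\<close>)
    then show L: "(\<lambda>x. X m x - u x) \<in> L2 S" by (auto simp: L2_def)
    have "(L2_norm S (\<lambda>x. X m x - u x))\<^sup>2 \<le> e\<^sup>2"
      using nn[OF that(1,2)] unfolding L2_norm_sq[OF L]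
      by (subst (asm) nn_integral_eq_integral[OF int])
        (auto simp: L2_inner_def power2_norm_eq_inner)
    then show "L2_norm S (\<lambda>x. X m x - u x) \<le> e"
      using \<open>e > 0\<close> power2_le_imp_le by (metis less_imp_le)
  qed
  obtain N where "\<forall>m\<ge>N. \<forall>n\<ge>N. L2_norm S (\<lambda>x. X m x - X n x) < 1" using cau[of 1] by auto
  from L2_diff[OF X diff(1)[OF this order_refl], of N] have u: "u \<in> L2 S" by simp
  have "(\<lambda>n. L2_norm S (\<lambda>x. X n x - u x)) \<longlonglongrightarrow> 0"
  proof (rule LIMSEQ_I)
    fix e :: real assume "e > 0"
    then obtain N where N: "\<forall>m\<ge>N. \<forall>n\<ge>N. L2_norm S (\<lambda>x. X m x - X n x) < e/2"
      using cau[of "e/2"] by auto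
    have "norm (L2_norm S (\<lambda>x. X n x - u x) - 0) < e" if "n \<ge> N" for n
      using diff(2)[OF N that] \<open>e > 0\<close> L2_norm_nonneg[OF L2_diff[OF X u], of n] by simp
    then show "\<exists>N. \<forall>n\<ge>N. norm (L2_norm S (\<lambda>x. X n x - u x) - 0) < e" by blast
  qed
  then show "\<exists>u\<in>L2 S. (\<lambda>n. L2_norm S (\<lambda>x. X n x - u x)) \<longlonglongrightarrow> 0" using u by blast
qed

section \<open>Test functions\<close>

lemma Ck_continuous: "Ck k f \<Longrightarrow> continuous_on UNIV f"
  by (cases k) (auto intro!: differentiable_imp_continuous_on simp: differentiable_on_def
      intro: differentiable_at_withinI)

lemma Ck_Suc_imp: "Ck (Suc k) f \<Longrightarrow> Ck k f"
proof (induction k arbitrary: f)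
  case 0
  then show ?case using Ck_continuous[OF 0] by simp
next
  case (Suc k)
  from Suc.prems have "Ck (Suc k) (\<lambda>x. frechet_derivative f (at x) h)" for h
    by (subst (asm) Ck.simps) blast
  then have "Ck k (\<lambda>x. frechet_derivative f (at x) h)" for h
    by (rule Suc.IH)
  moreover have "\<forall>x. f differentiable (at x)" using Suc.prems by simp
  ultimately show ?case by simp
qed

text \<open>The derivative may be given by any formula \<open>F\<close>; uniqueness of derivatives
  identifies it with \<open>frechet_derivative\<close>.\<close>

lemma Ck_SucI:
  assumes "\<And>x. (f has_derivative F x) (at x)" "\<And>h. Ck k (\<lambda>x. F x h)"
  shows "Ck (Suc k) f"
  using assms frechet_derivative_at[OF assms(1), symmetric]
  by (auto simp: differentiable_def)

lemma Ck_Suc_has_derivative: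
  "Ck (Suc k) f \<Longrightarrow> (f has_derivative frechet_derivative f (at x)) (at x)"
  by (simp add: frechet_derivative_works)

lemma Ck_const: "Ck k (\<lambda>x. c)"
proof (induction k arbitrary: c)
  case (Suc k)
  show ?case by (rule Ck_SucI[where F="\<lambda>x h. 0"]) (auto intro!: derivative_eq_intros Suc)
qed simp

lemma Ck_add: "Ck k f \<Longrightarrow> Ck k g \<Longrightarrow> Ck k (\<lambda>x. f x + g x)"
proof (induction k arbitrary: f g)
  case (Suc k)
  have "((\<lambda>x. f x + g x) has_derivative
      (\<lambda>h. frechet_derivative f (at x) h + frechet_derivative g (at x) h)) (at x)" for x
    by (intro has_derivative_add Ck_Suc_has_derivative[of k] Suc.prems)
  then show ?case
    by (rule Ck_SucI) (use Suc in simp)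
qed (simp add: continuous_on_add)

lemma Ck_bilinear:
  assumes P: "bounded_bilinear P"
  shows "Ck k f \<Longrightarrow> Ck k g \<Longrightarrow> Ck k (\<lambda>x. P (f x) (g x))"
proof (induction k arbitrary: f g)
  case 0
  then show ?case using bounded_bilinear.continuous_on[OF P] by auto
next
  case (Suc k)
  have "((\<lambda>x. P (f x) (g x)) has_derivative
      (\<lambda>h. P (f x) (frechet_derivative g (at x) h) + P (frechet_derivative f (at x) h) (g x))) (at x)" for x
    by (intro bounded_bilinear.FDERIV[OF P] Ck_Suc_has_derivative[of k] Suc.prems)
  then show ?case
    by (rule Ck_SucI)
      (use Suc.prems in \<open>auto intro!: Ck_add Suc.IH Ck_Suc_imp[OF Suc.prems(1)] Ck_Suc_imp[OF Suc.prems(2)]\<close>)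
qed

lemma Ck_linear:
  assumes L: "bounded_linear L"
  shows "Ck k f \<Longrightarrow> Ck k (\<lambda>x. L (f x))"
proof (induction k arbitrary: f)
  case 0
  then show ?case using bounded_linear.continuous_on[OF L] by auto
next
  case (Suc k)
  have "((\<lambda>x. L (f x)) has_derivative (\<lambda>h. L (frechet_derivative f (at x) h))) (at x)" for x
    by (intro bounded_linear.has_derivative[OF L] Ck_Suc_has_derivative[of k] Suc.prems)
  then show ?case
    by (rule Ck_SucI) (use Suc in simp)
qed

lemma Ck_affine:
  assumes L: "bounded_linear L"
  shows "Ck k f \<Longrightarrow> Ck k (\<lambda>x. f (L x + a))"
proof (induction k arbitrary: f)
  case 0
  then show ?case
    by (auto intro!: continuous_on_compose2[of UNIV f] continuous_intros bounded_linear.continuous_on[OF L])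
next
  case (Suc k)
  have "((\<lambda>x. L x + a) has_derivative L) (at x)" for x
    by (intro has_derivative_add_const bounded_linear.has_derivative[OF L] has_derivative_ident)
  then show ?case
    by (intro Ck_SucI[where F="\<lambda>x h. frechet_derivative f (at (L x + a)) (L h)"]
        has_derivative_compose[where g=f and f="\<lambda>x. L x + a"] Ck_Suc_has_derivative[OF Suc.prems]
        Suc.IH[of "\<lambda>y. frechet_derivative f (at y) (L h)" for h]) (use Suc.prems in auto)
qed

lemma Ck_translate: "Ck k f \<Longrightarrow> Ck k (\<lambda>x. f (x + a))"
  by (rule Ck_affine[OF bounded_linear_ident])

lemma Ck_prod:
  fixes f :: "'i \<Rightarrow> 'a::euclidean_space \<Rightarrow> real"
  shows "(\<And>i. i \<in> I \<Longrightarrow> Ck k (f i)) \<Longrightarrow> Ck k (\<lambda>x. \<Prod>i\<in>I. f i x)"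
  by (induction I rule: infinite_finite_induct)
    (auto intro!: Ck_const Ck_bilinear[OF bounded_bilinear_mult])

lemma Ck_power: "Ck k f \<Longrightarrow> Ck k (\<lambda>x. f x ^ n :: real)"
  by (induction n) (auto intro!: Ck_const Ck_bilinear[OF bounded_bilinear_mult])

text \<open>Any compact set outside of which \<phi> vanishes will do, so the closure of the support
  never has to be computed.\<close>

lemma test_funI:
  assumes "\<And>k. Ck k \<phi>" "compact K" "K \<subseteq> S" "\<And>x. x \<notin> K \<Longrightarrow> \<phi> x = 0"
  shows "\<phi> \<in> test_fun S"
proof -
  have "closure {x. \<phi> x \<noteq> 0} \<subseteq> K"
    using assms by (intro closure_minimal compact_imp_closed) auto
  then show ?thesis
    using assms unfolding test_fun_def
    by (auto simp: compact_eq_bounded_closed intro: bounded_subset)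
qed

lemma test_funE:
  assumes "\<phi> \<in> test_fun S"
  obtains K where "compact K" "K \<subseteq> S" "\<And>x. x \<notin> K \<Longrightarrow> \<phi> x = 0"
proof (rule that[of "closure {x. \<phi> x \<noteq> 0}"])
  show "\<phi> x = 0" if "x \<notin> closure {x. \<phi> x \<noteq> 0}" for x
    using that closure_subset[of "{x. \<phi> x \<noteq> 0}"] by auto
qed (use assms in \<open>auto simp: test_fun_def\<close>)

lemma test_fun_Ck: "\<phi> \<in> test_fun S \<Longrightarrow> Ck k \<phi>"
  by (simp add: test_fun_def)

lemma test_fun_continuous: "\<phi> \<in> test_fun S \<Longrightarrow> continuous_on UNIV \<phi>"
  using test_fun_Ck[of \<phi> S 0] by simp

lemma test_fun_has_derivative:
  "\<phi> \<in> test_fun S \<Longrightarrow> (\<phi> has_derivative frechet_derivative \<phi> (at x)) (at x)"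
  by (rule Ck_Suc_has_derivative[OF test_fun_Ck])

lemma test_fun_zero_outside: "\<phi> \<in> test_fun S \<Longrightarrow> x \<notin> S \<Longrightarrow> \<phi> x = 0"
  by (elim test_funE) auto

lemma test_fun_mono: "\<phi> \<in> test_fun T \<Longrightarrow> T \<subseteq> S \<Longrightarrow> \<phi> \<in> test_fun S"
  by (auto simp: test_fun_def)

lemma test_fun_zero [simp]: "(\<lambda>x. 0) \<in> test_fun S"
  by (rule test_funI[of _ "{}"]) (auto intro: Ck_const)

lemma test_fun_add:
  assumes "\<phi> \<in> test_fun S" "\<psi> \<in> test_fun S"
  shows "(\<lambda>x. \<phi> x + \<psi> x) \<in> test_fun S"
proof -
  obtain K where K: "compact K" "K \<subseteq> S" "\<And>x. x \<notin> K \<Longrightarrow> \<phi> x = 0" using assms(1) by (rule test_funE) (rule that, auto)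
  obtain J where J: "compact J" "J \<subseteq> S" "\<And>x. x \<notin> J \<Longrightarrow> \<psi> x = 0" using assms(2) by (rule test_funE) (rule that, auto)
  show ?thesis
    by (rule test_funI[of _ "K \<union> J"])
      (use assms K J in \<open>auto intro: Ck_add test_fun_Ck compact_Un\<close>)
qed

lemma test_fun_bilinear:
  assumes P: "bounded_bilinear P" and f: "\<And>k. Ck k f" and \<phi>: "\<phi> \<in> test_fun S"
  shows "(\<lambda>x. P (f x) (\<phi> x)) \<in> test_fun S"
proof -
  obtain K where K: "compact K" "K \<subseteq> S" "\<And>x. x \<notin> K \<Longrightarrow> \<phi> x = 0" using \<phi> by (rule test_funE) (rule that, auto)
  show ?thesis
    by (rule test_funI[OF Ck_bilinear[OF P f test_fun_Ck[OF \<phi>]] K(1,2)])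
      (use K(3) in \<open>auto simp: bounded_bilinear.zero_right[OF P]\<close>)
qed

lemma test_fun_linear:
  assumes L: "bounded_linear L" and \<phi>: "\<phi> \<in> test_fun S"
  shows "(\<lambda>x. L (\<phi> x)) \<in> test_fun S"
proof -
  obtain K where K: "compact K" "K \<subseteq> S" "\<And>x. x \<notin> K \<Longrightarrow> \<phi> x = 0" using \<phi> by (rule test_funE) (rule that, auto)
  show ?thesis
    by (rule test_funI[OF Ck_linear[OF L test_fun_Ck[OF \<phi>]] K(1,2)])
      (use K(3) in \<open>auto simp: linear_0[OF bounded_linear.linear[OF L]]\<close>)
qed

lemma test_fun_scale: "\<phi> \<in> test_fun S \<Longrightarrow> (\<lambda>x. c *\<^sub>R \<phi> x) \<in> test_fun S"
  by (rule test_fun_linear[OF bounded_linear_scaleR_right])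

lemma test_fun_sum:
  "(\<And>i. i \<in> I \<Longrightarrow> f i \<in> test_fun S) \<Longrightarrow> (\<lambda>x. \<Sum>i\<in>I. f i x) \<in> test_fun S"
  by (induction I rule: infinite_finite_induct) (auto intro: test_fun_add)

lemma test_fun_derivative:
  assumes \<phi>: "\<phi> \<in> test_fun S"
  shows "(\<lambda>x. frechet_derivative \<phi> (at x) h) \<in> test_fun S"
proof -
  obtain K where K: "compact K" "K \<subseteq> S" "\<And>x. x \<notin> K \<Longrightarrow> \<phi> x = 0" using \<phi> by (rule test_funE) (rule that, auto)
  have "frechet_derivative \<phi> (at x) h = 0" if "x \<notin> K" for x
  proof -
    have "((\<lambda>x. 0) has_derivative (\<lambda>h. 0)) (at x)" by simp
    then have "(\<phi> has_derivative (\<lambda>h. 0)) (at x)"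
      by (rule has_derivative_transform_within_open[of _ _ _ _ "- K"])
        (use K that compact_imp_closed in auto)
    then show ?thesis by (simp add: frechet_derivative_at[symmetric])
  qed
  then show ?thesis
    using test_fun_Ck[OF \<phi>, of "Suc k" for k] by (intro test_funI[OF _ K(1,2)]) auto
qed

lemma test_fun_cgrad: "\<phi> \<in> test_fun S \<Longrightarrow> cgrad \<phi> \<in> test_fun S"
  unfolding cgrad_def[abs_def]
  by (intro test_fun_sum test_fun_linear[OF bounded_linear_scaleR_left] test_fun_derivative)

lemma test_fun_cdiv: "\<phi> \<in> test_fun S \<Longrightarrow> cdiv \<phi> \<in> test_fun S"
  unfolding cdiv_def[abs_def]
  by (intro test_fun_sum test_fun_linear[OF bounded_linear_inner_left] test_fun_derivative)

lemma test_fun_translate: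
  assumes \<phi>: "\<phi> \<in> test_fun A" and S: "\<And>x. x \<in> A \<Longrightarrow> x + a \<in> S"
  shows "(\<lambda>x. \<phi> (x - a)) \<in> test_fun S"
proof -
  obtain K where K: "compact K" "K \<subseteq> A" "\<And>x. x \<notin> K \<Longrightarrow> \<phi> x = 0" using \<phi> by (rule test_funE) (rule that, auto)
  show ?thesis
  proof (rule test_funI)
    show "Ck k (\<lambda>x. \<phi> (x - a))" for k using Ck_translate[OF test_fun_Ck[OF \<phi>], of k "- a"] by simp
    show "compact ((+) a ` K)" by (rule compact_translation[OF K(1)])
    show "(+) a ` K \<subseteq> S" using K(2) S by (auto simp: add.commute)
    show "\<phi> (x - a) = 0" if "x \<notin> (+) a ` K" for x
      using that K(3)[of "x - a"] by (metis add.commute diff_add_cancel image_eqI)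
  qed
qed

lemma test_fun_bounded:
  assumes "\<phi> \<in> test_fun S"
  obtains M where "M > 0" "\<And>x. norm (\<phi> x) \<le> M"
proof -
  obtain K where K: "compact K" "K \<subseteq> S" "\<And>x. x \<notin> K \<Longrightarrow> \<phi> x = 0" using assms by (rule test_funE) (rule that, auto)
  have "bounded (\<phi> ` K)"
    using K(1) test_fun_continuous[OF assms]
    by (intro compact_imp_bounded compact_continuous_image) (auto intro: continuous_on_subset)
  then obtain M where "M > 0" "\<And>x. x \<in> K \<Longrightarrow> norm (\<phi> x) \<le> M" by (auto simp: bounded_pos)
  then have "norm (\<phi> x) \<le> M" for x using K(3)[of x] by (cases "x \<in> K") auto
  then show thesis using that \<open>M > 0\<close> by blast
qed

lemma cgrad_inner: "\<phi> differentiable (at x) \<Longrightarrow> cgrad \<phi> x \<bullet> h = frechet_derivative \<phi> (at x) h"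
proof -
  assume "\<phi> differentiable (at x)"
  then interpret bounded_linear "frechet_derivative \<phi> (at x)"
    using frechet_derivative_works has_derivative_bounded_linear by blast
  have "frechet_derivative \<phi> (at x) h = frechet_derivative \<phi> (at x) (\<Sum>i\<in>Basis. (h \<bullet> i) *\<^sub>R i)"
    by (simp add: euclidean_representation)
  also have "\<dots> = cgrad \<phi> x \<bullet> h"
    by (simp add: sum scaleR cgrad_def inner_sum_left inner_commute[of h] mult.commute)
  finally show ?thesis by simp
qed

lemma cdiv_scaleR_const:
  fixes \<phi> :: "'a::euclidean_space \<Rightarrow> real"
  assumes "\<phi> differentiable (at x)"
  shows "cdiv (\<lambda>x. \<phi> x *\<^sub>R h) x = frechet_derivative \<phi> (at x) h"
proof -
  have "((\<lambda>x. \<phi> x *\<^sub>R h) has_derivative (\<lambda>k. frechet_derivative \<phi> (at x) k *\<^sub>R h)) (at x)"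
    using assms by (intro has_derivative_scaleR_left) (simp add: frechet_derivative_works[symmetric])
  then have "cdiv (\<lambda>x. \<phi> x *\<^sub>R h) x = cgrad \<phi> x \<bullet> h"
    by (simp add: cdiv_def cgrad_def frechet_derivative_at[symmetric] inner_sum_left inner_commute[of h])
  then show ?thesis using cgrad_inner[OF assms] by simp
qed

subsection \<open>Bump functions\<close>

text \<open>For \<open>p = 1\<close> this is the classical flat function
  \<open>exp (- 1 / t)\<close>. The polynomial factor makes the family closed under differentiation,
  so that smoothness is one induction for all \<open>p\<close> at once.\<close>

definition flat_exp :: "real poly \<Rightarrow> real \<Rightarrow> real" where
  "flat_exp p t = (if t > 0 then poly p (1 / t) * exp (- 1 / t) else 0)"

text \<open>With \<open>s = 1 / t\<close> this becomes the decay of a polynomial divided by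
  \<open>exp s\<close> at infinity.\<close>

lemma flat_exp_tendsto_0: "(flat_exp p \<longlongrightarrow> 0) (at_right 0)"
proof -
  have "((\<lambda>s::real. \<Sum>i\<le>degree p. coeff p i * (s ^ i / exp s)) \<longlongrightarrow> (\<Sum>i\<le>degree p. coeff p i * 0)) at_top"
    by (intro tendsto_intros tendsto_power_div_exp_0)
  then have "((\<lambda>s::real. poly p s * exp (- s)) \<longlongrightarrow> 0) at_top"
    by (simp add: poly_altdef sum_distrib_right exp_minus divide_inverse mult.assoc)
  then have "((\<lambda>t. poly p (inverse t) * exp (- inverse t)) \<longlongrightarrow> 0) (at_right 0)"
    by (rule filterlim_compose) (rule filterlim_inverse_at_top_right)
  then show ?thesis
    by (rule Lim_transform_eventually)
      (auto simp: eventually_at_right_field flat_exp_def divide_inverse intro!: exI[of _ 1])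
qed

text \<open>Differentiating \<open>p(s) exp(-s)\<close> with \<open>s = 1/t\<close> gives \<open>s\<^sup>2 (p(s) - p'(s)) exp(-s)\<close>.\<close>

lemma flat_exp_derivative:
  "(flat_exp p has_real_derivative flat_exp ([:0, 0, 1:] * (p - pderiv p)) t) (at t)"
proof -
  consider "t > 0" | "t < 0" | "t = 0" by linarith
  then show ?thesis
  proof cases
    case 1
    have "((\<lambda>t. poly p (1 / t) * exp (- 1 / t)) has_real_derivative
        flat_exp ([:0, 0, 1:] * (p - pderiv p)) t) (at t)"
      using 1 by (auto intro!: derivative_eq_intros DERIV_chain2[OF poly_DERIV]
          simp: flat_exp_def power2_eq_square field_simps)
    then show ?thesis
      by (rule has_field_derivative_transform_within_open[of _ _ _ "{0<..}"])
        (use 1 in \<open>auto simp: flat_exp_def\<close>)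
  next
    case 2
    have "((\<lambda>t. 0) has_real_derivative flat_exp ([:0, 0, 1:] * (p - pderiv p)) t) (at t)"
      using 2 by (simp add: flat_exp_def)
    then show ?thesis
      by (rule has_field_derivative_transform_within_open[of _ _ _ "{..<0}"])
        (use 2 in \<open>auto simp: flat_exp_def\<close>)
  next
    case 3
    \<comment> \<open>From the right the difference quotient is \<open>flat_exp (pCons 0 p)\<close>:
      dividing by \<open>h\<close> multiplies the polynomial in \<open>1 / h\<close> by its
      variable.\<close>
    have "((\<lambda>h. (flat_exp p (0 + h) - flat_exp p 0) / h) \<longlongrightarrow> 0) (at_right 0)"
      by (rule Lim_transform_eventually[OF flat_exp_tendsto_0[of "pCons 0 p"]])
        (auto simp: eventually_at_right_field flat_exp_def intro!: exI[of _ 1])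
    moreover have "((\<lambda>h. (flat_exp p (0 + h) - flat_exp p 0) / h) \<longlongrightarrow> 0) (at_left 0)"
      by (rule Lim_transform_eventually[OF tendsto_const])
        (auto simp: eventually_at_left_field flat_exp_def intro!: exI[of _ "-1"])
    ultimately show ?thesis
      using 3 by (simp add: has_field_derivative_iff filterlim_at_split flat_exp_def)
  qed
qed

lemma Ck_flat_exp: "Ck k (flat_exp p)"
proof (induction k arbitrary: p)
  case 0
  show ?case using flat_exp_derivative by (auto intro: DERIV_isCont simp: continuous_on_eq_continuous_at)
next
  case (Suc k)
  show ?case
    by (rule Ck_SucI[OF flat_exp_derivative[unfolded has_field_derivative_def]])
      (intro Ck_bilinear[OF bounded_bilinear_mult] Suc Ck_const)
qed

text \<open>One factor switches on at each face of the box, so the product is positive exactly in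
  the open box; the values stay below 1 without any normalisation.\<close>

definition box_bump :: "'a::euclidean_space \<Rightarrow> 'a \<Rightarrow> 'a \<Rightarrow> real" where
  "box_bump a b x = (\<Prod>i\<in>Basis. flat_exp 1 (x \<bullet> i - a \<bullet> i) * flat_exp 1 (b \<bullet> i - x \<bullet> i))"

lemma flat_exp_1: "0 \<le> flat_exp 1 t" "flat_exp 1 t < 1" "0 < flat_exp 1 t \<longleftrightarrow> 0 < t"
  by (auto simp: flat_exp_def)

lemma Ck_box_bump: "Ck k (box_bump a b)"
proof -
  have "Ck k (\<lambda>x. flat_exp 1 (x \<bullet> i - a \<bullet> i))" "Ck k (\<lambda>x. flat_exp 1 (b \<bullet> i - x \<bullet> i))" for i
    using Ck_affine[OF bounded_linear_inner_left[of i] Ck_flat_exp[of k 1], of "- (a \<bullet> i)"]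
      Ck_affine[OF bounded_linear_minus[OF bounded_linear_inner_left[of i]] Ck_flat_exp[of k 1], of "b \<bullet> i"]
    by simp_all
  then show ?thesis
    unfolding box_bump_def[abs_def] by (intro Ck_prod Ck_bilinear[OF bounded_bilinear_mult])
qed

lemma box_bump_pos: "x \<in> box a b \<Longrightarrow> 0 < box_bump a b x"
  unfolding box_bump_def by (intro prod_pos) (auto simp: mem_box flat_exp_1)

lemma box_bump_zero: "x \<notin> box a b \<Longrightarrow> box_bump a b x = 0"
  unfolding box_bump_def mem_box
  by (auto simp: flat_exp_def intro!: prod_zero)

lemma box_bump_bounds: "0 \<le> box_bump a b x" "box_bump a b x < 1"
proof -
  show "0 \<le> box_bump a b x"
    by (cases "x \<in> box a b") (auto simp: box_bump_zero box_bump_pos less_imp_le)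
  have *: "flat_exp 1 s * flat_exp 1 t < 1" for s t
    using mult_strict_mono'[OF flat_exp_1(2)[of s] flat_exp_1(2)[of t] flat_exp_1(1) flat_exp_1(1)] by simp
  \<comment> \<open>Strictness comes from the factors of a single coordinate; the product over the
    others is at most 1.\<close>
  obtain i :: 'a where i: "i \<in> Basis" using nonempty_Basis by blast
  have "box_bump a b x = flat_exp 1 (x \<bullet> i - a \<bullet> i) * flat_exp 1 (b \<bullet> i - x \<bullet> i) *
      (\<Prod>i\<in>Basis - {i}. flat_exp 1 (x \<bullet> i - a \<bullet> i) * flat_exp 1 (b \<bullet> i - x \<bullet> i))"
    unfolding box_bump_def using i by (subst prod.remove) auto
  also have "\<dots> \<le> flat_exp 1 (x \<bullet> i - a \<bullet> i) * flat_exp 1 (b \<bullet> i - x \<bullet> i) * 1"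
    by (intro mult_left_mono prod_le_1) (auto simp: flat_exp_1 less_imp_le *)
  also have "\<dots> < 1" using * by simp
  finally show "box_bump a b x < 1" .
qed

lemma box_bump_test_fun: "cbox a b \<subseteq> S \<Longrightarrow> box_bump a b \<in> test_fun S"
  by (rule test_funI[of _ "cbox a b"])
    (use box_subset_cbox in \<open>auto simp: Ck_box_bump intro!: box_bump_zero\<close>)

text \<open>The powers of \<open>1 - box_bump a b\<close> converge to the indicator of the complement of the box.\<close>

lemma box_indicator_approx:
  fixes S :: "'a::euclidean_space set"
  assumes "cbox a b \<subseteq> S"
  shows "\<exists>\<psi> :: nat \<Rightarrow> 'a \<Rightarrow> real. (\<forall>n. \<psi> n \<in> test_fun S) \<and>
    (\<forall>n x. \<bar>\<psi> n x\<bar> \<le> indicator (box a b) x) \<and>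
    (\<forall>x. (\<lambda>n. \<psi> n x) \<longlonglongrightarrow> indicator (box a b) x)"
proof (intro exI conjI allI)
  let ?\<psi> = "\<lambda>n x. 1 - (1 - box_bump a b x) ^ n"
  show "?\<psi> n \<in> test_fun S" for n
  proof (rule test_funI[OF _ compact_cbox assms])
    show "Ck k (?\<psi> n)" for k
      using Ck_add[OF Ck_const Ck_linear[OF bounded_linear_minus[OF bounded_linear_ident]
          Ck_power[OF Ck_add[OF Ck_const Ck_linear[OF bounded_linear_minus[OF bounded_linear_ident] Ck_box_bump]]]],
          of k 1 1 a b n] by simp
    show "?\<psi> n x = 0" if "x \<notin> cbox a b" for x
      using that box_subset_cbox by (subst box_bump_zero) auto
  qed
  show "\<bar>?\<psi> n x\<bar> \<le> indicator (box a b) x" for n x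
    using box_bump_bounds[of a b x] power_le_one[of "1 - box_bump a b x" n]
    by (cases "x \<in> box a b") (auto simp: box_bump_zero abs_le_iff)
  show "(\<lambda>n. ?\<psi> n x) \<longlonglongrightarrow> indicator (box a b) x" for x
  proof (cases "x \<in> box a b")
    case True
    have "(\<lambda>n. 1 - (1 - box_bump a b x) ^ n) \<longlonglongrightarrow> 1 - 0"
      using box_bump_bounds[of a b x] box_bump_pos[OF True]
      by (intro tendsto_intros LIMSEQ_power_zero) auto
    then show ?thesis using True by simp
  qed (simp add: box_bump_zero)
qed

section \<open>From test functions to \<open>L2\<close>: the fundamental lemma of the calculus of
  variations, density and duality\<close>

lemma lmeasurable_open_bounded: "open S \<Longrightarrow> bounded S \<Longrightarrow> S \<in> lmeasurable"
  by (intro bounded_set_imp_lmeasurable lmeasurable_open) auto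

text \<open>The bridge between two measures: \<open>L2\<close> is built on the completed measure
  restricted to \<open>S\<close>, whereas translations, Fubini and differentiation under the
  integral are carried out for \<open>lborel\<close> on the whole space.\<close>

lemma integral_lebesgue_on_eq_lborel:
  fixes f :: "'a::euclidean_space \<Rightarrow> real"
  assumes "S \<in> sets lebesgue" "f \<in> borel_measurable borel" "\<And>x. x \<notin> S \<Longrightarrow> f x = 0"
  shows "(LINT x|lebesgue_on S. f x) = (LINT x|lborel. f x)"
proof -
  have "(LINT x|lebesgue_on S. f x) = (LINT x|lebesgue. indicator S x *\<^sub>R f x)"
    using assms(1) by (subst integral_restrict_space) auto
  also have "(\<lambda>x. indicator S x *\<^sub>R f x) = f"
    using assms(3) by (auto simp: indicator_def fun_eq_iff)
  also have "(LINT x|lebesgue. f x) = (LINT x|lborel. f x)"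
    using assms(2) by (subst integral_completion) auto
  finally show ?thesis .
qed

lemma continuous_borel: "continuous_on UNIV f \<Longrightarrow> f \<in> borel_measurable borel"
  by (rule borel_measurable_continuous_onI)

lemma bounded_continuous_in_L2:
  fixes f :: "'a::euclidean_space \<Rightarrow> 'b::euclidean_space"
  assumes "S \<in> lmeasurable" "continuous_on UNIV f" "\<And>x. norm (f x) \<le> M"
  shows "f \<in> L2 S"
proof -
  have m: "f \<in> borel_measurable (lebesgue_on S)"
    using continuous_borel[OF assms(2)] by (intro measurable_restrict_space1 measurable_completion) simp
  interpret finite_measure "lebesgue_on S" by (rule finite_measure_lebesgue_on[OF assms(1)])
  have "integrable (lebesgue_on S) (\<lambda>x. (norm (f x))\<^sup>2)"
    using m by (intro integrable_const_bound[of _ "M\<^sup>2"]) (auto intro!: power_mono assms)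
  with m show ?thesis by (simp add: L2_def)
qed

lemma test_fun_L2:
  assumes "S \<in> lmeasurable" "\<phi> \<in> test_fun T"
  shows "\<phi> \<in> L2 S"
proof -
  show ?thesis
    by (rule test_fun_bounded[OF assms(2)])
      (rule bounded_continuous_in_L2[OF assms(1) test_fun_continuous[OF assms(2)]])
qed

lemma test_fun_borel: "\<phi> \<in> test_fun S \<Longrightarrow> \<phi> \<in> borel_measurable borel"
  by (intro continuous_borel test_fun_continuous)

text \<open>Members of \<open>L2 S\<close> are arbitrary outside \<open>S\<close> and measurable
  only for the completion. The zero extension of a Borel version can be translated and integrated
  over the whole space.\<close>

lemma L2_borel_representative:
  fixes g :: "'a::euclidean_space \<Rightarrow> real"
  assumes S: "open S" "bounded S" and g: "g \<in> L2 S"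
  obtains P where "P \<in> borel_measurable borel" "\<And>x. x \<notin> S \<Longrightarrow> P x = 0" "ae_eq S g P" "P \<in> L2 S"
    "integrable lborel P" "integrable lborel (\<lambda>x. (P x)\<^sup>2)"
proof -
  have Sl: "S \<in> sets lebesgue" using S by auto
  have "(\<lambda>x. indicator S x *\<^sub>R g x) \<in> borel_measurable (completion lborel)"
    using L2_measurable[OF g] Sl by (subst (asm) borel_measurable_restrict_space_iff) auto
  then have "\<exists>Q\<in>borel_measurable lborel. AE x in lborel. indicator S x *\<^sub>R g x = Q x"
    by (rule completion_ex_borel_measurable_real)
  then obtain Q where Q: "Q \<in> borel_measurable borel" "AE x in lborel. indicator S x *\<^sub>R g x = Q x"
    by auto
  define P where "P x = indicator S x *\<^sub>R Q x" for x
  have P1: "P \<in> borel_measurable borel"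
    unfolding P_def using Q(1) S by (intro borel_measurable_scaleR borel_measurable_indicator) auto
  have P2: "P x = 0" if "x \<notin> S" for x using that by (simp add: P_def)
  have "AE x in lebesgue. indicator S x *\<^sub>R g x = Q x" by (rule AE_completion[OF Q(2)])
  then have "AE x in lebesgue. x \<in> S \<longrightarrow> g x = P x"
    by (rule AE_mp) (auto simp: P_def)
  then have P3: "ae_eq S g P"
    unfolding ae_eq_def using Sl by (subst AE_restrict_space_iff) auto
  have P_meas: "P \<in> borel_measurable (lebesgue_on S)"
    using P1 by (intro measurable_restrict_space1 measurable_completion) simp
  have P4: "P \<in> L2 S"
  proof -
    have "AE x in lebesgue_on S. (norm (g x))\<^sup>2 = (norm (P x))\<^sup>2"
      using P3 unfolding ae_eq_def by (auto elim: AE_mp)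
    then have "integrable (lebesgue_on S) (\<lambda>x. (norm (P x))\<^sup>2)"
      using P_meas L2_integrable_sq[OF g] L2_measurable[OF g]
      by (subst integrable_cong_AE[where g="\<lambda>x. (norm (g x))\<^sup>2"]) (auto elim: AE_mp)
    then show ?thesis using P_meas by (simp add: L2_def)
  qed
  have to_lborel: "integrable lborel f" if "integrable (lebesgue_on S) f" "f \<in> borel_measurable borel"
    "\<And>x. x \<notin> S \<Longrightarrow> f x = 0" for f :: "'a \<Rightarrow> real"
  proof -
    have "integrable lebesgue (\<lambda>x. indicator S x *\<^sub>R f x)"
      using that(1) Sl by (subst (asm) integrable_restrict_space) auto
    also have "(\<lambda>x. indicator S x *\<^sub>R f x) = f" using that(3) by (auto simp: indicator_def fun_eq_iff)
    finally show ?thesis using that(2) by (subst (asm) integrable_completion) auto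
  qed
  show thesis
  proof (rule that[of P])
    show "integrable lborel P"
      using L2_integrable[OF lmeasurable_open_bounded[OF S] P4] P1 P2 by (rule to_lborel)
    show "integrable lborel (\<lambda>x. (P x)\<^sup>2)"
      using L2_integrable_sq[OF P4] P1 P2 by (intro to_lborel) auto
  qed (use P1 P2 P3 P4 in auto)
qed

text \<open>Boxes form an intersection-stable generator of the Borel sets, and the sets over which
  \<open>P\<close>, cut off to \<open>box a b\<close>, integrates to zero form a Dynkin system. So
  all set integrals vanish, and with them the function.\<close>

lemma AE_zero_cbox:
  fixes P :: "'a::euclidean_space \<Rightarrow> real"
  assumes P: "integrable lborel P"
    and box0: "\<And>c d. box c d \<subseteq> box a b \<Longrightarrow> (LINT x|lborel. indicator (box c d) x * P x) = 0"
  shows "AE x in lborel. x \<in> cbox a b \<longrightarrow> P x = 0"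
proof -
  let ?f = "\<lambda>x. indicator (box a b) x * P x"
  have [measurable]: "P \<in> borel_measurable borel" using P by auto
  have int: "integrable lborel (\<lambda>x. indicator A x * ?f x)" if "A \<in> sets borel" for A
    using integrable_mult_indicator[OF _ integrable_mult_indicator[OF _ P, of "box a b"], of A] that by simp
  have "(LINT x|lborel. indicator A x * ?f x) = 0" if "A \<in> sets borel" for A
  proof -
    have eq: "sets (borel :: 'a measure) = sigma_sets UNIV (range (\<lambda>(a, b). box a b))"
      by (simp add: borel_eq_box)
    have "Int_stable (range (\<lambda>(a, b). box a b :: 'a set))"
      by (auto simp: Int_stable_def box_Int_box)
    moreover have "range (\<lambda>(a, b). box a b :: 'a set) \<subseteq> Pow UNIV" by simp
    ultimately show ?thesis using that[unfolded eq]
    proof (induction rule: sigma_sets_induct_disjoint)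
      case (basic A)
      then obtain c d where A: "A = box c d" by auto
      then obtain c' d' where Int: "A \<inter> box a b = box c' d'" by (auto simp: box_Int_box)
      have "(LINT x|lborel. indicator A x * ?f x) = (LINT x|lborel. indicator (box c' d') x * P x)"
        unfolding Int[symmetric] by (intro Bochner_Integration.integral_cong) (auto simp: indicator_def)
      also have "\<dots> = 0" using Int by (intro box0) auto
      finally show ?case .
    next
      case (compl A)
      then have A: "A \<in> sets borel" by (simp add: eq)
      have "(LINT x|lborel. indicator (UNIV - A) x * ?f x) =
          (LINT x|lborel. ?f x - indicator A x * ?f x)"
        by (intro Bochner_Integration.integral_cong) (auto simp: indicator_def)
      also have "\<dots> = (LINT x|lborel. ?f x) - (LINT x|lborel. indicator A x * ?f x)"
        using int[of UNIV] int[OF A] by (intro Bochner_Integration.integral_diff) auto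
      also have "\<dots> = 0" using compl box0[of a b] by simp
      finally show ?case .
    next
      case (union A)
      then have A: "A i \<in> sets borel" for i by (auto simp: eq)
      have lim: "(\<lambda>n. LINT x|lborel. (\<Sum>i<n. indicator (A i) x * ?f x)) \<longlonglongrightarrow>
          (LINT x|lborel. indicator (\<Union> (range A)) x * ?f x)"
      proof (rule integral_dominated_convergence[where w="\<lambda>x. \<bar>?f x\<bar>"])
        show "AE x in lborel. (\<lambda>n. \<Sum>i<n. indicator (A i) x * ?f x) \<longlonglongrightarrow> indicator (\<Union> (range A)) x * ?f x"
          using indicator_sums[of A "x :: 'a" for x] union(1)
          by (intro AE_I2) (auto simp: disjoint_family_on_def sums_def sum_distrib_right[symmetric] intro!: tendsto_mult)
        show "AE x in lborel. norm (\<Sum>i<n. indicator (A i) x * ?f x) \<le> \<bar>?f x\<bar>" for n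
        proof (intro AE_I2)
          fix x
          have "(\<Sum>i<n. indicator (A i) x * ?f x) = indicator (\<Union>i<n. A i) x * ?f x"
            using union(1)
            by (subst indicator_UN_disjoint) (auto simp: sum_distrib_right disjoint_family_on_def)
          then show "norm (\<Sum>i<n. indicator (A i) x * ?f x) \<le> \<bar>?f x\<bar>"
            by (simp only:) (auto simp: indicator_def)
        qed
        show "integrable lborel (\<lambda>x. \<bar>?f x\<bar>)" using int[of UNIV] by auto
      qed (use A in \<open>auto intro!: borel_measurable_sum borel_measurable_times\<close>)
      have "(LINT x|lborel. (\<Sum>i<n. indicator (A i) x * ?f x)) = 0" for n
        using int[OF A] union(3) by (subst Bochner_Integration.integral_sum) auto
      with lim show ?case by (simp add: LIMSEQ_const_iff)
    qed simp
  qed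
  then have "AE x in lborel. ?f x = 0"
    using int[of UNIV] by (intro sigma_finite_measure.density_zero[OF sigma_finite_lborel]) (auto simp: set_lebesgue_integral_def)
  \<comment> \<open>The passage from the open to the closed box costs only a null boundary.\<close>
  moreover have "AE x in lborel. x \<notin> cbox a b - box a b"
    using negligible_frontier_interval[of a b]
    by (intro AE_not_in) (auto simp: negligible_iff_null_sets null_sets_completion_iff)
  ultimately show ?thesis
    by eventually_elim (auto simp: indicator_def split: if_splits)
qed

text \<open>Box indicators are bounded limits of test functions, so dominated convergence makes the
  integrals over small boxes vanish; countably many closed boxes exhaust the open set.\<close>

lemma du_bois_reymond:
  fixes g :: "'a::euclidean_space \<Rightarrow> real"
  assumes S: "open S" "bounded S" and g: "g \<in> L2 S"
    and orth: "\<And>\<phi>. \<phi> \<in> test_fun S \<Longrightarrow> L2_inner S g \<phi> = 0"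
  shows "ae_eq S g (\<lambda>x. 0)"
proof -
  have Sm: "S \<in> lmeasurable" and Sl: "S \<in> sets lebesgue" using S by (auto intro: lmeasurable_open_bounded)
  obtain P where P: "P \<in> borel_measurable borel" "\<And>x. x \<notin> S \<Longrightarrow> P x = 0" "ae_eq S g P" "P \<in> L2 S"
    "integrable lborel P" using L2_borel_representative[OF S g] by metis
  note [measurable] = P(1)
  have orth_P: "(LINT x|lborel. P x * \<phi> x) = 0" if "\<phi> \<in> test_fun S" for \<phi>
  proof -
    have "(LINT x|lborel. P x * \<phi> x) = L2_inner S P \<phi>"
      unfolding L2_inner_def inner_real_def
      using test_fun_borel[OF that] P by (intro integral_lebesgue_on_eq_lborel[symmetric] Sl) auto
    also have "\<dots> = L2_inner S g \<phi>"
      using P g test_fun_L2[OF Sm that] by (intro L2_inner_cong ae_eq_sym[OF P(3)]) auto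
    finally show ?thesis using orth[OF that] by simp
  qed
  have cbox: "AE x in lborel. x \<in> cbox a b \<longrightarrow> P x = 0" if ab: "cbox a b \<subseteq> S" for a b
  proof (rule AE_zero_cbox[OF P(5)])
    fix c d assume cd: "box c d \<subseteq> box a b"
    show "(LINT x|lborel. indicator (box c d) x * P x) = 0"
    proof (cases "box c d = {}")
      case False
      have "cbox c d = closure (box c d)" using closure_box[OF False] by simp
      also have "\<dots> \<subseteq> cbox a b" using cd box_subset_cbox by (intro closure_minimal closed_cbox) blast
      finally have "cbox c d \<subseteq> S" using ab by simp
      from box_indicator_approx[OF this] obtain \<psi> :: "nat \<Rightarrow> 'a \<Rightarrow> real"
        where "(\<forall>n. \<psi> n \<in> test_fun S) \<and> (\<forall>n x. \<bar>\<psi> n x\<bar> \<le> indicator (box c d) x) \<and>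
          (\<forall>x. (\<lambda>n. \<psi> n x) \<longlonglongrightarrow> indicator (box c d) x)" ..
      then have \<psi>: "\<And>n. \<psi> n \<in> test_fun S" "\<And>n x. \<bar>\<psi> n x\<bar> \<le> indicator (box c d) x"
        "\<And>x. (\<lambda>n. \<psi> n x) \<longlonglongrightarrow> indicator (box c d) x" by simp_all
      have "(\<lambda>n. LINT x|lborel. P x * \<psi> n x) \<longlonglongrightarrow> (LINT x|lborel. indicator (box c d) x * P x)"
      proof (rule integral_dominated_convergence[where w="\<lambda>x. \<bar>P x\<bar>"])
        show "AE x in lborel. (\<lambda>n. P x * \<psi> n x) \<longlonglongrightarrow> indicator (box c d) x * P x"
          using tendsto_mult[OF tendsto_const \<psi>(3)] by (simp add: mult.commute)
        have "\<bar>\<psi> n x\<bar> \<le> 1" for n x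
          by (rule order_trans[OF \<psi>(2) indicator_le_1])
        then show "AE x in lborel. norm (P x * \<psi> n x) \<le> \<bar>P x\<bar>" for n
          by (simp add: abs_mult mult_left_le)
        show "(\<lambda>x. P x * \<psi> n x) \<in> borel_measurable lborel" for n
          using test_fun_borel[OF \<psi>(1)[of n]] by measurable
      qed (use P(5) in auto)
      then show ?thesis by (simp add: orth_P \<psi>(1) LIMSEQ_const_iff)
    qed simp
  qed
  obtain D where D: "countable D" "D \<subseteq> Pow S" "\<And>X. X \<in> D \<Longrightarrow> \<exists>a b. X = cbox a b" "\<Union>D = S"
    using open_countable_Union_open_cbox[OF S(1)] by metis
  have "AE x in lborel. \<forall>X\<in>D. x \<in> X \<longrightarrow> P x = 0"
    using D(2,3) cbox by (intro AE_ball_countable' D(1)) blast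
  then have "AE x in lborel. P x = 0"
    by (rule AE_mp) (use D(4) P(2) in \<open>auto intro!: AE_I2\<close>)
  then have "ae_eq S P (\<lambda>x. 0)"
    unfolding ae_eq_def using Sl
    by (subst AE_restrict_space_iff) (auto intro!: AE_completion elim: AE_mp)
  then show ?thesis using P(3) ae_eq_trans by blast
qed

text \<open>The Riesz element of \<open>v\<close> in the closure of the test functions differs from
  \<open>v\<close> by a function orthogonal to all test functions, which is null by
  \<open>du_bois_reymond\<close>. This replaces mollification.\<close>

lemma test_fun_dense:
  fixes v :: "'a::euclidean_space \<Rightarrow> real"
  assumes S: "open S" "bounded S" and v: "v \<in> L2 S" and "e > 0"
  obtains \<phi> where "\<phi> \<in> test_fun S" "L2_norm S (\<lambda>x. v x - \<phi> x) < e"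
proof -
  have Sm: "S \<in> lmeasurable" using S by (rule lmeasurable_open_bounded)
  interpret L: pre_hilbert "L2 S :: ('a \<Rightarrow> real) set" "L2_inner S" by (rule pre_hilbert_L2)
  let ?T = "test_fun S :: ('a \<Rightarrow> real) set"
  have sub: "?T \<subseteq> L2 S" using test_fun_L2[OF Sm] by auto
  interpret A: pre_hilbert "L.adherence ?T" "L2_inner S"
    by (rule L.closure_pre_hilbert) (use sub in \<open>auto intro: test_fun_add test_fun_scale[where 'b=real, simplified]\<close>)
  have T_A: "\<phi> \<in> L.adherence ?T" if "\<phi> \<in> ?T" for \<phi>
    using that sub by (auto simp: L.adherence_def nrm_L2 intro!: bexI[of _ \<phi>])
  have A_L: "w \<in> L2 S" if "w \<in> L.adherence ?T" for w
    using that by (simp add: L.adherence_def)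
  have "A.complete_space"
    by (rule L.closure_complete[OF L2_complete[OF Sm] sub]) unfold_locales
  then obtain u where u: "u \<in> L.adherence ?T"
    and uv: "\<And>w. w \<in> L.adherence ?T \<Longrightarrow> L2_inner S u w = L2_inner S v w"
  proof (rule A.riesz[where l="L2_inner S v" and M="L2_norm S v"])
    show "L2_inner S v (\<lambda>x. w x + w' x) = L2_inner S v w + L2_inner S v w'"
      if "w \<in> L.adherence ?T" "w' \<in> L.adherence ?T" for w w'
      using that A_L v by (intro L2_inner_add2)
    show "\<bar>L2_inner S v w\<bar> \<le> L2_norm S v * nrm (L2_inner S) w" if "w \<in> L.adherence ?T" for w
      unfolding nrm_L2 by (intro L2_cs v A_L that)
    show "L2_inner S v (\<lambda>x. c *\<^sub>R w x) = c * L2_inner S v w" for c w by (rule L2_inner_scale2)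
  qed (rule that)
  have "ae_eq S (\<lambda>x. v x - u x) (\<lambda>x. 0)"
    using uv[OF T_A] v A_L[OF u] sub
    by (intro du_bois_reymond S) (auto simp: L2_diff L2_inner_diff subset_iff)
  then have eq: "ae_eq S v u" by (simp add: ae_eq_def)
  obtain \<phi> where \<phi>: "\<phi> \<in> ?T" "L2_norm S (\<lambda>x. u x - \<phi> x) < e"
    using L.adherenceD[OF u \<open>e > 0\<close>] by (auto simp: nrm_L2)
  have "L2_norm S (\<lambda>x. v x - \<phi> x) = L2_norm S (\<lambda>x. u x - \<phi> x)"
    using v A_L[OF u] \<phi>(1) sub by (intro L2_norm_cong ae_eq_diff eq L2_diff) auto
  then show thesis using that \<phi> by simp
qed

text \<open>The supremum defining the dual norm is nearly attained at a test function close to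
  \<open>w\<close> itself.\<close>

lemma L2_norm_le_dual:
  fixes w :: "'a::euclidean_space \<Rightarrow> real"
  assumes S: "open S" "bounded S" and w: "w \<in> L2 S" and "M \<ge> 0"
    and bound: "\<And>\<phi>. \<phi> \<in> test_fun S \<Longrightarrow> \<bar>L2_inner S w \<phi>\<bar> \<le> M * L2_norm S \<phi>"
  shows "L2_norm S w \<le> M"
proof (rule ccontr)
  assume "\<not> L2_norm S w \<le> M"
  define N where "N = L2_norm S w"
  have N: "N > M" "N > 0" using \<open>\<not> L2_norm S w \<le> M\<close> \<open>M \<ge> 0\<close> by (auto simp: N_def)
  \<comment> \<open>Chosen such that \<open>(N + M) * e\<close> is half of the gap
    \<open>N * (N - M)\<close> between \<open>N * N\<close> and \<open>M * N\<close>.\<close>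
  define e where "e = N * (N - M) / (2 * (N + M))"
  have "e > 0" using N \<open>M \<ge> 0\<close> by (simp add: e_def)
  then obtain \<phi> where \<phi>: "\<phi> \<in> test_fun S" "L2_norm S (\<lambda>x. w x - \<phi> x) < e"
    using test_fun_dense[OF S w] by blast
  have \<phi>L: "\<phi> \<in> L2 S" using test_fun_L2[OF lmeasurable_open_bounded[OF S] \<phi>(1)] .
  have \<phi>N: "L2_norm S \<phi> \<le> N + L2_norm S (\<lambda>x. w x - \<phi> x)"
    using L2_norm_add[OF w L2_diff[OF \<phi>L w]] L2_norm_minus_commute[OF w \<phi>L] by (simp add: N_def)
  have "N\<^sup>2 = L2_inner S w (\<lambda>x. w x - \<phi> x) + L2_inner S w \<phi>"
    by (simp add: N_def L2_norm_sq L2_inner_diff2 w \<phi>L)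
  also have "\<dots> \<le> N * L2_norm S (\<lambda>x. w x - \<phi> x) + M * L2_norm S \<phi>"
    using L2_cs[OF w L2_diff[OF w \<phi>L]] bound[OF \<phi>(1)] by (simp add: N_def)
  also have "\<dots> \<le> (N + M) * L2_norm S (\<lambda>x. w x - \<phi> x) + M * N"
    using mult_left_mono[OF \<phi>N \<open>M \<ge> 0\<close>] by (simp add: algebra_simps)
  also have "\<dots> < (N + M) * e + M * N"
    using \<phi>(2) N \<open>M \<ge> 0\<close> by simp
  also have "(N + M) * e = N * (N - M) / 2"
    using N \<open>M \<ge> 0\<close> by (simp add: e_def field_simps)
  finally have "N\<^sup>2 < N * (N - M) / 2 + M * N" .
  moreover have "N\<^sup>2 = N * (N - M) + M * N" by (simp add: power2_eq_square algebra_simps)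
  moreover have "N * (N - M) > 0" using N by simp
  ultimately show False by linarith
qed

section \<open>Integration by parts for test functions\<close>

lemma lborel_integral_translate:
  fixes f :: "'a::euclidean_space \<Rightarrow> real"
  assumes [measurable]: "f \<in> borel_measurable borel"
  shows "(LINT x|lborel. f (x + a)) = (LINT x|lborel. f x)"
proof -
  have "(LINT x|lborel. f x) = (LINT x|distr lborel borel ((+) a). f x)"
    by (simp add: lborel_distr_plus)
  also have "\<dots> = (LINT x|lborel. f (a + x))" by (rule integral_distr) measurable
  finally show ?thesis by (simp add: add.commute)
qed

lemma lborel_integrable_translate:
  fixes f :: "'a::euclidean_space \<Rightarrow> real"
  assumes "integrable lborel f"
  shows "integrable lborel (\<lambda>x. f (x + a))"
proof -
  have [measurable]: "f \<in> borel_measurable borel" using assms by auto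
  have "integrable (distr lborel borel ((+) a)) f" using assms by (simp add: lborel_distr_plus)
  then show ?thesis by (subst (asm) integrable_distr_eq) (auto simp: add.commute)
qed

lemma test_fun_integrable:
  fixes \<phi> :: "'a::euclidean_space \<Rightarrow> real"
  assumes \<phi>: "\<phi> \<in> test_fun S"
  shows "integrable lborel \<phi>"
proof -
  obtain K where K: "compact K" "K \<subseteq> S" "\<And>x. x \<notin> K \<Longrightarrow> \<phi> x = 0" using \<phi> by (rule test_funE) (rule that, auto)
  have "integrable lborel (\<lambda>x. indicator K x *\<^sub>R \<phi> x)"
    using K(1) test_fun_continuous[OF \<phi>]
    by (intro borel_integrable_compact) (auto intro: continuous_on_subset)
  also have "(\<lambda>x. indicator K x *\<^sub>R \<phi> x) = \<phi>" using K(3) by (auto simp: indicator_def fun_eq_iff)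
  finally show ?thesis .
qed

lemma test_fun_line_derivative:
  fixes \<phi> :: "'a::euclidean_space \<Rightarrow> real"
  assumes \<phi>: "\<phi> \<in> test_fun S"
  shows "((\<lambda>t. \<phi> (y - t *\<^sub>R h)) has_real_derivative
    - frechet_derivative \<phi> (at (y - t *\<^sub>R h)) h) (at t)"
proof -
  interpret D: bounded_linear "frechet_derivative \<phi> (at (y - t *\<^sub>R h))"
    using has_derivative_bounded_linear test_fun_has_derivative[OF \<phi>] by blast
  have "((\<lambda>t. y - t *\<^sub>R h) has_derivative (\<lambda>s. - (s *\<^sub>R h))) (at t)"
    by (auto intro!: derivative_eq_intros)
  then have "((\<lambda>t. \<phi> (y - t *\<^sub>R h)) has_derivative
      (\<lambda>s. frechet_derivative \<phi> (at (y - t *\<^sub>R h)) (- (s *\<^sub>R h)))) (at t)"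
    by (rule has_derivative_compose[OF _ test_fun_has_derivative[OF \<phi>]])
  moreover have "(\<lambda>s. frechet_derivative \<phi> (at (y - t *\<^sub>R h)) (- (s *\<^sub>R h))) =
      (*) (- frechet_derivative \<phi> (at (y - t *\<^sub>R h)) h)"
    by (simp add: linear_neg[OF D.linear] D.scaleR fun_eq_iff mult.commute)
  ultimately show ?thesis
    by (simp add: has_field_derivative_def)
qed

lemma test_fun_translate_bound:
  fixes \<phi> :: "'a::euclidean_space \<Rightarrow> real"
  assumes \<phi>: "\<phi> \<in> test_fun S" and M: "\<And>x. \<bar>frechet_derivative \<phi> (at x) h\<bar> \<le> M"
  shows "\<bar>\<phi> (y - s *\<^sub>R h) - \<phi> y\<bar> \<le> M * \<bar>s\<bar>"
proof -
  have der: "((\<lambda>t. \<phi> (y - t *\<^sub>R h)) has_real_derivative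
      - frechet_derivative \<phi> (at (y - t *\<^sub>R h)) h) (at t)" for t
    by (rule test_fun_line_derivative[OF \<phi>])
  have "norm (\<phi> (y - s *\<^sub>R h) - \<phi> (y - 0 *\<^sub>R h)) \<le> M * norm (s - 0)"
    by (rule field_differentiable_bound[of UNIV "\<lambda>t. \<phi> (y - t *\<^sub>R h)"])
      (use der M in auto)
  then show ?thesis by simp
qed

text \<open>Differentiation under the integral sign. All smoothness sits in \<phi>, so
  \<open>q\<close> need only be integrable; by the mean value theorem the difference quotients of
  \<phi> are bounded by a bound \<open>M\<close> of its derivative, which gives the majorant
  \<open>M * \<bar>q x\<bar>\<close>.\<close>

lemma translate_integral_derivative:
  fixes \<phi> q :: "'a::euclidean_space \<Rightarrow> real"
  assumes \<phi>: "\<phi> \<in> test_fun S" and q: "integrable lborel q"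
  shows "((\<lambda>t. LINT x|lborel. q x * \<phi> (x - t *\<^sub>R h)) has_real_derivative
    - (LINT x|lborel. q x * frechet_derivative \<phi> (at (x - t *\<^sub>R h)) h)) (at t)"
proof -
  obtain M where M: "M > 0" "\<And>x. \<bar>frechet_derivative \<phi> (at x) h\<bar> \<le> M"
    using test_fun_bounded[OF test_fun_derivative[OF \<phi>, of h]] by (metis real_norm_def)
  obtain M0 where M0: "\<And>x. \<bar>\<phi> x\<bar> \<le> M0" using test_fun_bounded[OF \<phi>] by (metis real_norm_def)
  have [measurable]: "\<phi> \<in> borel_measurable borel" by (rule test_fun_borel[OF \<phi>])
  have [measurable]: "(\<lambda>x. frechet_derivative \<phi> (at x) h) \<in> borel_measurable borel"
    by (rule test_fun_borel[OF test_fun_derivative[OF \<phi>]])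
  have [measurable]: "q \<in> borel_measurable borel" using q by auto
  have int: "integrable lborel (\<lambda>x. q x * \<phi> (x - s *\<^sub>R h))" for s
  proof (rule Bochner_Integration.integrable_bound[where f="\<lambda>x. M0 * q x"])
    show "AE x in lborel. norm (q x * \<phi> (x - s *\<^sub>R h)) \<le> norm (M0 * q x)"
    proof (rule AE_I2)
      fix x
      have "\<bar>\<phi> (x - s *\<^sub>R h)\<bar> \<le> \<bar>M0\<bar>" using M0[of "x - s *\<^sub>R h"] by linarith
      then show "norm (q x * \<phi> (x - s *\<^sub>R h)) \<le> norm (M0 * q x)"
        by (simp add: abs_mult mult.commute[of "\<bar>q x\<bar>"] mult_right_mono)
    qed
  qed (use q in auto)
  let ?G = "\<lambda>t. LINT x|lborel. q x * \<phi> (x - t *\<^sub>R h)"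
  let ?D = "\<lambda>x. - frechet_derivative \<phi> (at (x - t *\<^sub>R h)) h"
  have "((\<lambda>s. (?G (t + s) - ?G t) / s) \<longlongrightarrow> (LINT x|lborel. q x * ?D x)) (at 0)"
    unfolding tendsto_at_iff_sequentially comp_def
  proof (intro allI impI)
    fix X :: "nat \<Rightarrow> real" assume X: "\<forall>i. X i \<in> UNIV - {0}" "X \<longlonglongrightarrow> 0"
    let ?q = "\<lambda>i x. q x * ((\<phi> (x - (t + X i) *\<^sub>R h) - \<phi> (x - t *\<^sub>R h)) / X i)"
    have eq: "(?G (t + X i) - ?G t) / X i = (LINT x|lborel. ?q i x)" for i
    proof -
      have "?G (t + X i) - ?G t = (LINT x|lborel. q x * \<phi> (x - (t + X i) *\<^sub>R h) - q x * \<phi> (x - t *\<^sub>R h))"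
        by (rule Bochner_Integration.integral_diff[OF int int, symmetric])
      then have "(?G (t + X i) - ?G t) / X i =
          (LINT x|lborel. (q x * \<phi> (x - (t + X i) *\<^sub>R h) - q x * \<phi> (x - t *\<^sub>R h)) / X i)"
        by simp
      also have "\<dots> = (LINT x|lborel. ?q i x)"
        by (intro Bochner_Integration.integral_cong) (auto simp: algebra_simps diff_divide_distrib)
      finally show ?thesis .
    qed
    show "(\<lambda>i. (?G (t + X i) - ?G t) / X i) \<longlonglongrightarrow> (LINT x|lborel. q x * ?D x)"
      unfolding eq
    proof (rule integral_dominated_convergence[where w="\<lambda>x. M * \<bar>q x\<bar>"])
      have "((\<lambda>s. (\<phi> (x - (t + s) *\<^sub>R h) - \<phi> (x - t *\<^sub>R h)) / s) \<longlongrightarrow> ?D x) (at 0)" for x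
        using test_fun_line_derivative[OF \<phi>, of x h t] by (simp add: DERIV_def)
      then have "(\<lambda>i. (\<phi> (x - (t + X i) *\<^sub>R h) - \<phi> (x - t *\<^sub>R h)) / X i) \<longlonglongrightarrow> ?D x" for x
        using X unfolding tendsto_at_iff_sequentially comp_def by blast
      then show "AE x in lborel. (\<lambda>i. ?q i x) \<longlonglongrightarrow> q x * ?D x"
        by (intro AE_I2 tendsto_mult tendsto_const)
      have "\<bar>(\<phi> (x - (t + X i) *\<^sub>R h) - \<phi> (x - t *\<^sub>R h)) / X i\<bar> \<le> M" for x i
        using test_fun_translate_bound[OF \<phi> M(2), of "x - t *\<^sub>R h" "X i"] X(1)
        by (simp add: algebra_simps abs_divide divide_le_eq) 
      then show "AE x in lborel. norm (?q i x) \<le> M * \<bar>q x\<bar>" for i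
        by (intro AE_I2) (simp only: real_norm_def abs_mult mult.commute[of M] mult_left_mono abs_ge_zero)
    qed (use q in auto)
  qed
  then show ?thesis by (simp add: DERIV_def)
qed

text \<open>The integral of a translate does not depend on the translation, so its derivative at 0
  vanishes.\<close>

lemma integral_derivative_zero:
  fixes \<phi> :: "'a::euclidean_space \<Rightarrow> real"
  assumes \<phi>: "\<phi> \<in> test_fun S"
  shows "(LINT x|lborel. frechet_derivative \<phi> (at x) h) = 0"
proof -
  obtain K where K: "compact K" "K \<subseteq> S" "\<And>x. x \<notin> K \<Longrightarrow> \<phi> x = 0" using \<phi> by (rule test_funE) (rule that, auto)
  obtain R where R: "\<And>x. x \<in> K \<Longrightarrow> norm x \<le> R"
    using compact_imp_bounded[OF K(1)] by (auto simp: bounded_iff)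
  \<comment> \<open>The constant 1 is not integrable, so it is cut off to a ball that contains the
    support of \<phi> shifted by \<open>t *\<^sub>R h\<close> for all
    \<open>\<bar>t\<bar> < 1\<close>.\<close>
  define q :: "'a \<Rightarrow> real" where "q = indicator (cball 0 (R + norm h))"
  have q: "integrable lborel q"
    unfolding q_def using emeasure_bounded_finite[OF bounded_cball]
    by (intro integrable_real_indicator) auto
  have q1: "q x * \<phi> (x - t *\<^sub>R h) = \<phi> (x - t *\<^sub>R h)" if "\<bar>t\<bar> < 1" for x t
  proof (cases "x - t *\<^sub>R h \<in> K")
    case True
    have "norm x \<le> norm (x - t *\<^sub>R h) + norm (t *\<^sub>R h)" by (metis norm_triangle_sub add.commute)
    also have "\<dots> \<le> R + 1 * norm h"
      using R[OF True] that unfolding norm_scaleR by (intro add_mono mult_right_mono) auto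
    finally show ?thesis by (simp add: q_def)
  qed (use K in simp)
  have [measurable]: "\<phi> \<in> borel_measurable borel" by (rule test_fun_borel[OF \<phi>])
  have "(LINT x|lborel. q x * \<phi> (x - t *\<^sub>R h)) = (LINT x|lborel. \<phi> x)" if "\<bar>t\<bar> < 1" for t
    using lborel_integral_translate[of \<phi> "- t *\<^sub>R h"] by (simp add: q1[OF that])
  then have "((\<lambda>t. LINT x|lborel. q x * \<phi> (x - t *\<^sub>R h)) has_real_derivative 0) (at 0)"
    by (intro has_field_derivative_transform_within_open[OF DERIV_const, of "{-1<..<1}" _ "LINT x|lborel. \<phi> x"]) auto
  then have "(LINT x|lborel. q x * frechet_derivative \<phi> (at (x - 0 *\<^sub>R h)) h) = 0"
    using DERIV_unique[OF translate_integral_derivative[OF \<phi> q, of h 0]] by force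
  moreover have "q x * frechet_derivative \<phi> (at x) h = frechet_derivative \<phi> (at x) h" for x
  proof (cases "x \<in> K")
    case True
    then have "norm x \<le> R + norm h" using R[OF True] norm_ge_zero[of h] by linarith
    then show ?thesis by (simp add: q_def)
  next
    case False
    have "\<phi> \<in> test_fun K" by (rule test_funI[OF test_fun_Ck[OF \<phi>] K(1)]) (use K(3) in auto)
    then have "frechet_derivative \<phi> (at x) h = 0"
      using test_fun_zero_outside[OF test_fun_derivative False] by blast
    then show ?thesis by simp
  qed
  ultimately show ?thesis by simp
qed

lemma integral_cdiv_zero:
  fixes \<psi> :: "'a::euclidean_space \<Rightarrow> 'a"
  assumes \<psi>: "\<psi> \<in> test_fun S"
  shows "(LINT x|lborel. cdiv \<psi> x) = 0"
proof -
  have int: "integrable lborel (\<lambda>x. frechet_derivative \<psi> (at x) i \<bullet> i)" for i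
    by (rule test_fun_integrable) (rule test_fun_linear[OF bounded_linear_inner_left test_fun_derivative[OF \<psi>]])
  have der: "frechet_derivative \<psi> (at x) i \<bullet> i = frechet_derivative (\<lambda>x. \<psi> x \<bullet> i) (at x) i" for x i
    using fun_cong[OF frechet_derivative_at[OF bounded_linear.has_derivative[OF bounded_linear_inner_left
      test_fun_has_derivative[OF \<psi>]]], of x i i] .
  have "(LINT x|lborel. cdiv \<psi> x) = (\<Sum>i\<in>Basis. LINT x|lborel. frechet_derivative \<psi> (at x) i \<bullet> i)"
    unfolding cdiv_def by (rule Bochner_Integration.integral_sum) (rule int)
  also have "\<dots> = 0"
    unfolding der
    by (intro sum.neutral ballI integral_derivative_zero[of _ S] test_fun_linear[OF bounded_linear_inner_left] \<psi>)
  finally show ?thesis .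
qed

lemma cdiv_scaleR:
  fixes \<phi> :: "'a::euclidean_space \<Rightarrow> real"
  assumes "(\<phi> has_derivative frechet_derivative \<phi> (at x)) (at x)" "(\<psi> has_derivative frechet_derivative \<psi> (at x)) (at x)"
  shows "cdiv (\<lambda>x. \<phi> x *\<^sub>R \<psi> x) x = cgrad \<phi> x \<bullet> \<psi> x + \<phi> x * cdiv \<psi> x"
  using frechet_derivative_at[OF has_derivative_scaleR[OF assms], symmetric]
  by (simp add: cdiv_def cgrad_def inner_add_left sum.distrib inner_sum_left sum_distrib_left inner_commute[of _ "\<psi> x"] inner_sum_right)

text \<open>The product \<open>\<phi> \<psi>\<close> is a test field of \<open>S\<close> as soon as
  \<psi> is one. The support of \<phi> is therefore left free, which later allows test functions of
  the whole domain on a single cell.\<close>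

lemma integration_by_parts:
  fixes \<phi> :: "'a::euclidean_space \<Rightarrow> real"
  assumes S: "open S" "bounded S" and \<phi>: "\<phi> \<in> test_fun T" and \<psi>: "\<psi> \<in> test_fun S"
  shows "L2_inner S (cgrad \<phi>) \<psi> = - L2_inner S \<phi> (cdiv \<psi>)"
proof -
  have Sm: "S \<in> lmeasurable" using S by (rule lmeasurable_open_bounded)
  have L: "cgrad \<phi> \<in> L2 S" "\<psi> \<in> L2 S" "\<phi> \<in> L2 S" "cdiv \<psi> \<in> L2 S"
    using \<phi> \<psi> by (auto intro!: test_fun_L2[OF Sm] test_fun_cgrad test_fun_cdiv)
  have prod: "(\<lambda>x. \<phi> x *\<^sub>R \<psi> x) \<in> test_fun S"
    by (rule test_fun_bilinear[OF bounded_bilinear_scaleR test_fun_Ck[OF \<phi>] \<psi>])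
  have "L2_inner S (cgrad \<phi>) \<psi> + L2_inner S \<phi> (cdiv \<psi>) =
      (LINT x|lebesgue_on S. cgrad \<phi> x \<bullet> \<psi> x + \<phi> x * cdiv \<psi> x)"
    unfolding L2_inner_def using L2_integrable_inner[OF L(1,2)] L2_integrable_inner[OF L(3,4)]
    by (subst Bochner_Integration.integral_add) auto
  also have "\<dots> = (LINT x|lebesgue_on S. cdiv (\<lambda>x. \<phi> x *\<^sub>R \<psi> x) x)"
    by (simp add: cdiv_scaleR test_fun_has_derivative[OF \<phi>] test_fun_has_derivative[OF \<psi>])
  also have "\<dots> = (LINT x|lborel. cdiv (\<lambda>x. \<phi> x *\<^sub>R \<psi> x) x)"
    using test_fun_cdiv[OF prod] Sm
    by (intro integral_lebesgue_on_eq_lborel test_fun_borel) (auto intro: test_fun_zero_outside)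
  also have "\<dots> = 0" by (rule integral_cdiv_zero[OF prod])
  finally show ?thesis by simp
qed

text \<open>The test field \<open>\<psi>(x) = (x \<bullet> i) \<phi>(x) i\<close> has divergence \<open>\<phi> + (x \<bullet> i) \<partial>\<^sub>i \<phi>\<close>.\<close>

lemma friedrichs_test_fun:
  fixes \<phi> :: "'a::euclidean_space \<Rightarrow> real"
  assumes S: "open S" "S \<subseteq> cball 0 R" and \<phi>: "\<phi> \<in> test_fun S"
  shows "L2_norm S \<phi> \<le> 2 * R * L2_norm S (cgrad \<phi>)"
proof -
  have bS: "bounded S" using S(2) bounded_subset by blast
  have Sm: "S \<in> lmeasurable" using S bS by (intro lmeasurable_open_bounded)
  obtain i :: 'a where i: "i \<in> Basis" using nonempty_Basis by blast
  define \<psi> where "\<psi> x = ((x \<bullet> i) * \<phi> x) *\<^sub>R i" for x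
  have lin: "Ck k (\<lambda>x. x \<bullet> i)" for k
  proof -
    have "Ck k (\<lambda>x::real. x)"
    proof (induction k)
      case (Suc k)
      show ?case by (rule Ck_SucI[where F="\<lambda>x h. h"]) (auto intro: Ck_const)
    qed (simp add: continuous_on_id)
    from Ck_affine[OF bounded_linear_inner_left[of i] this, of 0] show ?thesis by simp
  qed
  have x\<phi>: "(\<lambda>x. (x \<bullet> i) * \<phi> x) \<in> test_fun S"
    by (rule test_fun_bilinear[OF bounded_bilinear_mult lin \<phi>])
  have \<psi>: "\<psi> \<in> test_fun S"
    unfolding \<psi>_def[abs_def] by (rule test_fun_linear[OF bounded_linear_scaleR_left x\<phi>])
  have div: "cdiv \<psi> x = \<phi> x + (x \<bullet> i) * (cgrad \<phi> x \<bullet> i)" for x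
  proof -
    have "((\<lambda>x. (x \<bullet> i) * \<phi> x) has_derivative (\<lambda>h. (x \<bullet> i) * frechet_derivative \<phi> (at x) h + (h \<bullet> i) * \<phi> x)) (at x)"
      by (intro has_derivative_mult test_fun_has_derivative[OF \<phi>] has_derivative_inner_left has_derivative_ident)
    from fun_cong[OF frechet_derivative_at[OF this], of i]
    have "frechet_derivative (\<lambda>x. (x \<bullet> i) * \<phi> x) (at x) i = (x \<bullet> i) * frechet_derivative \<phi> (at x) i + (i \<bullet> i) * \<phi> x"
      by simp
    moreover have "(\<lambda>x. (x \<bullet> i) * \<phi> x) differentiable (at x)" "\<phi> differentiable (at x)"
      using test_fun_has_derivative[OF x\<phi>] test_fun_has_derivative[OF \<phi>] by (auto simp: differentiable_def)
    ultimately show ?thesis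
      using i unfolding \<psi>_def[abs_def] by (simp add: cdiv_scaleR_const cgrad_inner)
  qed
  have L: "\<phi> \<in> L2 S" "cgrad \<phi> \<in> L2 S" "cdiv \<psi> \<in> L2 S" "\<psi> \<in> L2 S"
    using \<phi> \<psi> by (auto intro!: test_fun_L2[OF Sm] test_fun_cgrad test_fun_cdiv)
  have "L2_inner S \<phi> (cdiv \<psi>) = L2_inner S \<phi> \<phi> + L2_inner S (cgrad \<phi>) \<psi>"
  proof -
    have "L2_inner S \<phi> (cdiv \<psi>) = (LINT x|lebesgue_on S. \<phi> x \<bullet> \<phi> x + cgrad \<phi> x \<bullet> \<psi> x)"
      unfolding L2_inner_def by (simp add: div \<psi>_def algebra_simps)
    also have "\<dots> = L2_inner S \<phi> \<phi> + L2_inner S (cgrad \<phi>) \<psi>"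
      unfolding L2_inner_def using L
      by (intro Bochner_Integration.integral_add L2_integrable_inner)
    finally show ?thesis .
  qed
  \<comment> \<open>By parts, the left-hand side also equals minus the last term; comparing the two
    gives the factor 2 of the final constant.\<close>
  then have eq: "L2_inner S \<phi> \<phi> = - 2 * L2_inner S (cgrad \<phi>) \<psi>"
    using integration_by_parts[OF S(1) bS \<phi> \<psi>] by simp
  have "L2_inner S \<psi> \<psi> \<le> R\<^sup>2 * L2_inner S \<phi> \<phi>"
  proof -
    have "\<psi> x \<bullet> \<psi> x \<le> R\<^sup>2 * (\<phi> x \<bullet> \<phi> x)" for x
    proof (cases "x \<in> S")
      case True
      have "\<bar>x \<bullet> i\<bar> \<le> R" using S(2) True Basis_le_norm[OF i, of x] by fastforce
      then have "(x \<bullet> i)\<^sup>2 \<le> R\<^sup>2" by (metis abs_le_square_iff abs_ge_self order_trans)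
      from mult_right_mono[OF this, of "(\<phi> x)\<^sup>2"] show ?thesis
        using i by (simp add: \<psi>_def power2_eq_square mult_ac)
    next
      case False
      then show ?thesis using test_fun_zero_outside[OF \<phi>] by (simp add: \<psi>_def)
    qed
    then have "(LINT x|lebesgue_on S. \<psi> x \<bullet> \<psi> x) \<le> (LINT x|lebesgue_on S. R\<^sup>2 * (\<phi> x \<bullet> \<phi> x))"
      using L by (intro integral_mono Bochner_Integration.integrable_mult_right L2_integrable_inner)
    then show ?thesis by (simp add: L2_inner_def)
  qed
  then have \<psi>n: "L2_norm S \<psi> \<le> \<bar>R\<bar> * L2_norm S \<phi>"
    unfolding L2_norm_def using real_sqrt_le_mono[of "L2_inner S \<psi> \<psi>" "R\<^sup>2 * L2_inner S \<phi> \<phi>"]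
    by (simp add: real_sqrt_mult)
  show ?thesis
  \<comment> \<open>\<open>R \<ge> 0\<close> follows only once \<open>S\<close> has a point.\<close>
  proof (cases "S = {}")
    case True
    then have "\<phi> = (\<lambda>x. 0)" using test_fun_zero_outside[OF \<phi>] by auto
    then show ?thesis using True by (simp add: L2_norm_def L2_inner_def cgrad_def)
  next
    case False
    then obtain x where "x \<in> S" by blast
    with S(2) have "norm x \<le> R" by auto
    with norm_ge_zero[of x] have R: "R \<ge> 0" by linarith
    have "(L2_norm S \<phi>)\<^sup>2 \<le> 2 * (L2_norm S (cgrad \<phi>) * L2_norm S \<psi>)"
      unfolding L2_norm_sq[OF L(1)] eq using L2_cs[OF L(2,4)] by linarith
    also have "\<dots> \<le> 2 * (L2_norm S (cgrad \<phi>) * (R * L2_norm S \<phi>))"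
      using \<psi>n R L by (intro mult_left_mono) (auto simp: L2_norm_nonneg)
    finally have "L2_norm S \<phi> * L2_norm S \<phi> \<le> (2 * R * L2_norm S (cgrad \<phi>)) * L2_norm S \<phi>"
      by (simp add: power2_eq_square algebra_simps)
    then show ?thesis
      using L2_norm_nonneg[OF L(1)] L2_norm_nonneg[OF L(2)] R
      by (cases "L2_norm S \<phi> = 0") (auto simp: mult_le_cancel_right)
  qed
qed

section \<open>Sobolev spaces on bounded open sets\<close>

text \<open>Interpreted for the domain as well as for each cell of a mesh; Lipschitz regularity
  enters as a separate hypothesis.\<close>

locale bounded_open =
  fixes S :: "'a::euclidean_space set"
  assumes open_S: "open S" and bounded_S: "bounded S"
begin

lemma S_lmeasurable: "S \<in> lmeasurable"
  using open_S bounded_S by (rule lmeasurable_open_bounded)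

lemma S_sets: "S \<in> sets lebesgue"
  using S_lmeasurable by auto

lemma test_L2: "\<phi> \<in> test_fun T \<Longrightarrow> \<phi> \<in> L2 S"
  by (rule test_fun_L2[OF S_lmeasurable])

lemma du_bois_reymond_vector:
  fixes g :: "'a \<Rightarrow> 'a"
  assumes g: "g \<in> L2 S" and orth: "\<And>\<phi>. \<phi> \<in> test_fun S \<Longrightarrow> L2_inner S g \<phi> = 0"
  shows "ae_eq S g (\<lambda>x. 0)"
proof -
  have "ae_eq S (\<lambda>x. g x \<bullet> i) (\<lambda>x. 0)" if i: "i \<in> Basis" for i
  proof (rule du_bois_reymond[OF open_S bounded_S])
    have meas: "(\<lambda>x. g x \<bullet> i) \<in> borel_measurable (lebesgue_on S)"
      using L2_measurable[OF g] by measurable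
    have "integrable (lebesgue_on S) (\<lambda>x. (norm (g x \<bullet> i))\<^sup>2)"
    proof (rule Bochner_Integration.integrable_bound[OF L2_integrable_sq[OF g]])
      show "AE x in lebesgue_on S. norm ((norm (g x \<bullet> i))\<^sup>2) \<le> norm ((norm (g x))\<^sup>2)"
        using Basis_le_norm[OF i] by (intro AE_I2) (simp add: power_mono abs_le_square_iff[symmetric])
    qed (use meas in measurable)
    then show "(\<lambda>x. g x \<bullet> i) \<in> L2 S" using meas by (simp add: L2_def)
    fix \<phi> :: "'a \<Rightarrow> real" assume "\<phi> \<in> test_fun S"
    from orth[OF test_fun_linear[OF bounded_linear_scaleR_left this, of i]]
    show "L2_inner S (\<lambda>x. g x \<bullet> i) \<phi> = 0" by (simp add: L2_inner_def mult.commute)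
  qed
  then have "AE x in lebesgue_on S. \<forall>i\<in>Basis. g x \<bullet> i = 0"
    unfolding ae_eq_def by (intro AE_finite_allI) auto
  then show ?thesis
    unfolding ae_eq_def by (rule AE_mp) (auto simp: euclidean_all_zero_iff)
qed

lemma ae_eq_test:
  fixes f g :: "'a \<Rightarrow> real"
  assumes "f \<in> L2 S" "g \<in> L2 S" "\<And>\<phi>. \<phi> \<in> test_fun S \<Longrightarrow> L2_inner S f \<phi> = L2_inner S g \<phi>"
  shows "ae_eq S f g"
proof -
  have "ae_eq S (\<lambda>x. f x - g x) (\<lambda>x. 0)"
    using assms by (intro du_bois_reymond open_S bounded_S L2_diff) (simp_all add: L2_inner_diff test_L2)
  then show ?thesis by (simp add: ae_eq_def)
qed

lemma ae_eq_test_vector: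
  fixes f g :: "'a \<Rightarrow> 'a"
  assumes "f \<in> L2 S" "g \<in> L2 S" "\<And>\<phi>. \<phi> \<in> test_fun S \<Longrightarrow> L2_inner S f \<phi> = L2_inner S g \<phi>"
  shows "ae_eq S f g"
proof -
  have "ae_eq S (\<lambda>x. f x - g x) (\<lambda>x. 0)"
    using assms by (intro du_bois_reymond_vector L2_diff) (simp_all add: L2_inner_diff test_L2)
  then show ?thesis by (simp add: ae_eq_def)
qed

lemma H1_L2: "v \<in> H1 S \<Longrightarrow> v \<in> L2 S"
  by (simp add: H1_def)

lemma Hdiv_L2: "\<tau> \<in> Hdiv S \<Longrightarrow> \<tau> \<in> L2 S"
  by (simp add: Hdiv_def)

lemma H1_I: "v \<in> L2 S \<Longrightarrow> is_weak_grad S v g \<Longrightarrow> v \<in> H1 S"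
  by (auto simp: H1_def)

lemma Hdiv_I: "\<tau> \<in> L2 S \<Longrightarrow> is_weak_div S \<tau> q \<Longrightarrow> \<tau> \<in> Hdiv S"
  by (auto simp: Hdiv_def)

lemma wgrad_weak: "v \<in> H1 S \<Longrightarrow> is_weak_grad S v (wgrad S v)"
  using someI_ex[of "is_weak_grad S v"] by (simp add: H1_def wgrad_def)

lemma wdiv_weak: "\<tau> \<in> Hdiv S \<Longrightarrow> is_weak_div S \<tau> (wdiv S \<tau>)"
  using someI_ex[of "is_weak_div S \<tau>"] by (simp add: Hdiv_def wdiv_def)

lemma wgrad_L2: "v \<in> H1 S \<Longrightarrow> wgrad S v \<in> L2 S"
  using wgrad_weak by (auto simp: is_weak_grad_def)

lemma wdiv_L2: "\<tau> \<in> Hdiv S \<Longrightarrow> wdiv S \<tau> \<in> L2 S"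
  using wdiv_weak by (auto simp: is_weak_div_def)

lemma wgrad_test:
  "v \<in> H1 S \<Longrightarrow> \<phi> \<in> test_fun S \<Longrightarrow> L2_inner S (wgrad S v) \<phi> = - L2_inner S v (cdiv \<phi>)"
  using wgrad_weak by (auto simp: is_weak_grad_def)

lemma wdiv_test:
  "\<tau> \<in> Hdiv S \<Longrightarrow> \<phi> \<in> test_fun S \<Longrightarrow> L2_inner S (wdiv S \<tau>) \<phi> = - L2_inner S \<tau> (cgrad \<phi>)"
  using wdiv_weak by (auto simp: is_weak_div_def)

text \<open>The choice made by \<open>SOME\<close> agrees almost everywhere with any known weak
  gradient, since test functions separate; this is how \<open>wgrad\<close> gets evaluated.\<close>

lemma wgrad_eqI:
  assumes "v \<in> L2 S" "is_weak_grad S v g"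
  shows "ae_eq S (wgrad S v) g"
  using wgrad_weak[OF H1_I[OF assms]] assms(2)
  by (intro ae_eq_test_vector) (auto simp: is_weak_grad_def)

lemma wdiv_eqI:
  assumes "\<tau> \<in> L2 S" "is_weak_div S \<tau> q"
  shows "ae_eq S (wdiv S \<tau>) q"
  using wdiv_weak[OF Hdiv_I[OF assms]] assms(2)
  by (intro ae_eq_test) (auto simp: is_weak_div_def)

lemma is_weak_grad_add:
  assumes "u \<in> L2 S" "v \<in> L2 S" "is_weak_grad S u g" "is_weak_grad S v h"
  shows "is_weak_grad S (\<lambda>x. u x + v x) (\<lambda>x. g x + h x)"
  using assms unfolding is_weak_grad_def
  by (auto simp: L2_add L2_inner_add test_L2 test_L2[OF test_fun_cdiv])

lemma is_weak_grad_scale: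
  "is_weak_grad S u g \<Longrightarrow> is_weak_grad S (\<lambda>x. c *\<^sub>R u x) (\<lambda>x. c *\<^sub>R g x)"
  unfolding is_weak_grad_def by (auto simp: L2_scale L2_inner_scale simp del: real_scaleR_def)

lemma is_weak_grad_cong:
  assumes "is_weak_grad S u g" "ae_eq S u v" "ae_eq S g h" "u \<in> L2 S" "v \<in> L2 S" "h \<in> L2 S"
  shows "is_weak_grad S v h"
proof -
  have gL: "g \<in> L2 S" using assms(1) by (simp add: is_weak_grad_def)
  have "L2_inner S h \<phi> = L2_inner S g \<phi>" "L2_inner S v (cdiv \<phi>) = L2_inner S u (cdiv \<phi>)"
    if "\<phi> \<in> test_fun S" for \<phi>
    by (rule L2_inner_cong[OF ae_eq_sym[OF assms(3)] ae_eq_refl assms(6) gL test_L2[OF that] test_L2[OF that]])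
      (rule L2_inner_cong[OF ae_eq_sym[OF assms(2)] ae_eq_refl assms(5,4)
          test_L2[OF test_fun_cdiv[OF that]] test_L2[OF test_fun_cdiv[OF that]]])
  then show ?thesis using assms by (auto simp: is_weak_grad_def)
qed

lemma is_weak_div_add:
  assumes "u \<in> L2 S" "v \<in> L2 S" "is_weak_div S u g" "is_weak_div S v h"
  shows "is_weak_div S (\<lambda>x. u x + v x) (\<lambda>x. g x + h x)"
  using assms unfolding is_weak_div_def
  by (auto simp: L2_add L2_inner_add test_L2 test_L2[OF test_fun_cgrad])

lemma is_weak_div_scale:
  "is_weak_div S u g \<Longrightarrow> is_weak_div S (\<lambda>x. c *\<^sub>R u x) (\<lambda>x. c *\<^sub>R g x)"
  unfolding is_weak_div_def by (auto simp: L2_scale L2_inner_scale simp del: real_scaleR_def)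

lemma is_weak_div_cong:
  assumes "is_weak_div S u g" "ae_eq S u v" "ae_eq S g h" "u \<in> L2 S" "v \<in> L2 S" "h \<in> L2 S"
  shows "is_weak_div S v h"
proof -
  have gL: "g \<in> L2 S" using assms(1) by (simp add: is_weak_div_def)
  have "L2_inner S h \<phi> = L2_inner S g \<phi>" "L2_inner S v (cgrad \<phi>) = L2_inner S u (cgrad \<phi>)"
    if "\<phi> \<in> test_fun S" for \<phi>
    by (rule L2_inner_cong[OF ae_eq_sym[OF assms(3)] ae_eq_refl assms(6) gL test_L2[OF that] test_L2[OF that]])
      (rule L2_inner_cong[OF ae_eq_sym[OF assms(2)] ae_eq_refl assms(5,4)
          test_L2[OF test_fun_cgrad[OF that]] test_L2[OF test_fun_cgrad[OF that]]])
  then show ?thesis using assms by (auto simp: is_weak_div_def)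
qed

lemma H1_add: "u \<in> H1 S \<Longrightarrow> v \<in> H1 S \<Longrightarrow> (\<lambda>x. u x + v x) \<in> H1 S"
  by (rule H1_I[OF _ is_weak_grad_add]) (auto intro: L2_add wgrad_weak H1_L2)

lemma wgrad_add:
  "u \<in> H1 S \<Longrightarrow> v \<in> H1 S \<Longrightarrow> ae_eq S (wgrad S (\<lambda>x. u x + v x)) (\<lambda>x. wgrad S u x + wgrad S v x)"
  by (rule wgrad_eqI[OF _ is_weak_grad_add]) (auto intro: L2_add wgrad_weak H1_L2)

lemma H1_scale: "u \<in> H1 S \<Longrightarrow> (\<lambda>x. c *\<^sub>R u x) \<in> H1 S"
  by (rule H1_I[OF L2_scale is_weak_grad_scale]) (auto intro: wgrad_weak H1_L2)

lemma wgrad_scale: "u \<in> H1 S \<Longrightarrow> ae_eq S (wgrad S (\<lambda>x. c *\<^sub>R u x)) (\<lambda>x. c *\<^sub>R wgrad S u x)"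
  by (rule wgrad_eqI[OF L2_scale is_weak_grad_scale]) (auto intro: wgrad_weak H1_L2)

lemma Hdiv_add: "u \<in> Hdiv S \<Longrightarrow> v \<in> Hdiv S \<Longrightarrow> (\<lambda>x. u x + v x) \<in> Hdiv S"
  by (rule Hdiv_I[OF _ is_weak_div_add]) (auto intro: L2_add wdiv_weak Hdiv_L2)

lemma wdiv_add:
  "u \<in> Hdiv S \<Longrightarrow> v \<in> Hdiv S \<Longrightarrow> ae_eq S (wdiv S (\<lambda>x. u x + v x)) (\<lambda>x. wdiv S u x + wdiv S v x)"
  by (rule wdiv_eqI[OF _ is_weak_div_add]) (auto intro: L2_add wdiv_weak Hdiv_L2)

lemma Hdiv_scale: "u \<in> Hdiv S \<Longrightarrow> (\<lambda>x. c *\<^sub>R u x) \<in> Hdiv S"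
  by (rule Hdiv_I[OF L2_scale is_weak_div_scale]) (auto intro: wdiv_weak Hdiv_L2)

lemma wdiv_scale: "u \<in> Hdiv S \<Longrightarrow> ae_eq S (wdiv S (\<lambda>x. c *\<^sub>R u x)) (\<lambda>x. c *\<^sub>R wdiv S u x)"
  by (rule wdiv_eqI[OF L2_scale is_weak_div_scale]) (auto intro: wdiv_weak Hdiv_L2)

lemma H1_diff: "u \<in> H1 S \<Longrightarrow> v \<in> H1 S \<Longrightarrow> (\<lambda>x. u x - v x) \<in> H1 S"
  using H1_add[OF _ H1_scale, of u v "-1"] by simp

lemma Hdiv_diff: "u \<in> Hdiv S \<Longrightarrow> v \<in> Hdiv S \<Longrightarrow> (\<lambda>x. u x - v x) \<in> Hdiv S"
  using Hdiv_add[OF _ Hdiv_scale, of u v "-1"] by simp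

lemma wgrad_diff:
  assumes "u \<in> H1 S" "v \<in> H1 S"
  shows "ae_eq S (wgrad S (\<lambda>x. u x - v x)) (\<lambda>x. wgrad S u x - wgrad S v x)"
  using wgrad_add[OF assms(1) H1_scale[OF assms(2)], of "-1"]
    ae_eq_add[OF ae_eq_refl wgrad_scale[OF assms(2), of "-1"], of "wgrad S u"] ae_eq_trans by simp blast

lemma wdiv_diff:
  assumes "u \<in> Hdiv S" "v \<in> Hdiv S"
  shows "ae_eq S (wdiv S (\<lambda>x. u x - v x)) (\<lambda>x. wdiv S u x - wdiv S v x)"
  using wdiv_add[OF assms(1) Hdiv_scale[OF assms(2)], of "-1"]
    ae_eq_add[OF ae_eq_refl wdiv_scale[OF assms(2), of "-1"], of "wdiv S u"] ae_eq_trans by simp blast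

lemma H1_cong:
  assumes "u \<in> H1 S" "ae_eq S u v" "v \<in> L2 S"
  shows "v \<in> H1 S" "ae_eq S (wgrad S v) (wgrad S u)"
  using is_weak_grad_cong[OF wgrad_weak[OF assms(1)] assms(2) ae_eq_refl H1_L2[OF assms(1)] assms(3)
      wgrad_L2[OF assms(1)]] assms(3)
  by (auto intro: H1_I wgrad_eqI)

lemma Hdiv_cong:
  assumes "u \<in> Hdiv S" "ae_eq S u v" "v \<in> L2 S"
  shows "v \<in> Hdiv S" "ae_eq S (wdiv S v) (wdiv S u)"
  using is_weak_div_cong[OF wdiv_weak[OF assms(1)] assms(2) ae_eq_refl Hdiv_L2[OF assms(1)] assms(3)
      wdiv_L2[OF assms(1)]] assms(3)
  by (auto intro: Hdiv_I wdiv_eqI)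

text \<open>No support in \<open>S\<close> is required of \<phi>, as the test field it is paired
  with has compact support in \<open>S\<close>. So test functions of the domain belong to
  \<open>H1\<close> of every cell.\<close>

lemma test_weak_grad:
  fixes \<phi> :: "'a \<Rightarrow> real"
  shows "\<phi> \<in> test_fun T \<Longrightarrow> is_weak_grad S \<phi> (cgrad \<phi>)"
  unfolding is_weak_grad_def
  using integration_by_parts[OF open_S bounded_S] test_L2[OF test_fun_cgrad] by blast

lemma test_weak_div:
  fixes \<phi> :: "'a \<Rightarrow> 'a"
  assumes "\<phi> \<in> test_fun S"
  shows "is_weak_div S \<phi> (cdiv \<phi>)"
  unfolding is_weak_div_def
proof (intro conjI ballI)
  show "L2_inner S (cdiv \<phi>) \<psi> = - L2_inner S \<phi> (cgrad \<psi>)" if "\<psi> \<in> test_fun S" for \<psi>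
    using integration_by_parts[OF open_S bounded_S that assms] by (simp add: L2_inner_commute)
qed (rule test_L2[OF test_fun_cdiv[OF assms]])

lemma test_H1: "\<phi> \<in> test_fun T \<Longrightarrow> \<phi> \<in> H1 S"
  by (rule H1_I[OF test_L2 test_weak_grad])

lemma test_wgrad: "\<phi> \<in> test_fun T \<Longrightarrow> ae_eq S (wgrad S \<phi>) (cgrad \<phi>)"
  by (rule wgrad_eqI[OF test_L2 test_weak_grad])

lemma test_Hdiv: "\<phi> \<in> test_fun S \<Longrightarrow> \<phi> \<in> Hdiv S"
  by (rule Hdiv_I[OF test_L2 test_weak_div])

lemma test_wdiv: "\<phi> \<in> test_fun S \<Longrightarrow> ae_eq S (wdiv S \<phi>) (cdiv \<phi>)"
  by (rule wdiv_eqI[OF test_L2 test_weak_div])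

subsection \<open>The Hilbert space \<open>H1\<close>\<close>

definition H1_inner :: "('a \<Rightarrow> real) \<Rightarrow> ('a \<Rightarrow> real) \<Rightarrow> real" where
  "H1_inner u v = L2_inner S u v + L2_inner S (wgrad S u) (wgrad S v)"

text \<open>Constants have seminorm zero on \<open>H1 S\<close>; on \<open>H1_0 S\<close>
  Friedrichs' inequality makes it equivalent to the \<open>H1\<close> norm.\<close>

definition grad_inner :: "('a \<Rightarrow> real) \<Rightarrow> ('a \<Rightarrow> real) \<Rightarrow> real" where
  "grad_inner u v = L2_inner S (wgrad S u) (wgrad S v)"

lemma nrm_grad: "nrm grad_inner v = L2_norm S (wgrad S v)"
  by (simp add: nrm_def grad_inner_def L2_norm_def)

lemma pre_hilbert_grad: "pre_hilbert (H1 S) grad_inner"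
proof
  fix u v w c assume u: "u \<in> H1 S" and v: "v \<in> H1 S" and w: "w \<in> H1 S"
  note L = wgrad_L2[OF u] wgrad_L2[OF v] wgrad_L2[OF w]
  have "L2_inner S (wgrad S (\<lambda>x. u x + v x)) (wgrad S w) = L2_inner S (\<lambda>x. wgrad S u x + wgrad S v x) (wgrad S w)"
    using L by (intro L2_inner_cong wgrad_add ae_eq_refl u v w wgrad_L2 H1_add L2_add)
  then show "grad_inner (\<lambda>x. u x + v x) w = grad_inner u w + grad_inner v w"
    unfolding grad_inner_def using L by (simp add: L2_inner_add)
  have "L2_inner S (wgrad S (\<lambda>x. c *\<^sub>R u x)) (wgrad S w) = L2_inner S (\<lambda>x. c *\<^sub>R wgrad S u x) (wgrad S w)"
    using L by (intro L2_inner_cong wgrad_scale ae_eq_refl u w wgrad_L2 H1_scale L2_scale)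
  then show "grad_inner (\<lambda>x. c *\<^sub>R u x) w = c * grad_inner u w"
    unfolding grad_inner_def by (simp add: L2_inner_scale)
qed (auto simp: grad_inner_def L2_inner_commute H1_add H1_scale[simplified] L2_inner_nonneg wgrad_L2 test_H1[OF test_fun_zero])

lemma pre_hilbert_H1: "pre_hilbert (H1 S) H1_inner"
proof -
  interpret G: pre_hilbert "H1 S" grad_inner by (rule pre_hilbert_grad)
  have eq: "H1_inner u v = L2_inner S u v + grad_inner u v" for u v
    by (simp add: H1_inner_def grad_inner_def)
  show ?thesis
  proof
    fix u v w c assume "u \<in> H1 S" "v \<in> H1 S" "w \<in> H1 S"
    then show "H1_inner (\<lambda>x. u x + v x) w = H1_inner u w + H1_inner v w"
      by (simp add: eq G.B_add L2_inner_add H1_L2)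
  next
    fix u w c assume "u \<in> H1 S" "w \<in> H1 S"
    then show "H1_inner (\<lambda>x. c *\<^sub>R u x) w = c * H1_inner u w"
      unfolding eq by (simp only: G.B_scale L2_inner_scale distrib_left)
  qed (auto simp: eq G.B_sym L2_inner_commute G.zero G.add G.scale[simplified] G.B_nonneg L2_inner_nonneg H1_L2)
qed

lemma nrm_H1: "u \<in> H1 S \<Longrightarrow> nrm H1_inner u = H1_norm S u"
  by (simp add: nrm_def H1_inner_def H1_norm_def L2_norm_sq H1_L2 wgrad_L2)

lemma L2_norm_le_H1_norm: "u \<in> H1 S \<Longrightarrow> L2_norm S u \<le> H1_norm S u"
  unfolding H1_norm_def by (rule real_le_rsqrt) simp

lemma L2_norm_wgrad_le_H1_norm: "u \<in> H1 S \<Longrightarrow> L2_norm S (wgrad S u) \<le> H1_norm S u"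
  unfolding H1_norm_def by (rule real_le_rsqrt) simp

lemma H1_norm_le: "u \<in> H1 S \<Longrightarrow> H1_norm S u \<le> L2_norm S u + L2_norm S (wgrad S u)"
  unfolding H1_norm_def by (rule sqrt_sum_squares_le_sum) (simp_all add: L2_norm_nonneg H1_L2 wgrad_L2)

text \<open>Closedness of the weak gradient: both sides of the defining identity are continuous in
  \<open>L2\<close> for a fixed test field.\<close>

lemma is_weak_grad_limit:
  assumes X: "\<And>n. X n \<in> H1 S" and u: "u \<in> L2 S" "(\<lambda>n. L2_norm S (\<lambda>x. X n x - u x)) \<longlonglongrightarrow> 0"
    and g: "g \<in> L2 S" "(\<lambda>n. L2_norm S (\<lambda>x. wgrad S (X n) x - g x)) \<longlonglongrightarrow> 0"
  shows "is_weak_grad S u g"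
  unfolding is_weak_grad_def
proof (intro conjI g ballI)
  fix \<phi> :: "'a \<Rightarrow> 'a" assume \<phi>: "\<phi> \<in> test_fun S"
  have "(\<lambda>n. L2_inner S (wgrad S (X n)) \<phi>) \<longlonglongrightarrow> L2_inner S g \<phi>"
    by (rule L2_inner_tendsto[OF wgrad_L2[OF X] g(1) test_L2[OF \<phi>] g(2)])
  moreover have "(\<lambda>n. - L2_inner S (X n) (cdiv \<phi>)) \<longlonglongrightarrow> - L2_inner S u (cdiv \<phi>)"
    by (intro tendsto_minus L2_inner_tendsto[OF H1_L2[OF X] u(1) test_L2[OF test_fun_cdiv[OF \<phi>]] u(2)])
  ultimately show "L2_inner S g \<phi> = - L2_inner S u (cdiv \<phi>)"
    by (simp add: wgrad_test[OF X \<phi>] LIMSEQ_unique)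
qed

lemma is_weak_div_limit:
  assumes X: "\<And>n. X n \<in> Hdiv S" and u: "u \<in> L2 S" "(\<lambda>n. L2_norm S (\<lambda>x. X n x - u x)) \<longlonglongrightarrow> 0"
    and g: "g \<in> L2 S" "(\<lambda>n. L2_norm S (\<lambda>x. wdiv S (X n) x - g x)) \<longlonglongrightarrow> 0"
  shows "is_weak_div S u g"
  unfolding is_weak_div_def
proof (intro conjI g ballI)
  fix \<phi> :: "'a \<Rightarrow> real" assume \<phi>: "\<phi> \<in> test_fun S"
  have "(\<lambda>n. L2_inner S (wdiv S (X n)) \<phi>) \<longlonglongrightarrow> L2_inner S g \<phi>"
    by (rule L2_inner_tendsto[OF wdiv_L2[OF X] g(1) test_L2[OF \<phi>] g(2)])
  moreover have "(\<lambda>n. - L2_inner S (X n) (cgrad \<phi>)) \<longlonglongrightarrow> - L2_inner S u (cgrad \<phi>)"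
    by (intro tendsto_minus L2_inner_tendsto[OF Hdiv_L2[OF X] u(1) test_L2[OF test_fun_cgrad[OF \<phi>]] u(2)])
  ultimately show "L2_inner S g \<phi> = - L2_inner S u (cgrad \<phi>)"
    by (simp add: wdiv_test[OF X \<phi>] LIMSEQ_unique)
qed

lemma L2_Cauchy_limit:
  fixes X :: "nat \<Rightarrow> 'a \<Rightarrow> 'b::euclidean_space"
  assumes "\<And>n. X n \<in> L2 S"
    and "\<And>e. e > 0 \<Longrightarrow> \<exists>N. \<forall>m\<ge>N. \<forall>n\<ge>N. L2_norm S (\<lambda>x. X m x - X n x) < e"
  obtains u where "u \<in> L2 S" "(\<lambda>n. L2_norm S (\<lambda>x. X n x - u x)) \<longlonglongrightarrow> 0"
  using pre_hilbert.complete_spaceD[OF pre_hilbert_L2 L2_complete[OF S_lmeasurable], of X] assms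
  by (auto simp: pre_hilbert.Cauchy_seq_def[OF pre_hilbert_L2] nrm_L2)

text \<open>Functions and gradients converge separately in \<open>L2\<close>; closedness of the weak
  gradient links the two limits.\<close>

lemma H1_complete: "pre_hilbert.complete_space (H1 S) H1_inner"
proof -
  interpret H: pre_hilbert "H1 S" H1_inner by (rule pre_hilbert_H1)
  show ?thesis unfolding H.complete_space_def
  proof (intro allI impI)
    fix X assume "H.Cauchy_seq X"
    then have X: "\<And>n. X n \<in> H1 S"
      and cau: "\<And>e. e > 0 \<Longrightarrow> \<exists>N. \<forall>m\<ge>N. \<forall>n\<ge>N. H1_norm S (\<lambda>x. X m x - X n x) < e"
      by (auto simp: H.Cauchy_seq_def nrm_H1 H1_diff)
    note D = H1_diff[OF X X]
    have grad_eq: "L2_norm S (\<lambda>x. wgrad S (X m) x - wgrad S (X n) x) = L2_norm S (wgrad S (\<lambda>x. X m x - X n x))" for m n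
      by (intro L2_norm_cong ae_eq_sym[OF wgrad_diff] X L2_diff wgrad_L2 D)
    obtain u where u: "u \<in> L2 S" "(\<lambda>n. L2_norm S (\<lambda>x. X n x - u x)) \<longlonglongrightarrow> 0"
    proof (rule L2_Cauchy_limit)
      show "\<exists>N. \<forall>m\<ge>N. \<forall>n\<ge>N. L2_norm S (\<lambda>x. X m x - X n x) < e" if "e > 0" for e
        using cau[OF that] L2_norm_le_H1_norm[OF D] le_less_trans by blast
    qed (use X H1_L2 in auto)
    obtain g where g: "g \<in> L2 S" "(\<lambda>n. L2_norm S (\<lambda>x. wgrad S (X n) x - g x)) \<longlonglongrightarrow> 0"
    proof (rule L2_Cauchy_limit)
      show "\<exists>N. \<forall>m\<ge>N. \<forall>n\<ge>N. L2_norm S (\<lambda>x. wgrad S (X m) x - wgrad S (X n) x) < e" if "e > 0" for e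
        unfolding grad_eq using cau[OF that] L2_norm_wgrad_le_H1_norm[OF D] le_less_trans by blast
    qed (use X wgrad_L2 in auto)
    have weak: "is_weak_grad S u g" by (rule is_weak_grad_limit[OF X u g])
    have uH: "u \<in> H1 S" by (rule H1_I[OF u(1) weak])
    have le: "H1_norm S (\<lambda>x. X n x - u x) \<le> L2_norm S (\<lambda>x. X n x - u x) + L2_norm S (\<lambda>x. wgrad S (X n) x - g x)" for n
    proof -
      have "ae_eq S (wgrad S (\<lambda>x. X n x - u x)) (\<lambda>x. wgrad S (X n) x - g x)"
        using wgrad_diff[OF X uH] ae_eq_diff[OF ae_eq_refl wgrad_eqI[OF u(1) weak]] ae_eq_trans by blast
      then have "L2_norm S (wgrad S (\<lambda>x. X n x - u x)) = L2_norm S (\<lambda>x. wgrad S (X n) x - g x)"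
        by (rule L2_norm_cong) (intro wgrad_L2 H1_diff L2_diff X uH g)+
      then show ?thesis using H1_norm_le[OF H1_diff[OF X uH], of n] by simp
    qed
    have "(\<lambda>n. L2_norm S (\<lambda>x. X n x - u x) + L2_norm S (\<lambda>x. wgrad S (X n) x - g x)) \<longlonglongrightarrow> 0"
      using tendsto_add[OF u(2) g(2)] by simp
    then have "(\<lambda>n. H1_norm S (\<lambda>x. X n x - u x)) \<longlonglongrightarrow> 0"
      by (rule Lim_null_comparison[rotated]) (use le in \<open>auto simp: H1_norm_def intro!: always_eventually\<close>)
    then show "\<exists>u\<in>H1 S. (\<lambda>n. nrm H1_inner (\<lambda>x. X n x - u x)) \<longlonglongrightarrow> 0"
      using uH by (intro bexI[of _ u]) (simp_all add: nrm_H1 H1_diff X)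
  qed
qed

subsection \<open>The space \<open>H1_0\<close>\<close>

sublocale H: pre_hilbert "H1 S" H1_inner by (rule pre_hilbert_H1)

sublocale G: pre_hilbert "H1 S" grad_inner by (rule pre_hilbert_grad)

lemma H1_0_adherence: "H1_0 S = H.adherence (test_fun S)"
proof -
  have "nrm H1_inner (\<lambda>x. v x - \<phi> x) = H1_norm S (\<lambda>x. v x - \<phi> x)"
    if "v \<in> H1 S" "\<phi> \<in> test_fun S" for v and \<phi> :: "'a \<Rightarrow> real"
    by (intro nrm_H1 H1_diff that(1) test_H1[OF that(2)])
  then show ?thesis unfolding H1_0_def H.adherence_def by auto
qed

lemma H1_0_H1: "v \<in> H1_0 S \<Longrightarrow> v \<in> H1 S"
  by (simp add: H1_0_def)

lemma test_H1_0: "\<phi> \<in> test_fun S \<Longrightarrow> \<phi> \<in> H1_0 S"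
  using H.B_zero[OF H.zero]
  by (auto simp: H1_0_adherence H.adherence_def nrm_def test_H1 intro!: bexI[of _ \<phi>])

lemma pre_hilbert_H1_0: "pre_hilbert (H1_0 S) H1_inner"
  unfolding H1_0_adherence
  by (rule H.closure_pre_hilbert) (auto intro: test_H1 test_fun_add test_fun_scale[where 'b=real, simplified])

lemma H1_0_complete: "pre_hilbert.complete_space (H1_0 S) H1_inner"
  unfolding H1_0_adherence
  by (rule H.closure_complete[OF H1_complete _ pre_hilbert_H1_0[unfolded H1_0_adherence]])
    (auto intro: test_H1)

lemma H1_0_seq:
  assumes v: "v \<in> H1_0 S"
  shows "\<exists>X. (\<forall>n. X n \<in> test_fun S) \<and> (\<lambda>n. L2_norm S (\<lambda>x. X n x - v x)) \<longlonglongrightarrow> 0 \<and>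
    (\<lambda>n. L2_norm S (\<lambda>x. wgrad S (X n) x - wgrad S v x)) \<longlonglongrightarrow> 0"
proof -
  note vH = H1_0_H1[OF v]
  obtain X where X: "\<And>n. X n \<in> test_fun S" "(\<lambda>n. nrm H1_inner (\<lambda>x. v x - X n x)) \<longlonglongrightarrow> 0"
    using H.adherence_seq[OF v[unfolded H1_0_adherence]] test_H1 by (auto simp: subset_iff)
  note XH = test_H1[OF X(1)]
  note D = H1_diff[OF XH vH]
  have lim: "(\<lambda>n. H1_norm S (\<lambda>x. X n x - v x)) \<longlonglongrightarrow> 0"
    using X(2) H.nrm_minus_commute[OF vH XH] by (simp add: nrm_H1 D)
  have g_eq: "L2_norm S (\<lambda>x. wgrad S (X n) x - wgrad S v x) = L2_norm S (wgrad S (\<lambda>x. X n x - v x))" for n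
    by (intro L2_norm_cong ae_eq_sym[OF wgrad_diff] XH vH L2_diff wgrad_L2 D)
  show ?thesis
  proof (intro exI[of _ X] conjI allI X(1))
    show "(\<lambda>n. L2_norm S (\<lambda>x. X n x - v x)) \<longlonglongrightarrow> 0"
      by (rule Lim_null_comparison[OF _ lim])
        (use L2_norm_le_H1_norm[OF D] L2_norm_nonneg[OF H1_L2[OF D]] in \<open>auto intro!: always_eventually\<close>)
    show "(\<lambda>n. L2_norm S (\<lambda>x. wgrad S (X n) x - wgrad S v x)) \<longlonglongrightarrow> 0"
      unfolding g_eq
      by (rule Lim_null_comparison[OF _ lim])
        (use L2_norm_wgrad_le_H1_norm[OF D] L2_norm_nonneg[OF wgrad_L2[OF D]] in \<open>auto intro!: always_eventually\<close>)
  qed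
qed

text \<open>For test functions this is the definition of the weak divergence, and both sides are
  continuous in \<open>v\<close> for the \<open>H1\<close> norm.\<close>

lemma green_H1_0:
  assumes v: "v \<in> H1_0 S" and \<tau>: "\<tau> \<in> Hdiv S"
  shows "L2_inner S v (wdiv S \<tau>) = - L2_inner S (wgrad S v) \<tau>"
proof -
  obtain X where X': "\<forall>n. X n \<in> test_fun S" "(\<lambda>n. L2_norm S (\<lambda>x. X n x - v x)) \<longlonglongrightarrow> 0"
    "(\<lambda>n. L2_norm S (\<lambda>x. wgrad S (X n) x - wgrad S v x)) \<longlonglongrightarrow> 0"
    using H1_0_seq[OF v] by (elim exE conjE) (rule that)
  note X = X'(1)[rule_format] X'(2,3)
  have lim1: "(\<lambda>n. L2_inner S (X n) (wdiv S \<tau>)) \<longlonglongrightarrow> L2_inner S v (wdiv S \<tau>)"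
    by (rule L2_inner_tendsto[OF test_L2[OF X(1)] H1_L2[OF H1_0_H1[OF v]] wdiv_L2[OF \<tau>] X(2)])
  have lim2: "(\<lambda>n. L2_inner S (wgrad S (X n)) \<tau>) \<longlonglongrightarrow> L2_inner S (wgrad S v) \<tau>"
    by (rule L2_inner_tendsto[OF wgrad_L2[OF test_H1[OF X(1)]] wgrad_L2[OF H1_0_H1[OF v]] Hdiv_L2[OF \<tau>] X(3)])
  have eq: "L2_inner S (X n) (wdiv S \<tau>) = - L2_inner S (wgrad S (X n)) \<tau>" for n
  proof -
    have "L2_inner S (wgrad S (X n)) \<tau> = L2_inner S (cgrad (X n)) \<tau>"
      by (intro L2_inner_cong test_wgrad[OF X(1)] ae_eq_refl wgrad_L2 test_H1[OF X(1)]
          test_L2[OF test_fun_cgrad[OF X(1)]] Hdiv_L2[OF \<tau>])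
    then show ?thesis using wdiv_test[OF \<tau> X(1)[of n]] by (simp add: L2_inner_commute)
  qed
  have "(\<lambda>n. L2_inner S (X n) (wdiv S \<tau>)) \<longlonglongrightarrow> - L2_inner S (wgrad S v) \<tau>"
    unfolding eq by (rule tendsto_minus[OF lim2])
  then show ?thesis by (rule LIMSEQ_unique[OF lim1])
qed

lemma friedrichs:
  obtains C where "C > 0" "\<And>v. v \<in> H1_0 S \<Longrightarrow> L2_norm S v \<le> C * L2_norm S (wgrad S v)"
proof -
  obtain R where R: "R > 0" "S \<subseteq> cball 0 R"
    using bounded_S by (auto simp: bounded_pos subset_iff)
  show thesis
  proof (rule that[of "2 * R"])
    fix v assume v: "v \<in> H1_0 S"
    obtain X where X': "\<forall>n. X n \<in> test_fun S" "(\<lambda>n. L2_norm S (\<lambda>x. X n x - v x)) \<longlonglongrightarrow> 0"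
      "(\<lambda>n. L2_norm S (\<lambda>x. wgrad S (X n) x - wgrad S v x)) \<longlonglongrightarrow> 0"
      using H1_0_seq[OF v] by (elim exE conjE) (rule that)
    note X = X'(1)[rule_format] X'(2,3)
    have "(\<lambda>n. L2_norm S (X n)) \<longlonglongrightarrow> L2_norm S v"
      by (rule pre_hilbert.nrm_tendsto[OF pre_hilbert_L2, unfolded nrm_L2, OF test_L2[OF X(1)] H1_L2[OF H1_0_H1[OF v]] X(2)])
    moreover have "(\<lambda>n. 2 * R * L2_norm S (wgrad S (X n))) \<longlonglongrightarrow> 2 * R * L2_norm S (wgrad S v)"
      by (intro tendsto_mult_left pre_hilbert.nrm_tendsto[OF pre_hilbert_L2, unfolded nrm_L2, OF wgrad_L2[OF test_H1[OF X(1)]] wgrad_L2[OF H1_0_H1[OF v]] X(3)])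
    moreover have "L2_norm S (X n) \<le> 2 * R * L2_norm S (wgrad S (X n))" for n
    proof -
      have "L2_norm S (wgrad S (X n)) = L2_norm S (cgrad (X n))"
        by (intro L2_norm_cong test_wgrad[OF X(1)] wgrad_L2 test_H1[OF X(1)] test_L2[OF test_fun_cgrad[OF X(1)]])
      then show ?thesis using friedrichs_test_fun[OF open_S R(2) X(1)] by simp
    qed
    ultimately show "L2_norm S v \<le> 2 * R * L2_norm S (wgrad S v)"
      by (intro LIMSEQ_le[of _ _ _ "2 * R * L2_norm S (wgrad S v)"]) auto
  qed (use R in simp)
qed

section \<open>Dirichlet problems and the Helmholtz decomposition\<close>

lemma pre_hilbert_grad_0: "pre_hilbert (H1_0 S) grad_inner"
proof -
  interpret Z: pre_hilbert "H1_0 S" H1_inner by (rule pre_hilbert_H1_0)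
  show ?thesis
    by (rule G.subspace_pre_hilbert) (auto intro: H1_0_H1 Z.zero Z.add Z.scale[simplified])
qed

text \<open>By Friedrichs' inequality the \<open>H1\<close> norm is at most \<open>C + 1\<close>
  times the gradient norm on \<open>H1_0 S\<close>, so completeness transfers from
  \<open>H1_inner\<close>.\<close>

lemma H1_0_grad_complete: "pre_hilbert.complete_space (H1_0 S) grad_inner"
proof -
  interpret Z: pre_hilbert "H1_0 S" H1_inner by (rule pre_hilbert_H1_0)
  interpret ZG: pre_hilbert "H1_0 S" grad_inner by (rule pre_hilbert_grad_0)
  obtain C where C: "C > 0" "\<And>v. v \<in> H1_0 S \<Longrightarrow> L2_norm S v \<le> C * L2_norm S (wgrad S v)"
    using friedrichs by metis
  have le1: "nrm H1_inner v \<le> (C + 1) * nrm grad_inner v" if "v \<in> H1_0 S" for v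
    using H1_norm_le[OF H1_0_H1[OF that]] C(2)[OF that]
    by (simp add: nrm_H1[OF H1_0_H1[OF that]] nrm_grad algebra_simps)
  have le2: "nrm grad_inner v \<le> nrm H1_inner v" if "v \<in> H1_0 S" for v
    using L2_norm_wgrad_le_H1_norm[OF H1_0_H1[OF that]] by (simp add: nrm_H1[OF H1_0_H1[OF that]] nrm_grad)
  show ?thesis unfolding ZG.complete_space_def
  proof (intro allI impI)
    fix X assume "ZG.Cauchy_seq X"
    then have X: "\<And>n. X n \<in> H1_0 S"
      and cau: "\<And>e. e > 0 \<Longrightarrow> \<exists>N. \<forall>m\<ge>N. \<forall>n\<ge>N. nrm grad_inner (\<lambda>x. X m x - X n x) < e"
      by (auto simp: ZG.Cauchy_seq_def)
    have "Z.Cauchy_seq X"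
      unfolding Z.Cauchy_seq_def
    proof (intro conjI allI impI X)
      fix e :: real assume "e > 0"
      then obtain N where N: "\<forall>m\<ge>N. \<forall>n\<ge>N. nrm grad_inner (\<lambda>x. X m x - X n x) < e / (C + 1)"
        using cau[of "e / (C + 1)"] C(1) by auto
      have "nrm H1_inner (\<lambda>x. X m x - X n x) < e" if "m \<ge> N" "n \<ge> N" for m n
      proof -
        have "nrm grad_inner (\<lambda>x. X m x - X n x) < e / (C + 1)" using N that by blast
        then have "(C + 1) * nrm grad_inner (\<lambda>x. X m x - X n x) < e"
          using C(1) by (simp add: field_simps)
        then show ?thesis using le1[OF Z.diff[OF X X], of m n] by simp
      qed
      then show "\<exists>N. \<forall>m\<ge>N. \<forall>n\<ge>N. nrm H1_inner (\<lambda>x. X m x - X n x) < e" by blast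
    qed
    then obtain u where u: "u \<in> H1_0 S" "(\<lambda>n. nrm H1_inner (\<lambda>x. X n x - u x)) \<longlonglongrightarrow> 0"
      using Z.complete_spaceD[OF H1_0_complete] by blast
    have "(\<lambda>n. nrm grad_inner (\<lambda>x. X n x - u x)) \<longlonglongrightarrow> 0"
      by (rule Lim_null_comparison[OF _ u(2)])
        (use le2[OF Z.diff[OF X u(1)]] ZG.nrm_nonneg[OF Z.diff[OF X u(1)]] in \<open>auto intro!: always_eventually\<close>)
    then show "\<exists>u\<in>H1_0 S. (\<lambda>n. nrm grad_inner (\<lambda>x. X n x - u x)) \<longlonglongrightarrow> 0" using u(1) by blast
  qed
qed

text \<open>The weak form of \<open>div grad w = div F - q\<close> with zero boundary values. The
  data are used in turn: \<open>F = 0\<close> prescribes a divergence, \<open>q = 0\<close> projects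
  onto gradients.\<close>

lemma dirichlet_problem:
  assumes F: "F \<in> L2 S" and q: "q \<in> L2 S"
  obtains w where "w \<in> H1_0 S"
    "\<And>\<phi>. \<phi> \<in> H1_0 S \<Longrightarrow> L2_inner S (wgrad S w) (wgrad S \<phi>) = L2_inner S F (wgrad S \<phi>) + L2_inner S q \<phi>"
proof -
  interpret Z: pre_hilbert "H1_0 S" grad_inner by (rule pre_hilbert_grad_0)
  obtain C where C: "C > 0" "\<And>v. v \<in> H1_0 S \<Longrightarrow> L2_norm S v \<le> C * L2_norm S (wgrad S v)"
    using friedrichs by metis
  let ?l = "\<lambda>\<phi>. L2_inner S F (wgrad S \<phi>) + L2_inner S q \<phi>"
  obtain w where "w \<in> H1_0 S" "\<And>\<phi>. \<phi> \<in> H1_0 S \<Longrightarrow> grad_inner w \<phi> = ?l \<phi>"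
  proof (rule Z.riesz[of ?l "L2_norm S F + L2_norm S q * C"])
    show "Z.complete_space" by (rule H1_0_grad_complete)
    fix u v c assume u: "u \<in> H1_0 S"
    note uL = H1_L2[OF H1_0_H1[OF u]] wgrad_L2[OF H1_0_H1[OF u]]
    have "L2_inner S F (wgrad S (\<lambda>x. c *\<^sub>R u x)) = L2_inner S F (\<lambda>x. c *\<^sub>R wgrad S u x)"
      by (intro L2_inner_cong wgrad_scale ae_eq_refl H1_0_H1[OF u] wgrad_L2 H1_scale L2_scale uL F)
    then show "?l (\<lambda>x. c *\<^sub>R u x) = c * ?l u"
      unfolding L2_inner_scale2 by (simp only: L2_inner_scale2 distrib_left)
    have "\<bar>?l u\<bar> \<le> L2_norm S F * L2_norm S (wgrad S u) + L2_norm S q * L2_norm S u"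
      using L2_cs[OF F uL(2)] L2_cs[OF q uL(1)] by linarith
    also have "\<dots> \<le> L2_norm S F * L2_norm S (wgrad S u) + L2_norm S q * (C * L2_norm S (wgrad S u))"
      by (intro add_left_mono mult_left_mono C u L2_norm_nonneg q)
    finally show "\<bar>?l u\<bar> \<le> (L2_norm S F + L2_norm S q * C) * nrm grad_inner u"
      by (simp add: nrm_grad algebra_simps)
    assume v: "v \<in> H1_0 S"
    note vL = H1_L2[OF H1_0_H1[OF v]] wgrad_L2[OF H1_0_H1[OF v]]
    have "L2_inner S F (wgrad S (\<lambda>x. u x + v x)) = L2_inner S F (\<lambda>x. wgrad S u x + wgrad S v x)"
      by (intro L2_inner_cong wgrad_add ae_eq_refl H1_0_H1 u v wgrad_L2 H1_add L2_add uL vL F)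
    then show "?l (\<lambda>x. u x + v x) = ?l u + ?l v"
      using uL vL F q by (simp add: L2_inner_add2)
  qed (rule that)
  then show thesis by (intro that) (auto simp: grad_inner_def)
qed

lemma weak_div_from_H1_0:
  assumes \<sigma>: "\<sigma> \<in> L2 S" and q: "q \<in> L2 S"
    and eq: "\<And>\<phi>. \<phi> \<in> H1_0 S \<Longrightarrow> L2_inner S \<sigma> (wgrad S \<phi>) = - L2_inner S q \<phi>"
  shows "is_weak_div S \<sigma> q"
  unfolding is_weak_div_def
proof (intro conjI q ballI)
  fix \<phi> :: "'a \<Rightarrow> real" assume \<phi>: "\<phi> \<in> test_fun S"
  have "L2_inner S \<sigma> (wgrad S \<phi>) = L2_inner S \<sigma> (cgrad \<phi>)"
    by (intro L2_inner_cong test_wgrad[OF \<phi>] ae_eq_refl wgrad_L2 test_H1[OF \<phi>] test_L2[OF test_fun_cgrad[OF \<phi>]] \<sigma>)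
  then show "L2_inner S q \<phi> = - L2_inner S \<sigma> (cgrad \<phi>)" using eq[OF test_H1_0[OF \<phi>]] by simp
qed

text \<open>A Poisson problem with datum \<open>- q\<close>. It makes \<open>div \<tau>\<close>
  freely prescribable when the Euler-Lagrange equation is tested.\<close>

lemma div_surjective:
  assumes q: "q \<in> L2 S"
  obtains w where "w \<in> H1_0 S" "is_weak_div S (wgrad S w) q"
proof -
  obtain w where w: "w \<in> H1_0 S"
    "\<And>\<phi>. \<phi> \<in> H1_0 S \<Longrightarrow> L2_inner S (wgrad S w) (wgrad S \<phi>) = L2_inner S (\<lambda>x. 0) (wgrad S \<phi>) + L2_inner S (\<lambda>x. (-1) *\<^sub>R q x) \<phi>"
    using dirichlet_problem[OF L2_zero L2_scale[OF q]] by metis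
  have "is_weak_div S (wgrad S w) q"
  proof (rule weak_div_from_H1_0[OF wgrad_L2[OF H1_0_H1[OF w(1)]] q])
    show "L2_inner S (wgrad S w) (wgrad S \<phi>) = - L2_inner S q \<phi>" if "\<phi> \<in> H1_0 S" for \<phi>
      using w(2)[OF that] unfolding L2_inner_scale by simp
  qed
  then show thesis using that w(1) by blast
qed

text \<open>\<open>grad w\<close> is the \<open>L2\<close> projection of \<open>F\<close> onto the
  gradients of \<open>H1_0\<close> functions; orthogonality of the remainder to these gradients says
  that it is solenoidal.\<close>

lemma helmholtz_decomposition:
  assumes F: "F \<in> L2 S"
  obtains w where "w \<in> H1_0 S" "is_weak_div S (\<lambda>x. F x - wgrad S w x) (\<lambda>x. 0)"
proof -
  obtain w where w: "w \<in> H1_0 S"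
    "\<And>\<phi>. \<phi> \<in> H1_0 S \<Longrightarrow> L2_inner S (wgrad S w) (wgrad S \<phi>) = L2_inner S F (wgrad S \<phi>) + L2_inner S (\<lambda>x. 0) \<phi>"
    using dirichlet_problem[OF F L2_zero] by metis
  note gL = wgrad_L2[OF H1_0_H1[OF w(1)]]
  have "is_weak_div S (\<lambda>x. F x - wgrad S w x) (\<lambda>x. 0)"
    by (rule weak_div_from_H1_0[OF L2_diff[OF F gL] L2_zero])
      (simp add: L2_inner_diff F gL wgrad_L2 H1_0_H1 w(2))
  then show thesis using that w(1) by blast
qed

text \<open>The \<open>H1\<close>-orthogonal projection onto \<open>H1_0\<close> leaves a remainder \<open>r\<close> with \<open>div grad r = r\<close>;
  testing the hypothesis with \<open>grad r\<close> shows \<open>r = 0\<close>.\<close>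

lemma trace_kernel:
  assumes z: "z \<in> H1 S"
    and tr: "\<And>\<tau>. \<tau> \<in> Hdiv S \<Longrightarrow> L2_inner S z (wdiv S \<tau>) + L2_inner S (wgrad S z) \<tau> = 0"
  shows "z \<in> H1_0 S"
proof -
  interpret Z: pre_hilbert "H1_0 S" H1_inner by (rule pre_hilbert_H1_0)
  obtain w where w: "w \<in> H1_0 S" "\<And>\<phi>. \<phi> \<in> H1_0 S \<Longrightarrow> H1_inner w \<phi> = H1_inner z \<phi>"
  proof (rule Z.riesz[of "H1_inner z" "nrm H1_inner z"])
    show "Z.complete_space" by (rule H1_0_complete)
    show "H1_inner z (\<lambda>x. u x + v x) = H1_inner z u + H1_inner z v" if "u \<in> H1_0 S" "v \<in> H1_0 S" for u v
      by (intro H.B_add2 H1_0_H1 that z)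
    show "H1_inner z (\<lambda>x. c *\<^sub>R u x) = c * H1_inner z u" if "u \<in> H1_0 S" for u c
      by (intro H.B_scale2 H1_0_H1 that z)
    show "\<bar>H1_inner z u\<bar> \<le> nrm H1_inner z * nrm H1_inner u" if "u \<in> H1_0 S" for u
      by (intro H.cs H1_0_H1 that z)
  qed (rule that)
  note wH = H1_0_H1[OF w(1)]
  define r where "r = (\<lambda>x. z x - w x)"
  have r: "r \<in> H1 S" unfolding r_def by (intro H1_diff z wH)
  note rL = H1_L2[OF r] wgrad_L2[OF r]
  have weak: "is_weak_div S (wgrad S r) r"
  proof (rule weak_div_from_H1_0[OF rL(2,1)])
    fix \<phi> assume \<phi>: "\<phi> \<in> H1_0 S"
    have "H1_inner r \<phi> = 0"
      unfolding r_def using w(2)[OF \<phi>] H.B_diff[OF z wH H1_0_H1[OF \<phi>]] by simp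
    then show "L2_inner S (wgrad S r) (wgrad S \<phi>) = - L2_inner S r \<phi>" by (simp add: H1_inner_def)
  qed
  have rdiv: "wgrad S r \<in> Hdiv S" by (rule Hdiv_I[OF rL(2) weak])
  have div_eq: "L2_inner S v (wdiv S (wgrad S r)) = L2_inner S v r" if "v \<in> H1 S" for v
    by (intro L2_inner_cong ae_eq_refl wdiv_eqI[OF rL(2) weak] H1_L2[OF that] wdiv_L2[OF rdiv] rL)
  \<comment> \<open>As \<open>div grad r = r\<close>, the hypothesis for
    \<open>\<tau> = grad r\<close> is precisely the \<open>H1\<close> orthogonality of
    \<open>z\<close> and \<open>r\<close>. For \<open>w\<close> the same follows from Green's
    formula, so \<open>r\<close> is orthogonal to \<open>z - w = r\<close>.\<close>
  have "H1_inner z r = 0"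
    using tr[OF rdiv] div_eq[OF z] by (simp add: H1_inner_def)
  moreover have "H1_inner w r = 0"
    using green_H1_0[OF w(1) rdiv] div_eq[OF wH] by (simp add: H1_inner_def)
  ultimately have "H1_inner r r = 0"
    using H.B_diff[OF z wH r] by (simp add: r_def)
  then have nr: "nrm H1_inner (\<lambda>x. z x - w x) = 0" by (simp add: nrm_def r_def)
  \<comment> \<open>\<open>z\<close> and \<open>w\<close> are only at seminorm distance zero, so
    membership in \<open>H1_0\<close> is carried over through the approximating test
    functions.\<close>
  have "\<exists>\<phi>\<in>test_fun S. nrm H1_inner (\<lambda>x. z x - \<phi> x) < e" if e: "e > 0" for e
  proof -
    obtain \<phi> where \<phi>: "\<phi> \<in> test_fun S" "nrm H1_inner (\<lambda>x. w x - \<phi> x) < e"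
      using H.adherenceD[OF w(1)[unfolded H1_0_adherence] e] by blast
    then show ?thesis using H.nrm_triangle[OF z wH test_H1[OF \<phi>(1)]] nr by (intro bexI[of _ \<phi>]) auto
  qed
  then show ?thesis using z by (auto simp: H1_0_adherence H.adherence_def)
qed

end

section \<open>Control of the divergence\<close>

lemma L2_inner_lborel:
  fixes f g :: "'a::euclidean_space \<Rightarrow> real"
  assumes "open A" "f \<in> borel_measurable borel" "g \<in> borel_measurable borel"
  shows "L2_inner A f g = (LINT x|lborel. indicator A x * (f x * g x))"
proof -
  note [measurable] = assms(2,3)
  have [measurable]: "A \<in> sets borel" using assms(1) by auto
  have "L2_inner A f g = (LINT x|lebesgue. indicator A x * (f x * g x))"
    using assms(1) by (subst L2_inner_indicator) auto
  also have "\<dots> = (LINT x|lborel. indicator A x * (f x * g x))"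
    by (intro integral_completion) measurable
  finally show ?thesis .
qed

lemma integrable_lborel_imp_lebesgue_on:
  fixes f :: "'a::euclidean_space \<Rightarrow> real"
  assumes "open A" "integrable lborel f"
  shows "integrable (lebesgue_on A) f"
proof -
  have "integrable lebesgue f"
    using assms(2) by (subst integrable_completion) auto
  then show ?thesis
    using assms(1) integrable_mult_indicator[of A lebesgue f]
    by (subst integrable_restrict_space) auto
qed

lemma L2_borel_I:
  fixes f :: "'a::euclidean_space \<Rightarrow> real"
  assumes "open A" "f \<in> borel_measurable borel" "integrable lborel (\<lambda>x. (f x)\<^sup>2)"
  shows "f \<in> L2 A"
proof -
  have "f \<in> borel_measurable (lebesgue_on A)"
    using assms(2) by (intro measurable_restrict_space1 measurable_completion) simp
  then show ?thesis
    using integrable_lborel_imp_lebesgue_on[OF assms(1,3)] by (simp add: L2_def)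
qed

lemma nn_integral_lborel_translate:
  fixes f :: "'a::euclidean_space \<Rightarrow> ennreal"
  assumes [measurable]: "f \<in> borel_measurable borel"
  shows "(\<integral>\<^sup>+x. f (a + x) \<partial>lborel) = (\<integral>\<^sup>+x. f x \<partial>lborel)"
proof -
  have "(\<integral>\<^sup>+x. f x \<partial>lborel) = (\<integral>\<^sup>+x. f x \<partial>distr lborel borel ((+) a))"
    by (simp add: lborel_distr_plus)
  also have "\<dots> = (\<integral>\<^sup>+x. f (a + x) \<partial>lborel)" by (rule nn_integral_distr) measurable
  finally show ?thesis by simp
qed

lemma sum_squares_le: "(a + b)\<^sup>2 \<le> 2 * a\<^sup>2 + 2 * (b :: real)\<^sup>2"
  using zero_le_power2[of "a - b"] by (simp add: power2_sum power2_diff)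

text \<open>\<open>G\<close> extends the graph function constantly along \<open>e\<close>, hence is
  continuous on the whole space and unchanged by shifts in that direction. The graph is a Lipschitz
  image of a hyperplane and therefore null.\<close>

lemma lipschitz_chart:
  fixes S :: "'a::euclidean_space set"
  assumes "lipschitz_boundary S" "p \<in> frontier S"
  shows "\<exists>U e G. open U \<and> p \<in> U \<and> norm e = 1 \<and> continuous_on UNIV G \<and>
    S \<inter> U = {x \<in> U. x \<bullet> e < G x} \<and> (\<forall>x t. G (x + t *\<^sub>R e) = G x) \<and>
    negligible {x. x \<bullet> e = G x}"
proof -
  from assms obtain U e g K where U: "open U" "p \<in> U" and e: "norm e = 1"
    and g: "K-lipschitz_on {y. y \<bullet> e = 0} (g :: 'a \<Rightarrow> real)"
    and SU: "S \<inter> U = {x \<in> U. x \<bullet> e < g (x - (x \<bullet> e) *\<^sub>R e)}"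
    unfolding lipschitz_boundary_def by (elim ballE exE conjE) (rule that, auto)
  have ee: "e \<bullet> e = 1" using e by (simp add: norm_eq_1)
  define G where "G x = g (x - (x \<bullet> e) *\<^sub>R e)" for x
  have "continuous_on UNIV G"
    unfolding G_def[abs_def]
    by (rule continuous_on_compose2[OF lipschitz_on_continuous_on[OF g]])
      (auto intro!: continuous_intros simp: inner_diff_left ee)
  moreover have "G (x + t *\<^sub>R e) = G x" for x t
    by (simp add: G_def inner_add_left ee algebra_simps)
  moreover have "negligible {x. x \<bullet> e = G x}"
  proof (rule negligible_subset)
    show "negligible ((\<lambda>y. y + g y *\<^sub>R e) ` {y. y \<bullet> e = 0})"
    proof (rule negligible_locally_Lipschitz_image)
      show "negligible {y. y \<bullet> e = 0}"
        using negligible_hyperplane[of e 0] ee by (cases "e = 0") (auto simp: inner_commute)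
      fix x assume x: "x \<in> {y. y \<bullet> e = 0}"
      have "norm ((y + g y *\<^sub>R e) - (x + g x *\<^sub>R e)) \<le> (1 + K) * norm (y - x)" if "y \<in> {y. y \<bullet> e = 0}" for y
      proof -
        have eq: "(y + g y *\<^sub>R e) - (x + g x *\<^sub>R e) = (y - x) + (g y - g x) *\<^sub>R e"
          by (simp add: algebra_simps)
        have "norm ((y + g y *\<^sub>R e) - (x + g x *\<^sub>R e)) \<le> norm (y - x) + \<bar>g y - g x\<bar>"
          unfolding eq using norm_triangle_ineq[of "y - x" "(g y - g x) *\<^sub>R e"] e by simp
        also have "\<bar>g y - g x\<bar> \<le> K * norm (y - x)"
          using lipschitz_onD[OF g that x] by (simp add: dist_norm)
        finally show ?thesis by (simp add: algebra_simps)
      qed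
      then show "\<exists>T B. open T \<and> x \<in> T \<and> (\<forall>y\<in>{y. y \<bullet> e = 0} \<inter> T.
          norm ((y + g y *\<^sub>R e) - (x + g x *\<^sub>R e)) \<le> B * norm (y - x))"
        by (intro exI[of _ UNIV] exI[of _ "1 + K"]) auto
    qed simp
    show "{x. x \<bullet> e = G x} \<subseteq> (\<lambda>y. y + g y *\<^sub>R e) ` {y. y \<bullet> e = 0}"
    proof
      fix x assume "x \<in> {x. x \<bullet> e = G x}"
      then have "x = (x - (x \<bullet> e) *\<^sub>R e) + g (x - (x \<bullet> e) *\<^sub>R e) *\<^sub>R e" by (simp add: G_def)
      then show "x \<in> (\<lambda>y. y + g y *\<^sub>R e) ` {y. y \<bullet> e = 0}"
        by (rule image_eqI) (simp add: inner_diff_left ee)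
    qed
  qed
  ultimately show ?thesis
    using U e SU by (intro exI[of _ U] exI[of _ e] exI[of _ G]) (simp add: G_def)
qed

section \<open>Translations of \<open>H1\<close> functions and a local Poincare inequality\<close>

context bounded_open
begin

text \<open>A version that may be evaluated at shifted points \<open>x + h\<close>: Borel on the
  whole space and zero outside \<open>S\<close>.\<close>

definition representative :: "('a \<Rightarrow> real) \<Rightarrow> ('a \<Rightarrow> real) \<Rightarrow> bool" where
  "representative p P \<longleftrightarrow> P \<in> borel_measurable borel \<and> (\<forall>x. x \<notin> S \<longrightarrow> P x = 0) \<and> ae_eq S p P \<and> P \<in> L2 S \<and>
     integrable lborel P \<and> integrable lborel (\<lambda>x. (P x)\<^sup>2)"

lemma representative_exists: "p \<in> L2 S \<Longrightarrow> \<exists>P. representative p P"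
  using L2_borel_representative[OF open_S bounded_S] unfolding representative_def by metis

lemma representative_inner:
  assumes P: "representative p P" and p: "p \<in> L2 S"
    and \<psi>: "\<psi> \<in> test_fun S"
  shows "(LINT x|lborel. P x * \<psi> x) = L2_inner S p \<psi>"
proof -
  have "(LINT x|lborel. P x * \<psi> x) = L2_inner S P \<psi>"
    unfolding L2_inner_def inner_real_def
    using test_fun_borel[OF \<psi>] P
    by (intro integral_lebesgue_on_eq_lborel[symmetric] S_sets) (auto simp: representative_def)
  also have "\<dots> = L2_inner S p \<psi>"
    using P p by (intro L2_inner_cong test_L2[OF \<psi>]) (auto simp: representative_def intro: ae_eq_sym)
  finally show ?thesis .
qed

text \<open>By duality it suffices to test with \<open>\<phi> \<in> test_fun A\<close>; the derivative of
  \<open>t \<mapsto> \<integral> p(x) \<phi>(x - t h) dx\<close> is \<open>\<integral> (\<nabla>p(x) \<bullet> h) \<phi>(x - t h) dx\<close>.\<close>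

lemma translation_estimate:
  assumes p: "p \<in> H1 S" and P: "representative p P"
    and A: "open A" "\<And>x t. x \<in> A \<Longrightarrow> 0 \<le> t \<Longrightarrow> t \<le> 1 \<Longrightarrow> x + t *\<^sub>R h \<in> S"
  shows "(\<lambda>x. P (x + h) - P x) \<in> L2 A"
    "L2_norm A (\<lambda>x. P (x + h) - P x) \<le> norm h * L2_norm S (wgrad S p)"
proof -
  have AS: "A \<subseteq> S" using A(2)[of _ 0] by auto
  have bA: "bounded A" using AS bounded_S bounded_subset by blast
  interpret A: bounded_open A using A(1) bA by unfold_locales
  have [measurable]: "P \<in> borel_measurable borel" using P by (simp add: representative_def)
  have P_int: "integrable lborel P" "integrable lborel (\<lambda>x. (P x)\<^sup>2)"
    using P by (auto simp: representative_def)
  show w: "(\<lambda>x. P (x + h) - P x) \<in> L2 A"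
    using L2_diff[OF L2_borel_I[OF A(1) _ lborel_integrable_translate[OF P_int(2), of h]] L2_borel_I[OF A(1) _ P_int(2)]]
    by simp
  let ?M = "norm h * L2_norm S (wgrad S p)"
  note gL = wgrad_L2[OF p]
  show "L2_norm A (\<lambda>x. P (x + h) - P x) \<le> ?M"
  proof (rule L2_norm_le_dual[OF A(1) bA w])
    show "?M \<ge> 0" using L2_norm_nonneg[OF gL] by simp
    fix \<phi> :: "'a \<Rightarrow> real" assume \<phi>: "\<phi> \<in> test_fun A"
    have [measurable]: "\<phi> \<in> borel_measurable borel" by (rule test_fun_borel[OF \<phi>])
    let ?G = "\<lambda>t. LINT x|lborel. P x * \<phi> (x - t *\<^sub>R h)"
    let ?dG = "\<lambda>t. - (LINT x|lborel. P x * frechet_derivative \<phi> (at (x - t *\<^sub>R h)) h)"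
    have bound: "\<bar>?dG t\<bar> \<le> ?M * L2_norm A \<phi>" if t: "0 \<le> t" "t \<le> 1" for t
    proof -
      \<comment> \<open>The shifted test function is supported in \<open>S\<close> because the
        segments that start in \<open>A\<close> stay in \<open>S\<close>; so it may be paired with
        \<open>p\<close>.\<close>
      define \<eta> where "\<eta> x = \<phi> (x - t *\<^sub>R h)" for x
      have \<eta>: "\<eta> \<in> test_fun S"
        unfolding \<eta>_def[abs_def] using A(2) t by (intro test_fun_translate[OF \<phi>]) auto
      have \<eta>h: "(\<lambda>x. \<eta> x *\<^sub>R h) \<in> test_fun S"
        by (rule test_fun_linear[OF bounded_linear_scaleR_left \<eta>])
      have der: "(\<eta> has_derivative frechet_derivative \<phi> (at (x - t *\<^sub>R h))) (at x)" for x
        unfolding \<eta>_def[abs_def]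
        by (rule has_derivative_compose[OF _ test_fun_has_derivative[OF \<phi>], where f'="\<lambda>x. x"])
          (auto intro!: derivative_eq_intros)
      have "\<eta> differentiable (at x)" for x using der by (auto simp: differentiable_def)
      moreover have "frechet_derivative \<eta> (at x) = frechet_derivative \<phi> (at (x - t *\<^sub>R h))" for x
        by (rule frechet_derivative_at[OF der, symmetric])
      ultimately have div: "cdiv (\<lambda>x. \<eta> x *\<^sub>R h) x = frechet_derivative \<phi> (at (x - t *\<^sub>R h)) h" for x
        by (simp add: cdiv_scaleR_const)
      \<comment> \<open>The derivative of \<eta> along \<open>h\<close> is the divergence of the
        field \<open>\<eta> h\<close>, so the weak gradient of \<open>p\<close> takes over.\<close>
      have "?dG t = - L2_inner S p (cdiv (\<lambda>x. \<eta> x *\<^sub>R h))"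
        using representative_inner[OF P H1_L2[OF p] test_fun_cdiv[OF \<eta>h]] by (simp add: div)
      also have "\<dots> = L2_inner S (wgrad S p) (\<lambda>x. \<eta> x *\<^sub>R h)"
        using wgrad_test[OF p \<eta>h] by simp
      finally have "\<bar>?dG t\<bar> \<le> L2_norm S (wgrad S p) * L2_norm S (\<lambda>x. \<eta> x *\<^sub>R h)"
        using L2_cs[OF gL test_L2[OF \<eta>h]] by simp
      also have "L2_norm S (\<lambda>x. \<eta> x *\<^sub>R h) = norm h * L2_norm S \<eta>"
      proof -
        have "(\<lambda>x. norm (\<eta> x *\<^sub>R h)) = (\<lambda>x. norm h *\<^sub>R norm (\<eta> x))" by (simp add: mult.commute)
        then have "L2_norm S (\<lambda>x. \<eta> x *\<^sub>R h) = L2_norm S (\<lambda>x. norm h *\<^sub>R norm (\<eta> x))"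
          using L2_norm_fun(2)[of S "\<lambda>x. \<eta> x *\<^sub>R h"] by simp
        also have "\<dots> = norm h * L2_norm S \<eta>"
          by (simp only: L2_norm_scale L2_norm_fun(2) abs_norm_cancel)
        finally show ?thesis .
      qed
      also have "L2_norm S \<eta> = L2_norm A \<phi>"
      proof -
        have "L2_inner S \<eta> \<eta> = (LINT x|lborel. \<eta> x * \<eta> x)"
          unfolding L2_inner_def inner_real_def
          using test_fun_borel[OF \<eta>] test_fun_zero_outside[OF \<eta>]
          by (intro integral_lebesgue_on_eq_lborel S_sets) auto
        also have "\<dots> = (LINT x|lborel. \<phi> x * \<phi> x)"
          using lborel_integral_translate[of "\<lambda>x. \<phi> x * \<phi> x" "- t *\<^sub>R h"] by (simp add: \<eta>_def)
        also have "\<dots> = L2_inner A \<phi> \<phi>"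
          unfolding L2_inner_def inner_real_def
          using test_fun_zero_outside[OF \<phi>]
          by (intro integral_lebesgue_on_eq_lborel[symmetric] A.S_sets) auto
        finally show ?thesis by (simp add: L2_norm_def)
      qed
      finally show ?thesis by (simp add: mult_ac)
    qed
    have "norm (?G 1 - ?G 0) \<le> ?M * L2_norm A \<phi> * norm (1 - 0 :: real)"
    proof (rule field_differentiable_bound[of "{0..1}" ?G ?dG])
      show "(?G has_field_derivative ?dG t) (at t within {0..1})" for t
        using translate_integral_derivative[OF \<phi> P_int(1)] by (rule has_field_derivative_at_within)
    qed (use bound in auto)
    also have "?G 1 - ?G 0 = L2_inner A (\<lambda>x. P (x + h) - P x) \<phi>"
    proof -
      have int: "integrable lborel (\<lambda>x. P (x + k) * \<phi> x)" for k
      proof -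
        obtain M where M: "\<And>x. norm (\<phi> x) \<le> M" using test_fun_bounded[OF \<phi>] by metis
        show ?thesis
        proof (rule Bochner_Integration.integrable_bound[where f="\<lambda>x. M * P (x + k)"])
          show "AE x in lborel. norm (P (x + k) * \<phi> x) \<le> norm (M * P (x + k))"
          proof (rule AE_I2)
            fix x
            have "\<bar>\<phi> x\<bar> \<le> \<bar>M\<bar>" using M[of x] by simp
            then show "norm (P (x + k) * \<phi> x) \<le> norm (M * P (x + k))"
              by (simp add: abs_mult mult.commute[of "\<bar>P (x + k)\<bar>"] mult_right_mono)
          qed
        qed (use lborel_integrable_translate[OF P_int(1)] in auto)
      qed
      \<comment> \<open>Translation invariance moves the shift by \<open>h\<close> from \<phi> to
        \<open>P\<close>.\<close>
      have "?G 1 = (LINT x|lborel. P (x + h) * \<phi> x)"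
        using lborel_integral_translate[of "\<lambda>x. P x * \<phi> (x - h)" h] by simp
      then have "?G 1 - ?G 0 = (LINT x|lborel. P (x + h) * \<phi> x) - (LINT x|lborel. P (x + 0) * \<phi> x)"
        by simp
      also have "\<dots> = (LINT x|lborel. P (x + h) * \<phi> x - P (x + 0) * \<phi> x)"
        by (rule Bochner_Integration.integral_diff[OF int int, symmetric])
      also have "\<dots> = L2_inner A (\<lambda>x. P (x + h) - P x) \<phi>"
        unfolding L2_inner_def inner_real_def
        using test_fun_zero_outside[OF \<phi>]
        by (subst integral_lebesgue_on_eq_lborel[OF A.S_sets]) (auto simp: algebra_simps)
      finally show ?thesis .
    qed
    finally show "\<bar>L2_inner A (\<lambda>x. P (x + h) - P x) \<phi>\<bar> \<le> ?M * L2_norm A \<phi>" by simp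
  qed
qed

text \<open>Substituting \<open>y = x + h\<close> and exchanging the integrals leaves, for each
  \<open>h\<close> in the ball of radius \<rho>, the squared norm of a difference
  \<open>P (x + h) - P x\<close>, which \<open>translation_estimate\<close> bounds.\<close>

lemma local_poincare:
  assumes p: "p \<in> H1 S" and P: "representative p P" and A: "open A"
    and diam: "\<And>x y. x \<in> A \<Longrightarrow> y \<in> A \<Longrightarrow> norm (y - x) \<le> \<rho>"
    and inS: "\<And>x h. x \<in> A \<Longrightarrow> norm h \<le> \<rho> \<Longrightarrow> x + h \<in> S"
  shows "(\<integral>\<^sup>+x. \<integral>\<^sup>+y. ennreal (indicator A x * indicator A y * (P y - P x)\<^sup>2) \<partial>lborel \<partial>lborel)
    \<le> ennreal (measure lborel (cball 0 \<rho> :: 'a set) * (\<rho> * L2_norm S (wgrad S p))\<^sup>2)"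
proof -
  have [measurable]: "P \<in> borel_measurable borel" using P by (simp add: representative_def)
  have [measurable]: "A \<in> sets borel" using A by auto
  let ?f = "\<lambda>x y. ennreal (indicator A x * indicator A y * (P y - P x)\<^sup>2)"
  let ?g = "\<lambda>h x. ennreal (indicator A x * (P (x + h) - P x)\<^sup>2)"
  let ?c = "ennreal ((\<rho> * L2_norm S (wgrad S p))\<^sup>2)"
  have g_le: "(\<integral>\<^sup>+x. ?g h x \<partial>lborel) \<le> ?c" if h: "norm h \<le> \<rho>" for h
  proof -
    have seg: "x + t *\<^sub>R h \<in> S" if "x \<in> A" "0 \<le> t" "t \<le> 1" for x t
    proof (rule inS[OF that(1)])
      have "norm (t *\<^sub>R h) \<le> 1 * norm h" unfolding norm_scaleR using that by (intro mult_right_mono) auto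
      then show "norm (t *\<^sub>R h) \<le> \<rho>" using h by simp
    qed
    have T: "(\<lambda>x. P (x + h) - P x) \<in> L2 A"
      "L2_norm A (\<lambda>x. P (x + h) - P x) \<le> norm h * L2_norm S (wgrad S p)"
      by (rule translation_estimate[OF p P A], rule seg, assumption+)+
    have "(L2_norm A (\<lambda>x. P (x + h) - P x))\<^sup>2 \<le> (\<rho> * L2_norm S (wgrad S p))\<^sup>2"
      using T(2) h L2_norm_nonneg[OF wgrad_L2[OF p]]
      by (intro power_mono L2_norm_nonneg T(1)) (auto intro: order_trans mult_right_mono)
    moreover have "(L2_norm A (\<lambda>x. P (x + h) - P x))\<^sup>2 =
        (LINT x|lborel. indicator A x * ((P (x + h) - P x) * (P (x + h) - P x)))"
      unfolding L2_norm_sq[OF T(1)] by (rule L2_inner_lborel[OF A]) measurable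
    moreover have "integrable lborel (\<lambda>x. indicator A x * (P (x + h) - P x)\<^sup>2)"
    proof -
      have "integrable lebesgue (\<lambda>x. indicator A x *\<^sub>R (norm (P (x + h) - P x))\<^sup>2)"
        using L2_integrable_sq[OF T(1)] A by (subst (asm) integrable_restrict_space) auto
      then show ?thesis by (subst (asm) integrable_completion) auto
    qed
    ultimately show ?thesis
      by (subst nn_integral_eq_integral) (auto simp: power2_eq_square intro!: ennreal_leI)
  qed
  have "(\<integral>\<^sup>+x. \<integral>\<^sup>+y. ?f x y \<partial>lborel \<partial>lborel) = (\<integral>\<^sup>+x. \<integral>\<^sup>+h. ?f x (x + h) \<partial>lborel \<partial>lborel)"
    by (intro nn_integral_cong nn_integral_lborel_translate[symmetric]) measurable
  \<comment> \<open>Only increments within the diameter bound occur; the condition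
    \<open>x + h \<in> A\<close> is then dropped.\<close>
  also have "\<dots> \<le> (\<integral>\<^sup>+x. \<integral>\<^sup>+h. indicator (cball 0 \<rho>) h * ?g h x \<partial>lborel \<partial>lborel)"
    using diam by (intro nn_integral_mono) (force simp: indicator_def split: if_splits)
  also have "\<dots> = (\<integral>\<^sup>+h. \<integral>\<^sup>+x. indicator (cball 0 \<rho>) h * ?g h x \<partial>lborel \<partial>lborel)"
  proof (rule lborel_pair.Fubini'[of "\<lambda>h x. indicator (cball 0 \<rho>) h * ?g h x"])
    have [measurable]: "cball (0 :: 'a) \<rho> \<in> sets borel" by simp
    have "(\<lambda>(h, x). indicator (cball 0 \<rho>) h * ?g h x) \<in> borel_measurable (borel \<Otimes>\<^sub>M borel)"
      by measurable
    also have "borel_measurable (borel \<Otimes>\<^sub>M borel) = borel_measurable (lborel \<Otimes>\<^sub>M (lborel :: 'a measure))"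
      by (intro measurable_cong_sets sets_pair_measure_cong) simp_all
    finally show "(\<lambda>(h, x). indicator (cball 0 \<rho>) h * ?g h x) \<in> borel_measurable (lborel \<Otimes>\<^sub>M lborel)" .
  qed
  also have "\<dots> = (\<integral>\<^sup>+h. indicator (cball 0 \<rho>) h * (\<integral>\<^sup>+x. ?g h x \<partial>lborel) \<partial>lborel)"
    by (intro nn_integral_cong nn_integral_cmult) measurable
  also have "\<dots> \<le> (\<integral>\<^sup>+h. ?c * indicator (cball 0 \<rho> :: 'a set) h \<partial>lborel)"
  proof (intro nn_integral_mono)
    fix h :: 'a
    show "indicator (cball 0 \<rho>) h * (\<integral>\<^sup>+x. ?g h x \<partial>lborel) \<le> ?c * indicator (cball 0 \<rho> :: 'a set) h"
      using g_le[of h] by (cases "h \<in> cball 0 \<rho>") simp_all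
  qed
  also have "\<dots> = ?c * emeasure lborel (cball 0 \<rho> :: 'a set)"
    by (rule nn_integral_cmult_indicator) auto
  also have "emeasure lborel (cball 0 \<rho> :: 'a set) = ennreal (measure lborel (cball 0 \<rho> :: 'a set))"
    using emeasure_bounded_finite[OF bounded_cball, of "0::'a" \<rho>]
    by (intro emeasure_eq_ennreal_measure) auto
  finally show ?thesis by (simp add: ennreal_mult' mult.commute)
qed

text \<open>The maximal domain of \<open>grad div\<close>, free of boundary conditions.\<close>

definition div_grad_space :: "('a \<Rightarrow> 'a) set" where
  "div_grad_space = {\<tau> \<in> Hdiv S. wdiv S \<tau> \<in> H1 S}"

text \<open>The squared graph norm of \<open>grad div\<close>. The intermediate quantity
  \<open>div \<tau>\<close> is absent and has to be recovered.\<close>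

definition energy :: "('a \<Rightarrow> 'a) \<Rightarrow> real" where
  "energy \<tau> = (L2_norm S \<tau>)\<^sup>2 + (L2_norm S (wgrad S (wdiv S \<tau>)))\<^sup>2"

text \<open>Interior points are treated by a local Poincare inequality, where the mean of \<open>p = div \<tau>\<close>
  against a bump function is bounded by \<open>\<parallel>\<tau>\<parallel>\<close>; a boundary point is shifted to a compact subset of \<open>S\<close>,
  which finitely many controlled neighbourhoods cover.\<close>

definition controlled :: "'a set \<Rightarrow> bool" where
  "controlled N \<longleftrightarrow> open N \<and>
    (\<exists>C\<ge>0. \<forall>\<tau>\<in>div_grad_space. L2_inner (N \<inter> S) (wdiv S \<tau>) (wdiv S \<tau>) \<le> C * energy \<tau>)"

lemma div_grad_spaceD: "\<tau> \<in> div_grad_space \<Longrightarrow> \<tau> \<in> Hdiv S" "\<tau> \<in> div_grad_space \<Longrightarrow> wdiv S \<tau> \<in> H1 S"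
  by (simp_all add: div_grad_space_def)

lemma representative_local:
  assumes p: "p \<in> L2 S" and P: "representative p P" and A: "open A" "A \<subseteq> S"
  shows "L2_inner A p p = (LINT x|lborel. indicator A x * (P x)\<^sup>2)" "P \<in> L2 A"
    "integrable lborel (\<lambda>x. indicator A x * (P x)\<^sup>2)"
proof -
  have Al: "A \<in> sets lebesgue" using A by auto
  have eq: "ae_eq A p P" and PS: "P \<in> L2 S"
    using P ae_eq_restrict[OF A(2) Al S_sets] by (auto simp: representative_def)
  show PA: "P \<in> L2 A" by (rule L2_restrict[OF A(2) Al S_sets PS])
  have [measurable]: "P \<in> borel_measurable borel" and int: "integrable lborel (\<lambda>x. (P x)\<^sup>2)"
    using P by (auto simp: representative_def)
  have "L2_inner A p p = L2_inner A P P"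
    by (intro L2_inner_cong eq PA L2_restrict[OF A(2) Al S_sets p])
  then show "L2_inner A p p = (LINT x|lborel. indicator A x * (P x)\<^sup>2)"
    using L2_inner_lborel[OF A(1)] by (simp add: power2_eq_square)
  show "integrable lborel (\<lambda>x. indicator A x * (P x)\<^sup>2)"
    using integrable_mult_indicator[OF _ int, of A] A by simp
qed

lemma controlled_empty: "controlled {}"
  by (auto simp: controlled_def L2_inner_indicator intro!: exI[of _ 0])

lemma controlled_Un:
  assumes "controlled N" "controlled M"
  shows "controlled (N \<union> M)"
proof -
  obtain C D where C: "C \<ge> 0" "\<And>\<tau>. \<tau> \<in> div_grad_space \<Longrightarrow> L2_inner (N \<inter> S) (wdiv S \<tau>) (wdiv S \<tau>) \<le> C * energy \<tau>"
    and D: "D \<ge> 0" "\<And>\<tau>. \<tau> \<in> div_grad_space \<Longrightarrow> L2_inner (M \<inter> S) (wdiv S \<tau>) (wdiv S \<tau>) \<le> D * energy \<tau>"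
    and o: "open N" "open M"
    using assms unfolding controlled_def by metis
  have "L2_inner ((N \<union> M) \<inter> S) (wdiv S \<tau>) (wdiv S \<tau>) \<le> (C + D) * energy \<tau>" if \<tau>: "\<tau> \<in> div_grad_space" for \<tau>
  proof -
    note p = H1_L2[OF div_grad_spaceD(2)[OF \<tau>]]
    obtain P where P: "representative (wdiv S \<tau>) P" using representative_exists[OF p] by blast
    have oA: "open (N \<inter> S)" "open (M \<inter> S)" "open ((N \<union> M) \<inter> S)" using o open_S by auto
    note L1 = representative_local[OF p P oA(1) Int_lower2]
    note L2 = representative_local[OF p P oA(2) Int_lower2]
    note L3 = representative_local[OF p P oA(3) Int_lower2]
    have "L2_inner ((N \<union> M) \<inter> S) (wdiv S \<tau>) (wdiv S \<tau>) \<le>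
        (LINT x|lborel. indicator (N \<inter> S) x * (P x)\<^sup>2 + indicator (M \<inter> S) x * (P x)\<^sup>2)"
      unfolding L3(1) using L1(3) L2(3) L3(3)
      by (intro integral_mono Bochner_Integration.integrable_add) (auto simp: indicator_def)
    also have "\<dots> = L2_inner (N \<inter> S) (wdiv S \<tau>) (wdiv S \<tau>) + L2_inner (M \<inter> S) (wdiv S \<tau>) (wdiv S \<tau>)"
      unfolding L1(1) L2(1) by (rule Bochner_Integration.integral_add[OF L1(3) L2(3)])
    also have "\<dots> \<le> (C + D) * energy \<tau>" using C(2)[OF \<tau>] D(2)[OF \<tau>] by (simp add: algebra_simps)
    finally show ?thesis .
  qed
  then show ?thesis using C(1) D(1) o unfolding controlled_def by (auto intro!: exI[of _ "C + D"])
qed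

lemma controlled_compact:
  assumes K: "compact K" and loc: "\<And>x. x \<in> K \<Longrightarrow> \<exists>N. x \<in> N \<and> controlled N"
  obtains N where "controlled N" "K \<subseteq> N"
proof -
  have "K \<subseteq> \<Union>{N. controlled N}" using loc by blast
  moreover have "open N" if "N \<in> {N. controlled N}" for N using that by (simp add: controlled_def)
  ultimately obtain F where F: "F \<subseteq> {N. controlled N}" "finite F" "K \<subseteq> \<Union>F"
    using compactE[OF K, of "{N. controlled N}"] by metis
  have "controlled (\<Union>F)"
    using F(2,1) by (induction F rule: finite_induct) (auto simp: controlled_empty controlled_Un)
  then show thesis using that F(3) by blast
qed

lemma L2_norm_sq_nn_integral:
  fixes f :: "'a \<Rightarrow> real"
  assumes A: "open A" and f: "f \<in> L2 A" and [measurable]: "f \<in> borel_measurable borel"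
  shows "ennreal ((L2_norm A f)\<^sup>2) = (\<integral>\<^sup>+x. ennreal (indicator A x * (f x)\<^sup>2) \<partial>lborel)"
proof -
  have [measurable]: "A \<in> sets borel" using A by auto
  have "integrable lebesgue (\<lambda>x. indicator A x *\<^sub>R (norm (f x))\<^sup>2)"
    using L2_integrable_sq[OF f] A by (subst (asm) integrable_restrict_space) auto
  then have int: "integrable lborel (\<lambda>x. indicator A x * (f x)\<^sup>2)"
    by (subst (asm) integrable_completion) auto
  have "(L2_norm A f)\<^sup>2 = (LINT x|lborel. indicator A x * (f x * f x))"
    unfolding L2_norm_sq[OF f] by (rule L2_inner_lborel[OF A]) measurable
  then show ?thesis
    using nn_integral_eq_integral[OF int] by (simp add: power2_eq_square)
qed

lemma controlled_interior:
  assumes x0: "x0 \<in> S"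
  shows "\<exists>N. x0 \<in> N \<and> controlled N"
proof -
  obtain R where R: "R > 0" "ball x0 R \<subseteq> S" using open_S x0 openE by blast
  \<comment> \<open>With a third of the radius, points of \<open>A\<close> differ by at most
    \<open>2 * r\<close>, and a point of \<open>A\<close> moved that far stays in
    \<open>ball x0 R\<close>.\<close>
  define r where "r = R / 3"
  have r: "r > 0" using R by (simp add: r_def)
  define A where "A = ball x0 r"
  have A: "open A" "bounded A" "x0 \<in> A" using r by (auto simp: A_def)
  interpret A: bounded_open A using A by unfold_locales auto
  have inS: "x + h \<in> S" if "x \<in> A" "norm h \<le> 2 * r" for x h
  proof -
    have "dist x0 (x + h) \<le> dist x0 x + norm h"
      using dist_triangle[of x0 "x + h" x] by (simp add: dist_norm)
    also have "\<dots> < R" using that by (simp add: A_def r_def)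
    finally show ?thesis using R(2) by auto
  qed
  have AS: "A \<subseteq> S" using inS[of _ 0] r by auto
  have diam: "norm (y - x) \<le> 2 * r" if "x \<in> A" "y \<in> A" for x y
    using that dist_triangle[of y x x0] by (simp add: A_def dist_norm norm_minus_commute)
  obtain a b where ab: "cbox a b \<subseteq> A" "x0 \<in> box a b" "\<forall>i\<in>Basis. a \<bullet> i < b \<bullet> i"
    using open_contains_cbox[OF A(1,3)] by metis
  define \<phi> where "\<phi> = box_bump a b"
  have \<phi>: "\<phi> \<in> test_fun A" unfolding \<phi>_def by (rule box_bump_test_fun[OF ab(1)])
  have \<phi>S: "\<phi> \<in> test_fun S" by (rule test_fun_mono[OF \<phi> AS])
  have \<phi>L: "\<phi> \<in> L2 A" by (rule A.test_L2[OF \<phi>])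
  have [measurable]: "\<phi> \<in> borel_measurable borel" by (rule test_fun_borel[OF \<phi>])
  define m where "m = (LINT x|lborel. \<phi> x)"
  have m: "m > 0"
  proof -
    have "m \<ge> 0" unfolding m_def \<phi>_def by (rule Bochner_Integration.integral_nonneg) (rule box_bump_bounds)
    moreover have "m \<noteq> 0"
    proof
      assume "m = 0"
      then have "AE x in lborel. \<phi> x = 0"
        unfolding m_def using test_fun_integrable[OF \<phi>] box_bump_bounds(1)[of a b]
        by (subst (asm) integral_nonneg_eq_0_iff_AE) (auto simp: \<phi>_def)
      then have "AE x in lborel. x \<notin> box a b"
        by (rule AE_mp) (use box_bump_pos[of _ a b] in \<open>force simp: \<phi>_def\<close>)
      then have "emeasure lborel (box a b) = 0"
        by (subst (asm) AE_iff_measurable[of "box a b"]) auto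
      moreover have "0 < (\<Prod>i\<in>Basis. (b - a) \<bullet> i)"
        using ab(3) by (intro prod_pos) (auto simp: inner_diff_left)
      ultimately show False
        using ab(3) by (auto simp: emeasure_lborel_box_eq inner_diff_left less_imp_le split: if_splits)
    qed
    ultimately show ?thesis by simp
  qed
  have one: "(\<lambda>x. c) \<in> L2 A" for c :: real by (rule const_in_L2[OF A.S_lmeasurable])
  define V where "V = measure lborel (cball (0::'a) (2 * r))"
  \<comment> \<open>\<open>C1\<close> accounts for \<open>P - c\<close> by the local Poincare
    inequality, \<open>C2\<close> for the mean \<open>c\<close>; the leading factors 2 come from
    squaring a sum.\<close>
  define C1 where "C1 = 2 * ((L2_norm A \<phi>)\<^sup>2 / m\<^sup>2 * (V * (2 * r)\<^sup>2))"
  define C2 where "C2 = 2 * (L2_norm S (cgrad \<phi>) / m * L2_norm A (\<lambda>x. 1 :: real))\<^sup>2"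
  have C: "C1 \<ge> 0" "C2 \<ge> 0" by (simp_all add: C1_def C2_def V_def)
  have "L2_inner (A \<inter> S) (wdiv S \<tau>) (wdiv S \<tau>) \<le> (C1 + C2) * energy \<tau>" if \<tau>: "\<tau> \<in> div_grad_space" for \<tau>
  proof -
    define p where "p = wdiv S \<tau>"
    have p: "p \<in> H1 S" using div_grad_spaceD(2)[OF \<tau>] by (simp add: p_def)
    obtain P where P: "representative p P" using representative_exists[OF H1_L2[OF p]] by blast
    have [measurable]: "P \<in> borel_measurable borel" using P by (simp add: representative_def)
    note PA = representative_local[OF H1_L2[OF p] P A(1) AS]
    note PL = PA(2)
    define G where "G = L2_norm S (wgrad S p)"
    define c where "c = (LINT x|lborel. P x * \<phi> x) / m"
    \<comment> \<open>As \<open>p = div \<tau>\<close>, the derivative moves onto \<phi>, and the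
      mean is controlled without any knowledge of \<open>p\<close>.\<close>
    have "(LINT x|lborel. P x * \<phi> x) = - L2_inner S \<tau> (cgrad \<phi>)"
      using representative_inner[OF P H1_L2[OF p] \<phi>S] wdiv_test[OF div_grad_spaceD(1)[OF \<tau>] \<phi>S]
      by (simp add: p_def)
    then have c: "\<bar>c\<bar> \<le> L2_norm S \<tau> * (L2_norm S (cgrad \<phi>) / m)"
      using L2_cs[OF Hdiv_L2[OF div_grad_spaceD(1)[OF \<tau>]] test_L2[OF test_fun_cgrad[OF \<phi>]]] m
      by (simp add: c_def abs_divide divide_right_mono)
    \<comment> \<open>\<open>m * (c - P x)\<close> is the integral over \<open>y\<close> of
      \<open>(P y - P x) * \<phi> y\<close>, so Cauchy-Schwarz bounds the deviation from the mean by
      the oscillation of \<open>P\<close> about its value at \<open>x\<close>.\<close>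
    have pw: "(P x - c)\<^sup>2 \<le> (L2_norm A \<phi>)\<^sup>2 / m\<^sup>2 * (L2_norm A (\<lambda>y. P y - P x))\<^sup>2" for x
    proof -
      have "L2_inner A (\<lambda>y. P y - P x) \<phi> = L2_inner A P \<phi> - L2_inner A (\<lambda>y. P x) \<phi>"
        by (rule L2_inner_diff[OF PL one \<phi>L])
      also have "L2_inner A P \<phi> = (LINT x|lborel. P x * \<phi> x)"
        unfolding L2_inner_def inner_real_def
        using test_fun_zero_outside[OF \<phi>] by (intro integral_lebesgue_on_eq_lborel A.S_sets) auto
      also have "L2_inner A (\<lambda>y. P x) \<phi> = (LINT y|lborel. P x * \<phi> y)"
        unfolding L2_inner_def inner_real_def
        using test_fun_zero_outside[OF \<phi>] by (intro integral_lebesgue_on_eq_lborel A.S_sets) auto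
      finally have "L2_inner A (\<lambda>y. P y - P x) \<phi> = m * (c - P x)"
        using m by (simp add: c_def m_def algebra_simps)
      then have "m * \<bar>P x - c\<bar> \<le> L2_norm A (\<lambda>y. P y - P x) * L2_norm A \<phi>"
        using L2_cs[OF L2_diff[OF PL one] \<phi>L, of "P x"] m by (simp add: abs_mult abs_minus_commute)
      then have "(m * \<bar>P x - c\<bar>)\<^sup>2 \<le> (L2_norm A (\<lambda>y. P y - P x) * L2_norm A \<phi>)\<^sup>2"
        using m by (intro power_mono) auto
      then show ?thesis using m by (simp add: power_mult_distrib pos_le_divide_eq mult_ac)
    qed
    have nn: "ennreal (indicator A x * (P x - c)\<^sup>2) \<le> ennreal ((L2_norm A \<phi>)\<^sup>2 / m\<^sup>2) *
        (\<integral>\<^sup>+y. ennreal (indicator A x * indicator A y * (P y - P x)\<^sup>2) \<partial>lborel)" for x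
    proof (cases "x \<in> A")
      case True
      have "ennreal ((P x - c)\<^sup>2) \<le> ennreal ((L2_norm A \<phi>)\<^sup>2 / m\<^sup>2 * (L2_norm A (\<lambda>y. P y - P x))\<^sup>2)"
        by (rule ennreal_leI[OF pw])
      also have "\<dots> = ennreal ((L2_norm A \<phi>)\<^sup>2 / m\<^sup>2) * ennreal ((L2_norm A (\<lambda>y. P y - P x))\<^sup>2)"
        by (rule ennreal_mult) auto
      also have "ennreal ((L2_norm A (\<lambda>y. P y - P x))\<^sup>2) =
          (\<integral>\<^sup>+y. ennreal (indicator A y * (P y - P x)\<^sup>2) \<partial>lborel)"
        by (rule L2_norm_sq_nn_integral[OF A(1) L2_diff[OF PL one]]) measurable
      finally show ?thesis using True by simp
    qed simp
    have "ennreal ((L2_norm A (\<lambda>x. P x - c))\<^sup>2) = (\<integral>\<^sup>+x. ennreal (indicator A x * (P x - c)\<^sup>2) \<partial>lborel)"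
      by (rule L2_norm_sq_nn_integral[OF A(1) L2_diff[OF PL one]]) measurable
    also have "\<dots> \<le> (\<integral>\<^sup>+x. ennreal ((L2_norm A \<phi>)\<^sup>2 / m\<^sup>2) *
        (\<integral>\<^sup>+y. ennreal (indicator A x * indicator A y * (P y - P x)\<^sup>2) \<partial>lborel) \<partial>lborel)"
      by (intro nn_integral_mono nn)
    also have "\<dots> = ennreal ((L2_norm A \<phi>)\<^sup>2 / m\<^sup>2) *
        (\<integral>\<^sup>+x. (\<integral>\<^sup>+y. ennreal (indicator A x * indicator A y * (P y - P x)\<^sup>2) \<partial>lborel) \<partial>lborel)"
    proof (rule nn_integral_cmult)
      have [measurable]: "A \<in> sets borel" using A(1) by auto
      show "(\<lambda>x. \<integral>\<^sup>+y. ennreal (indicator A x * indicator A y * (P y - P x)\<^sup>2) \<partial>lborel) \<in> borel_measurable lborel"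
        by measurable
    qed
    also have "\<dots> \<le> ennreal ((L2_norm A \<phi>)\<^sup>2 / m\<^sup>2) * ennreal (V * (2 * r * G)\<^sup>2)"
      unfolding V_def G_def by (intro mult_left_mono local_poincare[OF p P A(1) diam inS]) auto
    also have "\<dots> = ennreal ((L2_norm A \<phi>)\<^sup>2 / m\<^sup>2 * (V * (2 * r * G)\<^sup>2))"
      by (rule ennreal_mult[symmetric]) (auto simp: V_def)
    finally have 1: "(L2_norm A (\<lambda>x. P x - c))\<^sup>2 \<le> (L2_norm A \<phi>)\<^sup>2 / m\<^sup>2 * (V * (2 * r * G)\<^sup>2)"
      by (subst (asm) ennreal_le_iff) (auto simp: V_def)
    have const: "L2_norm A (\<lambda>x. c) = \<bar>c\<bar> * L2_norm A (\<lambda>x. 1 :: real)"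
      using L2_norm_scale[of A c "\<lambda>x. 1 :: real"] by simp
    have "L2_norm A (\<lambda>x. c) \<le> L2_norm S \<tau> * (L2_norm S (cgrad \<phi>) / m) * L2_norm A (\<lambda>x. 1 :: real)"
      unfolding const by (intro mult_right_mono c L2_norm_nonneg one)
    then have 2: "(L2_norm A (\<lambda>x. c))\<^sup>2 \<le> (L2_norm S \<tau> * (L2_norm S (cgrad \<phi>) / m) * L2_norm A (\<lambda>x. 1 :: real))\<^sup>2"
      by (intro power_mono L2_norm_nonneg one)
    have "L2_norm A P \<le> L2_norm A (\<lambda>x. P x - c) + L2_norm A (\<lambda>x. c)"
      using L2_norm_add[OF L2_diff[OF PL one] one, of c c] by simp
    then have "(L2_norm A P)\<^sup>2 \<le> (L2_norm A (\<lambda>x. P x - c) + L2_norm A (\<lambda>x. c))\<^sup>2"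
      by (intro power_mono L2_norm_nonneg PL)
    also have "\<dots> \<le> 2 * (L2_norm A (\<lambda>x. P x - c))\<^sup>2 + 2 * (L2_norm A (\<lambda>x. c))\<^sup>2"
      by (rule sum_squares_le)
    also have "\<dots> \<le> C1 * G\<^sup>2 + C2 * (L2_norm S \<tau>)\<^sup>2"
    proof -
      have "C1 * G\<^sup>2 = 2 * ((L2_norm A \<phi>)\<^sup>2 / m\<^sup>2 * (V * (2 * r * G)\<^sup>2))"
        by (simp add: C1_def power_mult_distrib mult_ac)
      moreover have "C2 * (L2_norm S \<tau>)\<^sup>2 =
          2 * (L2_norm S \<tau> * (L2_norm S (cgrad \<phi>) / m) * L2_norm A (\<lambda>x. 1 :: real))\<^sup>2"
        by (simp add: C2_def power_mult_distrib power_divide mult_ac)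
      ultimately show ?thesis using 1 2 by linarith
    qed
    also have "\<dots> \<le> (C1 + C2) * energy \<tau>"
    proof -
      have "C1 * G\<^sup>2 \<le> C1 * energy \<tau>" "C2 * (L2_norm S \<tau>)\<^sup>2 \<le> C2 * energy \<tau>"
        using C by (auto intro!: mult_left_mono simp: energy_def G_def p_def)
      then show ?thesis by (simp add: algebra_simps)
    qed
    finally have "(L2_norm A P)\<^sup>2 \<le> (C1 + C2) * energy \<tau>" .
    moreover have "(L2_norm A P)\<^sup>2 = L2_inner A p p"
      unfolding PA(1) L2_norm_sq[OF PL] using L2_inner_lborel[OF A(1), of P P]
      by (simp add: power2_eq_square)
    moreover have "A \<inter> S = A" using AS by auto
    ultimately show ?thesis by (simp add: p_def)
  qed
  then have "controlled A" using A(1) C unfolding controlled_def by (auto intro!: exI[of _ "C1 + C2"])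
  then show ?thesis using A(3) by blast
qed

text \<open>Near the boundary, a shift in the direction \<open>- e\<close> of a chart moves \<open>S\<close> into a compact subset.\<close>

lemma controlled_boundary:
  assumes lip: "lipschitz_boundary S" and x0: "x0 \<in> frontier S"
  shows "\<exists>N. x0 \<in> N \<and> controlled N"
proof -
  obtain U e G where U: "open U" "x0 \<in> U" and e: "norm e = 1" and G: "continuous_on UNIV G"
    and SU: "S \<inter> U = {x \<in> U. x \<bullet> e < G x}" and Ge: "\<forall>x t. G (x + t *\<^sub>R e) = G x"
    using lipschitz_chart[OF lip x0] by (elim exE conjE) (rule that)
  obtain \<rho> where \<rho>: "\<rho> > 0" "cball x0 \<rho> \<subseteq> U" using U open_contains_cball by blast
  \<comment> \<open>Half the radius: a point within \<open>d\<close> of \<open>x0\<close> that is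
    shifted by length \<open>d\<close> remains in \<open>cball x0 \<rho>\<close>.\<close>
  define d where "d = \<rho> / 2"
  have d: "d > 0" using \<rho> by (simp add: d_def)
  have ee: "e \<bullet> e = 1" using e by (simp add: norm_eq_1)
  define A where "A = ball x0 d \<inter> S"
  define h where "h = - d *\<^sub>R e"
  have A: "open A" "A \<subseteq> S" using open_S by (auto simp: A_def)
  have near: "x + t *\<^sub>R h \<in> cball x0 \<rho>" if "x \<in> A" "0 \<le> t" "t \<le> 1" for x t
  proof -
    have "dist x0 (x + t *\<^sub>R h) \<le> dist x0 x + norm (t *\<^sub>R h)"
      using dist_triangle[of x0 "x + t *\<^sub>R h" x] by (simp add: dist_norm)
    also have "norm (t *\<^sub>R h) = t * d" using that d e by (simp add: h_def)
    also have "t * d \<le> 1 * d" using that d by (intro mult_right_mono) auto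
    also have "dist x0 x + 1 * d \<le> \<rho>" using that by (simp add: A_def d_def)
    finally show ?thesis by simp
  qed
  have G_shift: "G (x + t *\<^sub>R h) = G x" "(x + t *\<^sub>R h) \<bullet> e = x \<bullet> e - t * d" for x t
    using Ge[rule_format, of x "- (t * d)"] by (simp_all add: h_def inner_add_left inner_diff_left ee)
  have below: "x \<bullet> e < G x" if "x \<in> A" for x
    using that near[OF that, of 0] \<rho> SU by (auto simp: A_def)
  have seg: "x + t *\<^sub>R h \<in> S" if x: "x \<in> A" and t: "0 \<le> t" "t \<le> 1" for x t
  proof -
    have "(x + t *\<^sub>R h) \<bullet> e < G (x + t *\<^sub>R h)"
      unfolding G_shift using below[OF x] mult_nonneg_nonneg[OF t(1) less_imp_le[OF d]] by simp
    then show ?thesis using near[OF that] \<rho>(2) SU by auto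
  qed
  \<comment> \<open>The part of the ball lying at least \<open>d\<close> below the graph. It
    contains the shifted set, and being compact in \<open>S\<close> it is covered by finitely many
    interior neighbourhoods.\<close>
  define K where "K = cball x0 \<rho> \<inter> {y. y \<bullet> e \<le> G y - d}"
  have "compact K"
    unfolding K_def using G
    by (intro compact_Int_closed compact_cball closed_Collect_le continuous_intros) auto
  moreover have "K \<subseteq> S" using \<rho>(2) SU d by (force simp: K_def)
  ultimately obtain M where M: "controlled M" "K \<subseteq> M"
    using controlled_compact controlled_interior by (metis subsetD)
  obtain D where D: "D \<ge> 0" "\<And>\<tau>. \<tau> \<in> div_grad_space \<Longrightarrow> L2_inner (M \<inter> S) (wdiv S \<tau>) (wdiv S \<tau>) \<le> D * energy \<tau>"
    and oM: "open M" using M(1) unfolding controlled_def by blast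
  have AK: "x + h \<in> M \<inter> S" if x: "x \<in> A" for x
  proof -
    have "x + h \<in> K"
      using near[OF x, of 1] below[OF x] G_shift[of x 1] by (simp add: K_def)
    then show ?thesis using M(2) seg[OF x, of 1] by auto
  qed
  have "L2_inner A (wdiv S \<tau>) (wdiv S \<tau>) \<le> (2 * d\<^sup>2 + 2 * D) * energy \<tau>" if \<tau>: "\<tau> \<in> div_grad_space" for \<tau>
  proof -
    define p where "p = wdiv S \<tau>"
    have p: "p \<in> H1 S" using div_grad_spaceD(2)[OF \<tau>] by (simp add: p_def)
    obtain P where P: "representative p P" using representative_exists[OF H1_L2[OF p]] by blast
    have [measurable]: "P \<in> borel_measurable borel" and PI: "integrable lborel (\<lambda>x. (P x)\<^sup>2)"
      using P by (auto simp: representative_def)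
    have [measurable]: "A \<in> sets borel" "M \<inter> S \<in> sets borel" using A(1) oM open_S by auto
    note PA = representative_local[OF H1_L2[OF p] P A]
    note PM = representative_local[OF H1_L2[OF p] P open_Int[OF oM open_S] Int_lower2]
    have T: "(\<lambda>x. P (x + h) - P x) \<in> L2 A"
      "L2_norm A (\<lambda>x. P (x + h) - P x) \<le> norm h * L2_norm S (wgrad S p)"
      by (rule translation_estimate[OF p P A(1)], rule seg, assumption+)+
    have Ph: "(\<lambda>x. P (x + h)) \<in> L2 A"
      using L2_add[OF T(1) PA(2)] by simp
    have "ennreal ((L2_norm A (\<lambda>x. P (x + h)))\<^sup>2) = (\<integral>\<^sup>+x. ennreal (indicator A x * (P (x + h))\<^sup>2) \<partial>lborel)"
      by (rule L2_norm_sq_nn_integral[OF A(1) Ph]) measurable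
    also have "\<dots> \<le> (\<integral>\<^sup>+x. ennreal (indicator (M \<inter> S) (h + x) * (P (h + x))\<^sup>2) \<partial>lborel)"
      using AK by (intro nn_integral_mono ennreal_leI) (auto simp: indicator_def add.commute)
    also have "\<dots> = (\<integral>\<^sup>+x. ennreal (indicator (M \<inter> S) x * (P x)\<^sup>2) \<partial>lborel)"
      by (rule nn_integral_lborel_translate[of "\<lambda>x. ennreal (indicator (M \<inter> S) x * (P x)\<^sup>2)"]) measurable
    also have "\<dots> = ennreal (L2_inner (M \<inter> S) p p)"
      unfolding PM(1) by (rule nn_integral_eq_integral[OF PM(3)]) auto
    finally have "(L2_norm A (\<lambda>x. P (x + h)))\<^sup>2 \<le> L2_inner (M \<inter> S) p p"
      by (subst (asm) ennreal_le_iff) (auto simp: L2_inner_def)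
    then have 1: "(L2_norm A (\<lambda>x. P (x + h)))\<^sup>2 \<le> D * energy \<tau>" using D(2)[OF \<tau>] by (simp add: p_def)
    have "(L2_norm A (\<lambda>x. P (x + h) - P x))\<^sup>2 \<le> (d * L2_norm S (wgrad S p))\<^sup>2"
      using T(2) d e by (intro power_mono L2_norm_nonneg T(1)) (simp add: h_def)
    also have "\<dots> \<le> d\<^sup>2 * energy \<tau>"
      by (simp add: power_mult_distrib energy_def p_def mult_left_mono)
    finally have 2: "(L2_norm A (\<lambda>x. P (x + h) - P x))\<^sup>2 \<le> d\<^sup>2 * energy \<tau>" .
    \<comment> \<open>The shifted values are controlled on the interior set \<open>M\<close>, the
      difference by the translation estimate.\<close>
    have "L2_norm A P \<le> L2_norm A (\<lambda>x. P (x + h)) + L2_norm A (\<lambda>x. P (x + h) - P x)"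
      using L2_norm_add[OF Ph L2_diff[OF PA(2) Ph]] L2_norm_minus_commute[OF Ph PA(2)] by simp
    then have "(L2_norm A P)\<^sup>2 \<le> (L2_norm A (\<lambda>x. P (x + h)) + L2_norm A (\<lambda>x. P (x + h) - P x))\<^sup>2"
      by (intro power_mono L2_norm_nonneg PA(2))
    also have "\<dots> \<le> 2 * (L2_norm A (\<lambda>x. P (x + h)))\<^sup>2 + 2 * (L2_norm A (\<lambda>x. P (x + h) - P x))\<^sup>2"
      by (rule sum_squares_le)
    also have "\<dots> \<le> (2 * d\<^sup>2 + 2 * D) * energy \<tau>" using 1 2 by (simp add: algebra_simps)
    finally have "(L2_norm A P)\<^sup>2 \<le> (2 * d\<^sup>2 + 2 * D) * energy \<tau>" .
    moreover have "(L2_norm A P)\<^sup>2 = L2_inner A p p"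
      unfolding PA(1) L2_norm_sq[OF PA(2)] using L2_inner_lborel[OF A(1), of P P]
      by (simp add: power2_eq_square)
    ultimately show ?thesis by (simp add: p_def)
  qed
  then have "controlled (ball x0 d)"
    using D(1) unfolding controlled_def A_def by (auto intro!: exI[of _ "2 * d\<^sup>2 + 2 * D"])
  then show ?thesis using d by (intro exI[of _ "ball x0 d"]) simp
qed

theorem divergence_estimate:
  assumes "lipschitz_boundary S"
  obtains C where "C > 0" "\<And>\<tau>. \<tau> \<in> Hdiv S \<Longrightarrow> wdiv S \<tau> \<in> H1 S \<Longrightarrow>
    L2_norm S (wdiv S \<tau>) \<le> C * (L2_norm S \<tau> + L2_norm S (wgrad S (wdiv S \<tau>)))"
proof -
  have "compact (closure S)" using bounded_S by (simp add: compact_closure)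
  moreover have "\<exists>N. x \<in> N \<and> controlled N" if "x \<in> closure S" for x
    using that controlled_interior controlled_boundary[OF assms] open_S
    by (cases "x \<in> S") (auto simp: frontier_def interior_open)
  ultimately obtain N where N: "controlled N" "closure S \<subseteq> N" using controlled_compact by metis
  then have NS: "N \<inter> S = S" using closure_subset by blast
  obtain D where D: "D \<ge> 0" "\<And>\<tau>. \<tau> \<in> div_grad_space \<Longrightarrow> L2_inner S (wdiv S \<tau>) (wdiv S \<tau>) \<le> D * energy \<tau>"
    using N(1) unfolding controlled_def NS by blast
  show thesis
  \<comment> \<open>The added 1 keeps the constant positive when \<open>D = 0\<close>.\<close>
  proof (rule that[of "sqrt D + 1"])
    fix \<tau> assume \<tau>: "\<tau> \<in> Hdiv S" "wdiv S \<tau> \<in> H1 S"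
    note nn = L2_norm_nonneg[OF Hdiv_L2[OF \<tau>(1)]] L2_norm_nonneg[OF wgrad_L2[OF \<tau>(2)]]
    have "L2_norm S (wdiv S \<tau>) \<le> sqrt (D * energy \<tau>)"
      unfolding L2_norm_def using D(2)[of \<tau>] \<tau> by (intro real_sqrt_le_mono) (simp add: div_grad_space_def)
    also have "\<dots> = sqrt D * sqrt (energy \<tau>)" by (rule real_sqrt_mult)
    also have "\<dots> \<le> (sqrt D + 1) * (L2_norm S \<tau> + L2_norm S (wgrad S (wdiv S \<tau>)))"
      unfolding energy_def using D(1) nn by (intro mult_mono sqrt_sum_squares_le_sum) auto
    finally show "L2_norm S (wdiv S \<tau>) \<le> (sqrt D + 1) * (L2_norm S \<tau> + L2_norm S (wgrad S (wdiv S \<tau>)))" .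
  qed (use D(1) in \<open>simp add: add_nonneg_pos\<close>)
qed

end

section \<open>The problem on a single domain\<close>

context bounded_open
begin

text \<open>The chosen \<open>wdiv S \<tau>\<close> is rarely the formula at hand; any
  \<open>q\<close> in \<open>H1\<close> that agrees with it almost everywhere certifies
  membership.\<close>

lemma div_grad_cong:
  assumes "\<tau> \<in> Hdiv S" "ae_eq S (wdiv S \<tau>) q" "q \<in> H1 S"
  shows "\<tau> \<in> div_grad_space" "ae_eq S (wgrad S (wdiv S \<tau>)) (wgrad S q)"
  using H1_cong[OF assms(3) ae_eq_sym[OF assms(2)] wdiv_L2[OF assms(1)]] assms(1)
  by (auto simp: div_grad_space_def)

lemma div_grad_space_add:
  assumes u: "u \<in> div_grad_space" and v: "v \<in> div_grad_space"
  shows "(\<lambda>x. u x + v x) \<in> div_grad_space"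
    "ae_eq S (wgrad S (wdiv S (\<lambda>x. u x + v x))) (\<lambda>x. wgrad S (wdiv S u) x + wgrad S (wdiv S v) x)"
proof -
  note D = div_grad_spaceD[OF u] div_grad_spaceD[OF v]
  note C = div_grad_cong[OF Hdiv_add[OF D(1,3)] wdiv_add[OF D(1,3)] H1_add[OF D(2,4)]]
  show "(\<lambda>x. u x + v x) \<in> div_grad_space" by (rule C(1))
  show "ae_eq S (wgrad S (wdiv S (\<lambda>x. u x + v x))) (\<lambda>x. wgrad S (wdiv S u) x + wgrad S (wdiv S v) x)"
    by (rule ae_eq_trans[OF C(2) wgrad_add[OF D(2,4)]])
qed

lemma div_grad_space_scale:
  assumes u: "u \<in> div_grad_space"
  shows "(\<lambda>x. c *\<^sub>R u x) \<in> div_grad_space"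
    "ae_eq S (wgrad S (wdiv S (\<lambda>x. c *\<^sub>R u x))) (\<lambda>x. c *\<^sub>R wgrad S (wdiv S u) x)"
proof -
  note D = div_grad_spaceD[OF u]
  note C = div_grad_cong[OF Hdiv_scale[OF D(1)] wdiv_scale[OF D(1)] H1_scale[OF D(2)]]
  show "(\<lambda>x. c *\<^sub>R u x) \<in> div_grad_space" by (rule C(1))
  show "ae_eq S (wgrad S (wdiv S (\<lambda>x. c *\<^sub>R u x))) (\<lambda>x. c *\<^sub>R wgrad S (wdiv S u) x)"
    by (rule ae_eq_trans[OF C(2) wgrad_scale[OF D(2)]])
qed

lemma div_grad_space_diff:
  assumes u: "u \<in> div_grad_space" and v: "v \<in> div_grad_space"
  shows "(\<lambda>x. u x - v x) \<in> div_grad_space"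
    "ae_eq S (wgrad S (wdiv S (\<lambda>x. u x - v x))) (\<lambda>x. wgrad S (wdiv S u) x - wgrad S (wdiv S v) x)"
proof -
  note D = div_grad_spaceD[OF u] div_grad_spaceD[OF v]
  note C = div_grad_cong[OF Hdiv_diff[OF D(1,3)] wdiv_diff[OF D(1,3)] H1_diff[OF D(2,4)]]
  show "(\<lambda>x. u x - v x) \<in> div_grad_space" by (rule C(1))
  show "ae_eq S (wgrad S (wdiv S (\<lambda>x. u x - v x))) (\<lambda>x. wgrad S (wdiv S u) x - wgrad S (wdiv S v) x)"
    by (rule ae_eq_trans[OF C(2) wgrad_diff[OF D(2,4)]])
qed

lemma div_grad_space_L2:
  assumes "\<tau> \<in> div_grad_space"
  shows "\<tau> \<in> L2 S" "wdiv S \<tau> \<in> L2 S" "wgrad S (wdiv S \<tau>) \<in> L2 S"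
  using div_grad_spaceD[OF assms] by (auto intro: Hdiv_L2 H1_L2 wgrad_L2)

definition energy_inner :: "('a \<Rightarrow> 'a) \<Rightarrow> ('a \<Rightarrow> 'a) \<Rightarrow> real" where
  "energy_inner \<tau> \<sigma> = L2_inner S \<tau> \<sigma> + L2_inner S (wgrad S (wdiv S \<tau>)) (wgrad S (wdiv S \<sigma>))"

lemma pre_hilbert_energy: "pre_hilbert div_grad_space energy_inner"
proof
  fix u v w c assume u: "u \<in> div_grad_space" and v: "v \<in> div_grad_space" and w: "w \<in> div_grad_space"
  note L = div_grad_space_L2[OF u] div_grad_space_L2[OF v] div_grad_space_L2[OF w]
  have "L2_inner S (wgrad S (wdiv S (\<lambda>x. u x + v x))) (wgrad S (wdiv S w)) =
      L2_inner S (\<lambda>x. wgrad S (wdiv S u) x + wgrad S (wdiv S v) x) (wgrad S (wdiv S w))"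
    by (rule L2_inner_cong[OF div_grad_space_add(2)[OF u v] ae_eq_refl
        div_grad_space_L2(3)[OF div_grad_space_add(1)[OF u v]] L2_add[OF L(3,6)] L(9) L(9)])
  then show "energy_inner (\<lambda>x. u x + v x) w = energy_inner u w + energy_inner v w"
    unfolding energy_inner_def using L by (simp add: L2_inner_add)
  have "L2_inner S (wgrad S (wdiv S (\<lambda>x. c *\<^sub>R u x))) (wgrad S (wdiv S w)) =
      L2_inner S (\<lambda>x. c *\<^sub>R wgrad S (wdiv S u) x) (wgrad S (wdiv S w))"
    by (rule L2_inner_cong[OF div_grad_space_scale(2)[OF u] ae_eq_refl
        div_grad_space_L2(3)[OF div_grad_space_scale(1)[OF u]] L2_scale[OF L(3)] L(9) L(9)])
  then show "energy_inner (\<lambda>x. c *\<^sub>R u x) w = c * energy_inner u w"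
    unfolding energy_inner_def by (simp add: L2_inner_scale distrib_left)
  show "0 \<le> energy_inner u u"
    unfolding energy_inner_def using L by (simp add: L2_inner_nonneg)
next
  have z: "is_weak_div S (\<lambda>x. 0) (\<lambda>x. 0)" by (simp add: is_weak_div_def)
  show "(\<lambda>x. 0) \<in> div_grad_space"
    by (rule div_grad_cong(1)[OF Hdiv_I[OF L2_zero z] wdiv_eqI[OF L2_zero z] G.zero])
qed (auto simp: energy_inner_def L2_inner_commute div_grad_space_add div_grad_space_scale)

lemma nrm_energy:
  assumes "\<tau> \<in> div_grad_space"
  shows "nrm energy_inner \<tau> = sqrt (energy \<tau>)"
  using div_grad_space_L2[OF assms] by (simp add: nrm_def energy_inner_def energy_def L2_norm_sq)

lemma L2_norm_le_energy:
  assumes "\<tau> \<in> div_grad_space"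
  shows "L2_norm S \<tau> \<le> nrm energy_inner \<tau>" "L2_norm S (wgrad S (wdiv S \<tau>)) \<le> nrm energy_inner \<tau>"
  unfolding nrm_energy[OF assms] energy_def by (auto intro!: real_le_rsqrt)

lemma energy_le:
  assumes "\<tau> \<in> div_grad_space"
  shows "nrm energy_inner \<tau> \<le> L2_norm S \<tau> + L2_norm S (wgrad S (wdiv S \<tau>))"
  unfolding nrm_energy[OF assms] energy_def
  using div_grad_space_L2[OF assms] by (intro sqrt_sum_squares_le_sum L2_norm_nonneg)

text \<open>A limit of \<open>grad div\<close> alone could not be recognised as such. The divergence
  estimate makes the divergences Cauchy as well, so closedness applies twice: first to the
  divergence, then to the gradient of its limit.\<close>

lemma energy_complete:
  assumes lip: "lipschitz_boundary S"
  shows "pre_hilbert.complete_space div_grad_space energy_inner"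
proof -
  interpret E: pre_hilbert div_grad_space energy_inner by (rule pre_hilbert_energy)
  obtain C where C: "C > 0" "\<And>\<tau>. \<tau> \<in> Hdiv S \<Longrightarrow> wdiv S \<tau> \<in> H1 S \<Longrightarrow>
      L2_norm S (wdiv S \<tau>) \<le> C * (L2_norm S \<tau> + L2_norm S (wgrad S (wdiv S \<tau>)))"
    using divergence_estimate[OF lip] by blast
  have wdiv_le: "L2_norm S (wdiv S \<tau>) \<le> 2 * C * nrm energy_inner \<tau>" if "\<tau> \<in> div_grad_space" for \<tau>
  proof -
    have "C * (L2_norm S \<tau> + L2_norm S (wgrad S (wdiv S \<tau>))) \<le> C * (2 * nrm energy_inner \<tau>)"
      using L2_norm_le_energy[OF that] C(1) by (intro mult_left_mono) auto
    then show ?thesis using C(2)[OF div_grad_spaceD[OF that]] by simp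
  qed
  show ?thesis unfolding E.complete_space_def
  proof (intro allI impI)
    fix X assume "E.Cauchy_seq X"
    then have X: "\<And>n. X n \<in> div_grad_space"
      and cau: "\<And>e. e > 0 \<Longrightarrow> \<exists>N. \<forall>m\<ge>N. \<forall>n\<ge>N. nrm energy_inner (\<lambda>x. X m x - X n x) < e"
      by (auto simp: E.Cauchy_seq_def)
    note XD = div_grad_spaceD[OF X] and XL = div_grad_space_L2[OF X]
    note D = div_grad_space_diff(1)[OF X X]
    have grad_eq: "L2_norm S (\<lambda>x. wgrad S (wdiv S (X m)) x - wgrad S (wdiv S (X n)) x) =
        L2_norm S (wgrad S (wdiv S (\<lambda>x. X m x - X n x)))" for m n
      by (rule L2_norm_cong[OF ae_eq_sym[OF div_grad_space_diff(2)[OF X X]] L2_diff[OF XL(3) XL(3)] div_grad_space_L2(3)[OF D]])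
    have div_eq: "L2_norm S (\<lambda>x. wdiv S (X m) x - wdiv S (X n) x) = L2_norm S (wdiv S (\<lambda>x. X m x - X n x))" for m n
      by (rule L2_norm_cong[OF ae_eq_sym[OF wdiv_diff[OF XD(1) XD(1)]] L2_diff[OF XL(2) XL(2)] div_grad_space_L2(2)[OF D]])
    obtain u where u: "u \<in> L2 S" "(\<lambda>n. L2_norm S (\<lambda>x. X n x - u x)) \<longlonglongrightarrow> 0"
    proof (rule L2_Cauchy_limit[of X])
      show "\<exists>N. \<forall>m\<ge>N. \<forall>n\<ge>N. L2_norm S (\<lambda>x. X m x - X n x) < e" if "e > 0" for e
        using cau[OF that] L2_norm_le_energy(1)[OF D] le_less_trans by blast
    qed (use XL in auto)
    obtain g where g: "g \<in> L2 S" "(\<lambda>n. L2_norm S (\<lambda>x. wgrad S (wdiv S (X n)) x - g x)) \<longlonglongrightarrow> 0"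
    proof (rule L2_Cauchy_limit[of "\<lambda>n. wgrad S (wdiv S (X n))"])
      show "\<exists>N. \<forall>m\<ge>N. \<forall>n\<ge>N. L2_norm S (\<lambda>x. wgrad S (wdiv S (X m)) x - wgrad S (wdiv S (X n)) x) < e" if "e > 0" for e
        unfolding grad_eq using cau[OF that] L2_norm_le_energy(2)[OF D] le_less_trans by blast
    qed (use XL in auto)
    obtain q where q: "q \<in> L2 S" "(\<lambda>n. L2_norm S (\<lambda>x. wdiv S (X n) x - q x)) \<longlonglongrightarrow> 0"
    proof (rule L2_Cauchy_limit[of "\<lambda>n. wdiv S (X n)"])
      fix e :: real assume "e > 0"
      then obtain N where N: "\<forall>m\<ge>N. \<forall>n\<ge>N. nrm energy_inner (\<lambda>x. X m x - X n x) < e / (2 * C)"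
        using cau[of "e / (2 * C)"] C(1) by auto
      have "L2_norm S (wdiv S (\<lambda>x. X m x - X n x)) < e" if "m \<ge> N" "n \<ge> N" for m n
      proof -
        have "nrm energy_inner (\<lambda>x. X m x - X n x) < e / (2 * C)" using N that by blast
        then have "2 * C * nrm energy_inner (\<lambda>x. X m x - X n x) < e"
          using C(1) by (simp add: field_simps)
        then show ?thesis using wdiv_le[OF D, of m n] by simp
      qed
      then show "\<exists>N. \<forall>m\<ge>N. \<forall>n\<ge>N. L2_norm S (\<lambda>x. wdiv S (X m) x - wdiv S (X n) x) < e"
        unfolding div_eq by blast
    qed (use XL in auto)
    have weak_div: "is_weak_div S u q" by (rule is_weak_div_limit[OF XD(1) u q])
    have weak_grad: "is_weak_grad S q g" by (rule is_weak_grad_limit[OF XD(2) q g])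
    note uY = div_grad_cong[OF Hdiv_I[OF u(1) weak_div] wdiv_eqI[OF u(1) weak_div] H1_I[OF q(1) weak_grad]]
    have ug: "ae_eq S (wgrad S (wdiv S u)) g"
      by (rule ae_eq_trans[OF uY(2) wgrad_eqI[OF q(1) weak_grad]])
    note Du = div_grad_space_diff[OF X uY(1)]
    have le: "nrm energy_inner (\<lambda>x. X n x - u x) \<le>
        L2_norm S (\<lambda>x. X n x - u x) + L2_norm S (\<lambda>x. wgrad S (wdiv S (X n)) x - g x)" for n
    proof -
      have "ae_eq S (wgrad S (wdiv S (\<lambda>x. X n x - u x))) (\<lambda>x. wgrad S (wdiv S (X n)) x - g x)"
        by (rule ae_eq_trans[OF Du(2) ae_eq_diff[OF ae_eq_refl ug]])
      then have "L2_norm S (wgrad S (wdiv S (\<lambda>x. X n x - u x))) = L2_norm S (\<lambda>x. wgrad S (wdiv S (X n)) x - g x)"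
        by (rule L2_norm_cong[OF _ div_grad_space_L2(3)[OF Du(1)] L2_diff[OF XL(3) g(1)]])
      then show ?thesis using energy_le[OF Du(1), of n] by simp
    qed
    have "(\<lambda>n. L2_norm S (\<lambda>x. X n x - u x) + L2_norm S (\<lambda>x. wgrad S (wdiv S (X n)) x - g x)) \<longlonglongrightarrow> 0"
      using tendsto_add[OF u(2) g(2)] by simp
    then have "(\<lambda>n. nrm energy_inner (\<lambda>x. X n x - u x)) \<longlonglongrightarrow> 0"
      by (rule Lim_null_comparison[rotated])
        (use le E.nrm_nonneg[OF Du(1)] in \<open>auto intro!: always_eventually\<close>)
    then show "\<exists>u\<in>div_grad_space. (\<lambda>n. nrm energy_inner (\<lambda>x. X n x - u x)) \<longlonglongrightarrow> 0"
      using uY(1) by blast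
  qed
qed

section \<open>The first-order system: existence, uniqueness and the boundary value problem\<close>

definition solves_system ::
  "('a \<Rightarrow> 'a) \<Rightarrow> ('a \<Rightarrow> 'a) \<Rightarrow> ('a \<Rightarrow> real) \<Rightarrow> ('a \<Rightarrow> 'a) \<Rightarrow> ('a \<Rightarrow> real) \<Rightarrow> bool" where
  "solves_system f u1 u2 u3 u4 \<longleftrightarrow> u1 \<in> Hdiv_0 S \<and> u2 \<in> H1_0 S \<and> u3 \<in> Hdiv S \<and> u4 \<in> H1 S \<and>
     ae_eq S (wdiv S u1) u2 \<and> ae_eq S (wgrad S u2) u3 \<and> ae_eq S (wdiv S u3) u4 \<and>
     ae_eq S (wgrad S u4) (\<lambda>x. f x - u1 x)"

lemma Hdiv_0_Hdiv: "\<tau> \<in> Hdiv_0 S \<Longrightarrow> \<tau> \<in> Hdiv S"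
  by (simp add: Hdiv_0_def)

lemma green_Hdiv_0:
  "\<tau> \<in> Hdiv_0 S \<Longrightarrow> v \<in> H1 S \<Longrightarrow> L2_inner S v (wdiv S \<tau>) = - L2_inner S (wgrad S v) \<tau>"
  unfolding Hdiv_0_def normal_trace_def by fastforce

text \<open>The field \<open>u3\<close> minimises \<open>\<parallel>\<tau>\<parallel>\<^sup>2 + \<parallel>grad div \<tau> - f\<parallel>\<^sup>2\<close>. The Euler-Lagrange equation is
  \<open>(u1, grad div \<tau>) = (u3, \<tau>)\<close> with \<open>u1 = f - grad div u3\<close>; solenoidal \<open>\<tau>\<close> give \<open>u3 = grad u2\<close>,
  and \<open>\<tau> = grad w\<close> with \<open>div \<tau> = q\<close> for arbitrary \<open>q \<in> H1\<close> gives \<open>div u1 = u2\<close> together with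
  the boundary condition.\<close>

theorem system_solvable:
  assumes lip: "lipschitz_boundary S"
  obtains C where "C > 0" "\<And>f. f \<in> L2 S \<Longrightarrow> \<exists>u1 u2 u3 u4. solves_system f u1 u2 u3 u4 \<and>
    L2_norm S u1 \<le> C * L2_norm S f \<and> L2_norm S u2 \<le> C * L2_norm S f \<and>
    L2_norm S u3 \<le> C * L2_norm S f \<and> L2_norm S u4 \<le> C * L2_norm S f \<and>
    L2_norm S (wgrad S u4) \<le> C * L2_norm S f"
proof -
  interpret E: pre_hilbert div_grad_space energy_inner by (rule pre_hilbert_energy)
  obtain C where C: "C > 0" "\<And>\<tau>. \<tau> \<in> Hdiv S \<Longrightarrow> wdiv S \<tau> \<in> H1 S \<Longrightarrow>
      L2_norm S (wdiv S \<tau>) \<le> C * (L2_norm S \<tau> + L2_norm S (wgrad S (wdiv S \<tau>)))"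
    using divergence_estimate[OF lip] by blast
  show thesis
  proof (rule that[of "2 * C + 2"])
    fix f :: "'a \<Rightarrow> 'a" assume f: "f \<in> L2 S"
    define b where "b = L2_norm S f"
    have b: "b \<ge> 0" unfolding b_def by (rule L2_norm_nonneg[OF f])
    let ?T = "\<lambda>\<tau>. wgrad S (wdiv S \<tau>)"
    obtain u3 where u3: "u3 \<in> div_grad_space" "\<And>\<tau>. \<tau> \<in> div_grad_space \<Longrightarrow> energy_inner u3 \<tau> = L2_inner S f (?T \<tau>)"
    proof (rule E.riesz[of "\<lambda>\<tau>. L2_inner S f (?T \<tau>)" b])
      show "E.complete_space" by (rule energy_complete[OF lip])
      fix u v c assume u: "u \<in> div_grad_space"
      note uL = div_grad_space_L2[OF u]
      have "L2_inner S f (?T (\<lambda>x. c *\<^sub>R u x)) = L2_inner S f (\<lambda>x. c *\<^sub>R ?T u x)"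
        by (rule L2_inner_cong[OF ae_eq_refl div_grad_space_scale(2)[OF u] f f
            div_grad_space_L2(3)[OF div_grad_space_scale(1)[OF u]] L2_scale[OF uL(3)]])
      then show "L2_inner S f (?T (\<lambda>x. c *\<^sub>R u x)) = c * L2_inner S f (?T u)"
        by (simp add: L2_inner_scale2)
      have "\<bar>L2_inner S f (?T u)\<bar> \<le> b * L2_norm S (?T u)" unfolding b_def by (rule L2_cs[OF f uL(3)])
      also have "\<dots> \<le> b * nrm energy_inner u" using L2_norm_le_energy(2)[OF u] b by (rule mult_left_mono)
      finally show "\<bar>L2_inner S f (?T u)\<bar> \<le> b * nrm energy_inner u" .
      assume v: "v \<in> div_grad_space"
      note vL = div_grad_space_L2[OF v]
      have "L2_inner S f (?T (\<lambda>x. u x + v x)) = L2_inner S f (\<lambda>x. ?T u x + ?T v x)"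
        by (rule L2_inner_cong[OF ae_eq_refl div_grad_space_add(2)[OF u v] f f
            div_grad_space_L2(3)[OF div_grad_space_add(1)[OF u v]] L2_add[OF uL(3) vL(3)]])
      then show "L2_inner S f (?T (\<lambda>x. u x + v x)) = L2_inner S f (?T u) + L2_inner S f (?T v)"
        by (simp add: L2_inner_add2[OF uL(3) vL(3) f])
    qed (rule that)
    note u3D = div_grad_spaceD[OF u3(1)] and u3L = div_grad_space_L2[OF u3(1)]
    define u4 where "u4 = wdiv S u3"
    define u1 where "u1 = (\<lambda>x. f x - ?T u3 x)"
    have u1L: "u1 \<in> L2 S" unfolding u1_def by (rule L2_diff[OF f u3L(3)])
    have key: "L2_inner S u1 (?T \<tau>) = L2_inner S u3 \<tau>" if "\<tau> \<in> div_grad_space" for \<tau>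
      using u3(2)[OF that] L2_inner_diff[OF f u3L(3) div_grad_space_L2(3)[OF that]]
      by (simp add: u1_def energy_inner_def)
    obtain u2 where u2: "u2 \<in> H1_0 S" "is_weak_div S (\<lambda>x. u3 x - wgrad S u2 x) (\<lambda>x. 0)"
      using helmholtz_decomposition[OF u3L(1)] by blast
    note u2H = H1_0_H1[OF u2(1)]
    note gL = wgrad_L2[OF u2H]
    define \<sigma> where "\<sigma> = (\<lambda>x. u3 x - wgrad S u2 x)"
    have \<sigma>L: "\<sigma> \<in> L2 S" unfolding \<sigma>_def by (rule L2_diff[OF u3L(1) gL])
    have \<sigma>H: "\<sigma> \<in> Hdiv S" "ae_eq S (wdiv S \<sigma>) (\<lambda>x. 0)"
      using Hdiv_I[OF \<sigma>L] wdiv_eqI[OF \<sigma>L] u2(2) by (auto simp: \<sigma>_def)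
    \<comment> \<open>The solenoidal remainder \<sigma> is orthogonal to \<open>u3\<close> by the
      Euler-Lagrange equation and to \<open>grad u2\<close> by Green's formula, hence to
      itself.\<close>
    have "ae_eq S u3 (wgrad S u2)"
    proof -
      have z: "is_weak_grad S (\<lambda>x. 0) (\<lambda>x. 0)" by (simp add: is_weak_grad_def)
      note \<sigma>Y = div_grad_cong[OF \<sigma>H G.zero]
      have "L2_inner S u1 (?T \<sigma>) = L2_inner S u1 (\<lambda>x. 0)"
        by (rule L2_inner_cong[OF ae_eq_refl ae_eq_trans[OF \<sigma>Y(2) wgrad_eqI[OF L2_zero z]] u1L u1L
            div_grad_space_L2(3)[OF \<sigma>Y(1)] L2_zero])
      then have "L2_inner S u3 \<sigma> = 0" using key[OF \<sigma>Y(1)] by simp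
      moreover have "L2_inner S (wgrad S u2) \<sigma> = - L2_inner S u2 (wdiv S \<sigma>)"
        using green_H1_0[OF u2(1) \<sigma>H(1)] by simp
      moreover have "L2_inner S u2 (wdiv S \<sigma>) = L2_inner S u2 (\<lambda>x. 0)"
        by (rule L2_inner_cong[OF ae_eq_refl \<sigma>H(2) H1_L2[OF u2H] H1_L2[OF u2H] wdiv_L2[OF \<sigma>H(1)] L2_zero])
      ultimately have "L2_inner S \<sigma> \<sigma> = 0"
        using L2_inner_diff[OF u3L(1) gL \<sigma>L] by (simp add: \<sigma>_def)
      then have "L2_norm S (\<lambda>x. u3 x - wgrad S u2 x) = 0" by (simp add: L2_norm_def \<sigma>_def)
      then show ?thesis using L2_norm_diff_0_iff[OF u3L(1) gL] by simp
    qed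
    then have u23: "ae_eq S (wgrad S u2) u3" by (rule ae_eq_sym)
    have green: "L2_inner S u1 (wgrad S q) = - L2_inner S u2 q" if q: "q \<in> H1 S" for q
    proof -
      obtain w where w: "w \<in> H1_0 S" "is_weak_div S (wgrad S w) q" using div_surjective[OF H1_L2[OF q]] by blast
      note wL = wgrad_L2[OF H1_0_H1[OF w(1)]]
      note wY = div_grad_cong[OF Hdiv_I[OF wL w(2)] wdiv_eqI[OF wL w(2)] q]
      have "L2_inner S u1 (wgrad S q) = L2_inner S u1 (?T (wgrad S w))"
        by (rule L2_inner_cong[OF ae_eq_refl ae_eq_sym[OF wY(2)] u1L u1L wgrad_L2[OF q] div_grad_space_L2(3)[OF wY(1)]])
      also have "\<dots> = L2_inner S u3 (wgrad S w)" by (rule key[OF wY(1)])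
      also have "\<dots> = L2_inner S (wgrad S u2) (wgrad S w)"
        by (rule L2_inner_cong[OF ae_eq_sym[OF u23] ae_eq_refl u3L(1) gL wL wL])
      also have "\<dots> = - L2_inner S u2 (wdiv S (wgrad S w))"
        using green_H1_0[OF u2(1) Hdiv_I[OF wL w(2)]] by simp
      also have "L2_inner S u2 (wdiv S (wgrad S w)) = L2_inner S u2 q"
        by (rule L2_inner_cong[OF ae_eq_refl wdiv_eqI[OF wL w(2)] H1_L2[OF u2H] H1_L2[OF u2H]
            wdiv_L2[OF Hdiv_I[OF wL w(2)]] H1_L2[OF q]])
      finally show ?thesis .
    qed
    have weak1: "is_weak_div S u1 u2"
      by (rule weak_div_from_H1_0[OF u1L H1_L2[OF u2H] green[OF H1_0_H1]])
    have u1H: "u1 \<in> Hdiv S" "ae_eq S (wdiv S u1) u2"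
      by (rule Hdiv_I[OF u1L weak1]) (rule wdiv_eqI[OF u1L weak1])
    have u10: "u1 \<in> Hdiv_0 S"
      unfolding Hdiv_0_def normal_trace_def
    proof (intro CollectI conjI ballI u1H(1))
      fix v assume v: "v \<in> H1 S"
      have "L2_inner S v (wdiv S u1) = L2_inner S v u2"
        by (rule L2_inner_cong[OF ae_eq_refl u1H(2) H1_L2[OF v] H1_L2[OF v] wdiv_L2[OF u1H(1)] H1_L2[OF u2H]])
      then show "L2_inner S v (wdiv S u1) + L2_inner S (wgrad S v) u1 = 0"
        using green[OF v] by (simp add: L2_inner_commute)
    qed
    have sys: "solves_system f u1 u2 u3 u4"
      unfolding solves_system_def u4_def using u10 u2(1) u3D u1H(2) u23 by (auto simp: u1_def)
    \<comment> \<open>The Euler-Lagrange equation tested with \<open>u3\<close> itself.\<close>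
    have energy: "(L2_norm S u3)\<^sup>2 + (L2_norm S (?T u3))\<^sup>2 \<le> b * L2_norm S (?T u3)"
      using u3(2)[OF u3(1)] L2_cs[OF f u3L(3)]
      unfolding energy_inner_def L2_norm_sq[OF u3L(1)] L2_norm_sq[OF u3L(3)] b_def by linarith
    have n4: "L2_norm S (?T u3) \<le> b"
    proof (rule ccontr)
      assume "\<not> L2_norm S (?T u3) \<le> b"
      then have "b * L2_norm S (?T u3) < L2_norm S (?T u3) * L2_norm S (?T u3)"
        using b by (intro mult_strict_right_mono) auto
      then show False using energy by (simp add: power2_eq_square) (smt (verit) zero_le_square)
    qed
    have n3: "L2_norm S u3 \<le> b"
    proof (rule power2_le_imp_le[OF _ b])
      have "b * L2_norm S (?T u3) \<le> b * b" using n4 b by (rule mult_left_mono)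
      then show "(L2_norm S u3)\<^sup>2 \<le> b\<^sup>2"
        using energy zero_le_power2[of "L2_norm S (?T u3)"] unfolding power2_eq_square[of b] by linarith
    qed
    have n1: "L2_norm S u1 \<le> 2 * b"
    proof -
      have "L2_norm S u1 \<le> L2_norm S f + L2_norm S (\<lambda>x. (-1) *\<^sub>R ?T u3 x)"
        using L2_norm_add[OF f L2_scale[OF u3L(3), of "-1"]] by (simp add: u1_def)
      then show ?thesis using n4 unfolding L2_norm_scale b_def[symmetric] by simp
    qed
    \<comment> \<open>Green's identity with \<open>q = u2\<close> gives
      \<open>\<parallel>u2\<parallel>^2 = - (u1, u3)\<close>, so no Poincare constant
      enters.\<close>
    have n2: "L2_norm S u2 \<le> 2 * b"
    proof (rule power2_le_imp_le)
      have "L2_inner S u1 (wgrad S u2) = L2_inner S u1 u3"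
        by (rule L2_inner_cong[OF ae_eq_refl u23 u1L u1L gL u3L(1)])
      then have "(L2_norm S u2)\<^sup>2 \<le> L2_norm S u1 * L2_norm S u3"
        using green[OF u2H] L2_cs[OF u1L u3L(1)] unfolding L2_norm_sq[OF H1_L2[OF u2H]] by linarith
      also have "\<dots> \<le> (2 * b) * b"
        using n1 n3 b by (intro mult_mono L2_norm_nonneg u3L(1)) auto
      also have "\<dots> \<le> (2 * b)\<^sup>2" using b by (simp add: power2_eq_square)
      finally show "(L2_norm S u2)\<^sup>2 \<le> (2 * b)\<^sup>2" .
    qed (use b in simp)
    have n5: "L2_norm S u4 \<le> 2 * C * b"
    proof -
      have "C * (L2_norm S u3 + L2_norm S (?T u3)) \<le> C * (2 * b)"
        using n3 n4 C(1) by (intro mult_left_mono) auto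
      then show ?thesis using C(2)[OF u3D] by (simp add: u4_def)
    qed
    \<comment> \<open>One constant dominating the factors 1, 2 and \<open>2 * C\<close> of the
      separate bounds.\<close>
    have "2 * b \<le> (2 * C + 2) * b" "b \<le> (2 * C + 2) * b" "2 * C * b \<le> (2 * C + 2) * b"
      using b C(1) by (simp_all add: algebra_simps)
    then have "L2_norm S u1 \<le> (2 * C + 2) * b" "L2_norm S u2 \<le> (2 * C + 2) * b"
      "L2_norm S u3 \<le> (2 * C + 2) * b" "L2_norm S u4 \<le> (2 * C + 2) * b" "L2_norm S (wgrad S u4) \<le> (2 * C + 2) * b"
      using n1 n2 n3 n4 n5 unfolding u4_def by linarith+
    with sys show "\<exists>u1 u2 u3 u4. solves_system f u1 u2 u3 u4 \<and>
      L2_norm S u1 \<le> (2 * C + 2) * L2_norm S f \<and> L2_norm S u2 \<le> (2 * C + 2) * L2_norm S f \<and>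
      L2_norm S u3 \<le> (2 * C + 2) * L2_norm S f \<and> L2_norm S u4 \<le> (2 * C + 2) * L2_norm S f \<and>
      L2_norm S (wgrad S u4) \<le> (2 * C + 2) * L2_norm S f"
      unfolding b_def by blast
  qed (use C in simp)
qed

lemma Hdiv_0_diff:
  assumes "u \<in> Hdiv_0 S" "v \<in> Hdiv_0 S"
  shows "(\<lambda>x. u x - v x) \<in> Hdiv_0 S"
  unfolding Hdiv_0_def normal_trace_def
proof (intro CollectI conjI ballI)
  note H = Hdiv_0_Hdiv[OF assms(1)] Hdiv_0_Hdiv[OF assms(2)]
  show D: "(\<lambda>x. u x - v x) \<in> Hdiv S" by (rule Hdiv_diff[OF H])
  fix w assume w: "w \<in> H1 S"
  note wL = H1_L2[OF w] wgrad_L2[OF w]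
  have "L2_inner S w (wdiv S (\<lambda>x. u x - v x)) = L2_inner S w (\<lambda>x. wdiv S u x - wdiv S v x)"
    by (rule L2_inner_cong[OF ae_eq_refl wdiv_diff[OF H] wL(1) wL(1) wdiv_L2[OF D] L2_diff[OF wdiv_L2[OF H(1)] wdiv_L2[OF H(2)]]])
  then show "L2_inner S w (wdiv S (\<lambda>x. u x - v x)) + L2_inner S (wgrad S w) (\<lambda>x. u x - v x) = 0"
    using green_Hdiv_0[OF assms(1) w] green_Hdiv_0[OF assms(2) w]
    by (simp add: L2_inner_diff2 wL H Hdiv_L2 wdiv_L2)
qed

lemma solves_system_L2:
  assumes "solves_system f u1 u2 u3 u4"
  shows "u1 \<in> L2 S" "u2 \<in> L2 S" "u3 \<in> L2 S" "u4 \<in> L2 S"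
  using assms unfolding solves_system_def by (auto intro: Hdiv_L2 H1_L2 Hdiv_0_Hdiv H1_0_H1)

text \<open>Pairing \<open>u1 = - grad u4\<close> with \<open>u1\<close> and passing through the
  other equations gives \<open>\<parallel>u1\<parallel>^2 = - \<parallel>u3\<parallel>^2\<close>.
  The boundary terms vanish through \<open>u1 \<in> Hdiv_0\<close> and \<open>u2 \<in> H1_0\<close>;
  afterwards \<open>u2\<close> and \<open>u4\<close> vanish as divergences of null fields.\<close>

lemma system_homogeneous:
  assumes sys: "solves_system (\<lambda>x. 0) u1 u2 u3 u4"
  shows "ae_eq S u1 (\<lambda>x. 0)" "ae_eq S u2 (\<lambda>x. 0)" "ae_eq S u3 (\<lambda>x. 0)" "ae_eq S u4 (\<lambda>x. 0)"
proof -
  note L = solves_system_L2[OF sys]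
  have u1: "u1 \<in> Hdiv_0 S" and u2: "u2 \<in> H1_0 S" and u3: "u3 \<in> Hdiv S" and u4: "u4 \<in> H1 S"
    and eq: "ae_eq S (wdiv S u1) u2" "ae_eq S (wgrad S u2) u3" "ae_eq S (wdiv S u3) u4"
      "ae_eq S (wgrad S u4) (\<lambda>x. (-1) *\<^sub>R u1 x)"
    using sys by (auto simp: solves_system_def)
  note u1H = Hdiv_0_Hdiv[OF u1] and u2H = H1_0_H1[OF u2]
  have "L2_inner S u1 u1 = - L2_inner S (\<lambda>x. (-1) *\<^sub>R u1 x) u1" unfolding L2_inner_scale by simp
  also have "\<dots> = - L2_inner S (wgrad S u4) u1"
    using L2_inner_cong[OF eq(4) ae_eq_refl wgrad_L2[OF u4] L2_scale[OF L(1)] L(1) L(1)] by simp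
  also have "\<dots> = L2_inner S u4 (wdiv S u1)" using green_Hdiv_0[OF u1 u4] by simp
  also have "\<dots> = L2_inner S u4 u2"
    by (rule L2_inner_cong[OF ae_eq_refl eq(1) L(4) L(4) wdiv_L2[OF u1H] L(2)])
  also have "\<dots> = L2_inner S u2 u4" by (rule L2_inner_commute)
  also have "\<dots> = L2_inner S u2 (wdiv S u3)"
    by (rule L2_inner_cong[OF ae_eq_refl ae_eq_sym[OF eq(3)] L(2) L(2) L(4) wdiv_L2[OF u3]])
  also have "\<dots> = - L2_inner S (wgrad S u2) u3" by (rule green_H1_0[OF u2 u3])
  also have "L2_inner S (wgrad S u2) u3 = L2_inner S u3 u3"
    by (rule L2_inner_cong[OF eq(2) ae_eq_refl wgrad_L2[OF u2H] L(3) L(3) L(3)])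
  finally have "L2_inner S u1 u1 = 0" "L2_inner S u3 u3 = 0"
    using L2_inner_nonneg[OF L(1)] L2_inner_nonneg[OF L(3)] by linarith+
  then show z: "ae_eq S u1 (\<lambda>x. 0)" "ae_eq S u3 (\<lambda>x. 0)"
    using L2_norm_eq_0_iff[OF L(1)] L2_norm_eq_0_iff[OF L(3)] by (simp_all add: L2_norm_def)
  have w0: "is_weak_div S (\<lambda>x. 0) (\<lambda>x. 0)" by (simp add: is_weak_div_def)
  have "ae_eq S (wdiv S \<tau>) (\<lambda>x. 0)" if "\<tau> \<in> Hdiv S" "ae_eq S \<tau> (\<lambda>x. 0)" for \<tau>
    using Hdiv_cong(2)[OF that L2_zero] wdiv_eqI[OF L2_zero w0] ae_eq_sym ae_eq_trans by blast
  then show "ae_eq S u2 (\<lambda>x. 0)" "ae_eq S u4 (\<lambda>x. 0)"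
    using z u1H u3 eq(1,3) ae_eq_sym ae_eq_trans by blast+
qed

lemma system_unique:
  assumes u: "solves_system f u1 u2 u3 u4" and w: "solves_system f w1 w2 w3 w4"
  shows "ae_eq S u1 w1" "ae_eq S u2 w2" "ae_eq S u3 w3" "ae_eq S u4 w4"
proof -
  interpret Z: pre_hilbert "H1_0 S" H1_inner by (rule pre_hilbert_H1_0)
  have U: "u1 \<in> Hdiv_0 S" "u2 \<in> H1_0 S" "u3 \<in> Hdiv S" "u4 \<in> H1 S"
    "ae_eq S (wdiv S u1) u2" "ae_eq S (wgrad S u2) u3" "ae_eq S (wdiv S u3) u4"
    "ae_eq S (wgrad S u4) (\<lambda>x. f x - u1 x)" using u by (auto simp: solves_system_def)
  have W: "w1 \<in> Hdiv_0 S" "w2 \<in> H1_0 S" "w3 \<in> Hdiv S" "w4 \<in> H1 S"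
    "ae_eq S (wdiv S w1) w2" "ae_eq S (wgrad S w2) w3" "ae_eq S (wdiv S w3) w4"
    "ae_eq S (wgrad S w4) (\<lambda>x. f x - w1 x)" using w by (auto simp: solves_system_def)
  have "ae_eq S (wgrad S (\<lambda>x. u4 x - w4 x)) (\<lambda>x. (f x - u1 x) - (f x - w1 x))"
    by (rule ae_eq_trans[OF wgrad_diff[OF U(4) W(4)] ae_eq_diff[OF U(8) W(8)]])
  then have "ae_eq S (wgrad S (\<lambda>x. u4 x - w4 x)) (\<lambda>x. 0 - (u1 x - w1 x))" by simp
  moreover note
    ae_eq_trans[OF wdiv_diff[OF Hdiv_0_Hdiv[OF U(1)] Hdiv_0_Hdiv[OF W(1)]] ae_eq_diff[OF U(5) W(5)]]
    ae_eq_trans[OF wgrad_diff[OF H1_0_H1[OF U(2)] H1_0_H1[OF W(2)]] ae_eq_diff[OF U(6) W(6)]]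
    ae_eq_trans[OF wdiv_diff[OF U(3) W(3)] ae_eq_diff[OF U(7) W(7)]]
  ultimately have "solves_system (\<lambda>x. 0) (\<lambda>x. u1 x - w1 x) (\<lambda>x. u2 x - w2 x) (\<lambda>x. u3 x - w3 x) (\<lambda>x. u4 x - w4 x)"
    unfolding solves_system_def
    by (intro conjI Hdiv_0_diff Z.diff Hdiv_diff H1_diff U(1-4) W(1-4))
  from system_homogeneous[OF this]
  show "ae_eq S u1 w1" "ae_eq S u2 w2" "ae_eq S u3 w3" "ae_eq S u4 w4"
    by (simp_all add: ae_eq_def)
qed

text \<open>The boundary value problem speaks of \<open>wdiv S u1\<close>, which agrees with
  \<open>u2 \<in> H1_0\<close> only almost everywhere.\<close>

lemma H1_0_cong:
  assumes v: "v \<in> H1_0 S" and eq: "ae_eq S v w" and w: "w \<in> L2 S"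
  shows "w \<in> H1_0 S"
proof -
  note vH = H1_0_H1[OF v] and wH = H1_cong(1)[OF H1_0_H1[OF v] eq w]
  have "H1_norm S (\<lambda>x. w x - \<phi> x) = H1_norm S (\<lambda>x. v x - \<phi> x)" if \<phi>: "\<phi> \<in> test_fun S" for \<phi>
  proof -
    note D = H1_diff[OF vH test_H1[OF \<phi>]] H1_diff[OF wH test_H1[OF \<phi>]]
    have "ae_eq S (\<lambda>x. v x - \<phi> x) (\<lambda>x. w x - \<phi> x)" by (rule ae_eq_diff[OF eq ae_eq_refl])
    from L2_norm_cong[OF this H1_L2[OF D(1)] H1_L2[OF D(2)]]
      L2_norm_cong[OF H1_cong(2)[OF D(1) this H1_L2[OF D(2)]] wgrad_L2[OF D(2)] wgrad_L2[OF D(1)]]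
    show ?thesis by (simp add: H1_norm_def)
  qed
  then show ?thesis using v wH by (auto simp: H1_0_def)
qed

text \<open>Each of the four equations takes one derivative off the test field; the intermediate
  derivatives of \<phi> are again test functions.\<close>

lemma system_solves_bvp:
  assumes sys: "solves_system f u1 u2 u3 u4" and f: "f \<in> L2 S"
  shows "solves_bvp S f u1"
proof -
  note L = solves_system_L2[OF sys]
  have u1: "u1 \<in> Hdiv_0 S" and u2: "u2 \<in> H1_0 S" and u3: "u3 \<in> Hdiv S" and u4: "u4 \<in> H1 S"
    and eq: "ae_eq S (wdiv S u1) u2" "ae_eq S (wgrad S u2) u3" "ae_eq S (wdiv S u3) u4"
      "ae_eq S (wgrad S u4) (\<lambda>x. f x - u1 x)"
    using sys by (auto simp: solves_system_def)
  note u1H = Hdiv_0_Hdiv[OF u1] and u2H = H1_0_H1[OF u2]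
  have div0: "wdiv S u1 \<in> H1_0 S"
    by (rule H1_0_cong[OF u2 ae_eq_sym[OF eq(1)] wdiv_L2[OF u1H]])
  have weak: "L2_inner S u1 (cgrad_div (cgrad_div \<phi>)) + L2_inner S u1 \<phi> = L2_inner S f \<phi>"
    if \<phi>: "\<phi> \<in> test_fun S" for \<phi>
  proof -
    have d1: "cdiv \<phi> \<in> test_fun S" by (rule test_fun_cdiv[OF \<phi>])
    have g1: "cgrad_div \<phi> \<in> test_fun S" by (rule test_fun_cgrad[OF d1])
    have d2: "cdiv (cgrad_div \<phi>) \<in> test_fun S" by (rule test_fun_cdiv[OF g1])
    note T = test_L2[OF \<phi>] test_L2[OF d1] test_L2[OF g1] test_L2[OF d2]
    have "L2_inner S u1 (cgrad_div (cgrad_div \<phi>)) = - L2_inner S (wdiv S u1) (cdiv (cgrad_div \<phi>))"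
      using wdiv_test[OF u1H d2] by simp
    also have "L2_inner S (wdiv S u1) (cdiv (cgrad_div \<phi>)) = L2_inner S u2 (cdiv (cgrad_div \<phi>))"
      by (rule L2_inner_cong[OF eq(1) ae_eq_refl wdiv_L2[OF u1H] L(2) T(4) T(4)])
    also have "\<dots> = - L2_inner S (wgrad S u2) (cgrad_div \<phi>)"
      using wgrad_test[OF u2H g1] by simp
    also have "L2_inner S (wgrad S u2) (cgrad_div \<phi>) = L2_inner S u3 (cgrad_div \<phi>)"
      by (rule L2_inner_cong[OF eq(2) ae_eq_refl wgrad_L2[OF u2H] L(3) T(3) T(3)])
    also have "\<dots> = - L2_inner S (wdiv S u3) (cdiv \<phi>)"
      using wdiv_test[OF u3 d1] by simp
    also have "L2_inner S (wdiv S u3) (cdiv \<phi>) = L2_inner S u4 (cdiv \<phi>)"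
      by (rule L2_inner_cong[OF eq(3) ae_eq_refl wdiv_L2[OF u3] L(4) T(2) T(2)])
    also have "\<dots> = - L2_inner S (wgrad S u4) \<phi>"
      using wgrad_test[OF u4 \<phi>] by simp
    also have "L2_inner S (wgrad S u4) \<phi> = L2_inner S (\<lambda>x. f x - u1 x) \<phi>"
      by (rule L2_inner_cong[OF eq(4) ae_eq_refl wgrad_L2[OF u4] L2_diff[OF f L(1)] T(1) T(1)])
    also have "\<dots> = L2_inner S f \<phi> - L2_inner S u1 \<phi>" by (rule L2_inner_diff[OF f L(1) T(1)])
    finally show ?thesis by simp
  qed
  then show ?thesis
    unfolding solves_bvp_def using u1 u1H div0 H1_0_H1[OF div0] by blast
qed

end

section \<open>Meshes\<close>

text \<open>In a chart the frontier lies on the graph: points below it belong to the open set, and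
  points above it have a neighbourhood that misses the set.\<close>

lemma lipschitz_frontier_negligible:
  fixes S :: "'a::euclidean_space set"
  assumes lip: "lipschitz_boundary S" and S: "open S"
  shows "negligible (frontier S)"
  unfolding locally_negligible_alt[of "frontier S"]
proof
  fix p assume p: "p \<in> frontier S"
  obtain U e G where U: "open U" "p \<in> U" and G: "continuous_on UNIV G"
    and SU: "S \<inter> U = {x \<in> U. x \<bullet> e < G x}" and neg: "negligible {x. x \<bullet> e = G x}"
    using lipschitz_chart[OF lip p] by (elim exE conjE) (rule that)
  have "frontier S \<inter> U \<subseteq> {x. x \<bullet> e = G x}"
  proof
    fix x assume x: "x \<in> frontier S \<inter> U"
    then have "x \<notin> S" "x \<in> closure S" using S by (auto simp: frontier_def interior_open)
    then have "\<not> x \<bullet> e < G x" using SU x by auto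
    moreover have "\<not> G x < x \<bullet> e"
    proof
      assume less: "G x < x \<bullet> e"
      have "open (U \<inter> {y. G y < y \<bullet> e})"
        using U(1) G by (intro open_Int open_Collect_less continuous_intros) auto
      moreover have "x \<in> U \<inter> {y. G y < y \<bullet> e}" using x less by auto
      ultimately have "(U \<inter> {y. G y < y \<bullet> e}) \<inter> S \<noteq> {}"
        using \<open>x \<in> closure S\<close> open_Int_closure_eq_empty by blast
      then show False using SU by force
    qed
    ultimately show "x \<in> {x. x \<bullet> e = G x}" by simp
  qed
  then have "negligible (frontier S \<inter> U)" using neg negligible_subset by blast
  then show "\<exists>U. openin (top_of_set (frontier S)) U \<and> p \<in> U \<and> negligible U"
    using U p by (intro exI[of _ "frontier S \<inter> U"]) (auto simp: openin_open)
qed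

text \<open>A test field of \<open>T\<close> is one of \<open>S\<close>, and integrals against it
  over \<open>S\<close> and over \<open>T\<close> coincide.\<close>

lemma (in bounded_open) H1_restrict:
  assumes T: "open T" "T \<subseteq> S" and v: "v \<in> H1 S"
  shows "v \<in> H1 T" "ae_eq T (wgrad T v) (wgrad S v)"
proof -
  interpret T: bounded_open T using T bounded_S bounded_subset by unfold_locales auto
  have R: "v \<in> L2 T" "wgrad S v \<in> L2 T"
    using L2_restrict[OF T(2) T.S_sets S_sets] H1_L2[OF v] wgrad_L2[OF v] by auto
  have "is_weak_grad T v (wgrad S v)"
    unfolding is_weak_grad_def
  proof (intro conjI R(2) ballI)
    fix \<phi> :: "'a \<Rightarrow> 'a" assume \<phi>: "\<phi> \<in> test_fun T"
    have "L2_inner T (wgrad S v) \<phi> = L2_inner S (wgrad S v) \<phi>"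
      by (rule L2_inner_support[OF T(2) T.S_sets S_sets test_fun_zero_outside[OF \<phi>], symmetric])
    moreover have "L2_inner T v (cdiv \<phi>) = L2_inner S v (cdiv \<phi>)"
      by (rule L2_inner_support[OF T(2) T.S_sets S_sets test_fun_zero_outside[OF test_fun_cdiv[OF \<phi>]], symmetric])
    ultimately show "L2_inner T (wgrad S v) \<phi> = - L2_inner T v (cdiv \<phi>)"
      using wgrad_test[OF v test_fun_mono[OF \<phi> T(2)]] by simp
  qed
  then show "v \<in> H1 T" "ae_eq T (wgrad T v) (wgrad S v)"
    by (rule T.H1_I[OF R(1)], rule T.wgrad_eqI[OF R(1)])
qed

lemma (in bounded_open) Hdiv_restrict:
  assumes T: "open T" "T \<subseteq> S" and v: "v \<in> Hdiv S"
  shows "v \<in> Hdiv T" "ae_eq T (wdiv T v) (wdiv S v)"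
proof -
  interpret T: bounded_open T using T bounded_S bounded_subset by unfold_locales auto
  have R: "v \<in> L2 T" "wdiv S v \<in> L2 T"
    using L2_restrict[OF T(2) T.S_sets S_sets] Hdiv_L2[OF v] wdiv_L2[OF v] by auto
  have "is_weak_div T v (wdiv S v)"
    unfolding is_weak_div_def
  proof (intro conjI R(2) ballI)
    fix \<phi> :: "'a \<Rightarrow> real" assume \<phi>: "\<phi> \<in> test_fun T"
    have "L2_inner T (wdiv S v) \<phi> = L2_inner S (wdiv S v) \<phi>"
      by (rule L2_inner_support[OF T(2) T.S_sets S_sets test_fun_zero_outside[OF \<phi>], symmetric])
    moreover have "L2_inner T v (cgrad \<phi>) = L2_inner S v (cgrad \<phi>)"
      by (rule L2_inner_support[OF T(2) T.S_sets S_sets test_fun_zero_outside[OF test_fun_cgrad[OF \<phi>]], symmetric])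
    ultimately show "L2_inner T (wdiv S v) \<phi> = - L2_inner T v (cgrad \<phi>)"
      using wdiv_test[OF v test_fun_mono[OF \<phi> T(2)]] by simp
  qed
  then show "v \<in> Hdiv T" "ae_eq T (wdiv T v) (wdiv S v)"
    by (rule T.Hdiv_I[OF R(1)], rule T.wdiv_eqI[OF R(1)])
qed

text \<open>Not immediate, because the weak derivatives chosen for the zero function vanish only
  almost everywhere.\<close>

lemma (in bounded_open) normal_trace_zero:
  "\<tau> \<in> L2 S \<Longrightarrow> normal_trace S \<tau> (\<lambda>x. 0) = 0"
  "v \<in> L2 S \<Longrightarrow> normal_trace S (\<lambda>x. 0) v = 0"
proof -
  have g: "is_weak_grad S (\<lambda>x. 0) (\<lambda>x. 0)" and d: "is_weak_div S (\<lambda>x. 0) (\<lambda>x. 0)"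
    by (simp_all add: is_weak_grad_def is_weak_div_def)
  show "normal_trace S \<tau> (\<lambda>x. 0) = 0" if "\<tau> \<in> L2 S"
    using L2_inner_cong[OF wgrad_eqI[OF L2_zero g] ae_eq_refl wgrad_L2[OF H1_I[OF L2_zero g]] L2_zero that that]
    by (simp add: normal_trace_def)
  show "normal_trace S (\<lambda>x. 0) v = 0" if "v \<in> L2 S"
    using L2_inner_cong[OF ae_eq_refl wdiv_eqI[OF L2_zero d] that that wdiv_L2[OF Hdiv_I[OF L2_zero d]] L2_zero]
    by (simp add: normal_trace_def)
qed

section \<open>Additivity over the cells and traces on the skeleton\<close>

locale meshed = bounded_open +
  fixes Ts :: "'a set set"
  assumes mesh: "mesh S Ts"
begin

lemma cell: 
  assumes "T \<in> Ts"
  shows "bounded_open T" "open T" "T \<subseteq> S" "lipschitz_boundary T"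
  using assms mesh bounded_subset[OF bounded_S]
  by (auto simp: mesh_def lipschitz_domain_def bounded_open_def)

lemma finite_Ts: "finite Ts"
  using mesh by (simp add: mesh_def)

lemma L2_cell: "f \<in> L2 S \<Longrightarrow> T \<in> Ts \<Longrightarrow> f \<in> L2 T"
  using L2_restrict[OF cell(3) bounded_open.S_sets[OF cell(1)] S_sets] by blast

lemma ae_eq_cell: "ae_eq S f g \<Longrightarrow> T \<in> Ts \<Longrightarrow> ae_eq T f g"
  using ae_eq_restrict[OF cell(3) bounded_open.S_sets[OF cell(1)] S_sets] by blast

text \<open>The closures of the cells cover \<open>S\<close>, so a point outside all open cells lies
  on one of finitely many null frontiers.\<close>

lemma skeleton_negligible: "negligible (S - \<Union>Ts)"
proof (rule negligible_subset)
  show "negligible (\<Union>T\<in>Ts. frontier T)"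
    using finite_Ts lipschitz_frontier_negligible[OF cell(4) cell(2)] by (intro negligible_Union) auto
  show "S - \<Union>Ts \<subseteq> (\<Union>T\<in>Ts. frontier T)"
  proof
    fix x assume x: "x \<in> S - \<Union>Ts"
    then have "x \<in> closure S" using closure_subset by blast
    then obtain T where "T \<in> Ts" "x \<in> closure T" using mesh by (auto simp: mesh_def)
    then show "x \<in> (\<Union>T\<in>Ts. frontier T)"
      using x cell(2) by (auto simp: frontier_def interior_open)
  qed
qed

text \<open>Up to the null skeleton every point of \<open>S\<close> lies in exactly one
  cell.\<close>

lemma sum_cells:
  assumes f: "f \<in> L2 S" and g: "g \<in> L2 S"
  shows "(\<Sum>T\<in>Ts. L2_inner T f g) = L2_inner S f g"
proof -
  have Tl: "T \<in> sets lebesgue" if "T \<in> Ts" for T using cell(2)[OF that] by auto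
  have int: "integrable lebesgue (\<lambda>x. indicator T x *\<^sub>R (f x \<bullet> g x))" if "T \<in> Ts" for T
    using L2_integrable_inner[OF L2_cell[OF f that] L2_cell[OF g that]] Tl[OF that]
    by (subst (asm) integrable_restrict_space) auto
  have intS: "integrable lebesgue (\<lambda>x. indicator S x *\<^sub>R (f x \<bullet> g x))"
    using L2_integrable_inner[OF f g] S_sets by (subst (asm) integrable_restrict_space) auto
  have "(\<Sum>T\<in>Ts. L2_inner T f g) = (\<Sum>T\<in>Ts. LINT x|lebesgue. indicator T x *\<^sub>R (f x \<bullet> g x))"
    by (intro sum.cong refl L2_inner_indicator Tl)
  also have "\<dots> = (LINT x|lebesgue. (\<Sum>T\<in>Ts. indicator T x *\<^sub>R (f x \<bullet> g x)))"
    by (rule Bochner_Integration.integral_sum[OF int, symmetric])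
  also have "\<dots> = (LINT x|lebesgue. indicator S x *\<^sub>R (f x \<bullet> g x))"
  proof (rule integral_cong_AE)
    have "AE x in lebesgue. x \<notin> S - \<Union>Ts"
      using skeleton_negligible by (intro AE_not_in) (simp add: negligible_iff_null_sets)
    then show "AE x in lebesgue. (\<Sum>T\<in>Ts. indicator T x *\<^sub>R (f x \<bullet> g x)) = indicator S x *\<^sub>R (f x \<bullet> g x)"
    proof eventually_elim
      case (elim x)
      have "(\<Sum>T\<in>Ts. indicator T x) = (indicator (\<Union>T\<in>Ts. T) x :: real)"
        using finite_Ts mesh
        by (intro indicator_UN_disjoint[symmetric])
          (auto simp: disjoint_family_on_def mesh_def pairwise_def disjnt_def)
      also have "\<dots> = indicator S x"
        using elim cell(3) by (auto simp: indicator_def)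
      finally show ?case by (simp add: sum_distrib_right[symmetric])
    qed
  qed (use int intS in \<open>auto intro!: borel_measurable_sum\<close>)
  also have "\<dots> = L2_inner S f g" by (rule L2_inner_indicator[OF S_sets, symmetric])
  finally show ?thesis .
qed

text \<open>Green's formula on a cell with the global divergence: the chosen \<open>wdiv T u\<close>
  agrees with \<open>q\<close> almost everywhere on \<open>T\<close>.\<close>

lemma normal_trace_div:
  assumes u: "u \<in> Hdiv S" "ae_eq S (wdiv S u) q" and q: "q \<in> L2 S" and T: "T \<in> Ts" and v: "v \<in> H1 T"
  shows "normal_trace T u v = L2_inner T u (wgrad T v) + L2_inner T q v"
proof -
  interpret T: bounded_open T by (rule cell(1)[OF T])
  note R = Hdiv_restrict[OF cell(2,3)[OF T] u(1)]
  have "L2_inner T v (wdiv T u) = L2_inner T v q"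
    by (rule L2_inner_cong[OF ae_eq_refl ae_eq_trans[OF R(2) ae_eq_cell[OF u(2) T]]
        T.H1_L2[OF v] T.H1_L2[OF v] T.wdiv_L2[OF R(1)] L2_cell[OF q T]])
  then show ?thesis by (simp add: normal_trace_def L2_inner_commute)
qed

lemma normal_trace_grad:
  assumes u: "u \<in> H1 S" "ae_eq S (wgrad S u) g" and g: "g \<in> L2 S" and T: "T \<in> Ts" and \<sigma>: "\<sigma> \<in> Hdiv T"
  shows "normal_trace T \<sigma> u = L2_inner T u (wdiv T \<sigma>) + L2_inner T g \<sigma>"
proof -
  interpret T: bounded_open T by (rule cell(1)[OF T])
  note R = H1_restrict[OF cell(2,3)[OF T] u(1)]
  have "L2_inner T (wgrad T u) \<sigma> = L2_inner T g \<sigma>"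
    by (rule L2_inner_cong[OF ae_eq_trans[OF R(2) ae_eq_cell[OF u(2) T]] ae_eq_refl
        T.wgrad_L2[OF R(1)] L2_cell[OF g T] T.Hdiv_L2[OF \<sigma>] T.Hdiv_L2[OF \<sigma>]])
  then show ?thesis by (simp add: normal_trace_def)
qed

text \<open>When both arguments are conforming over \<open>S\<close>, the contributions of interior
  interfaces cancel; in the volume form of the trace this is just additivity of integrals.\<close>

lemma sum_normal_trace:
  assumes \<tau>: "\<tau> \<in> Hdiv S" and v: "v \<in> H1 S"
  shows "(\<Sum>T\<in>Ts. normal_trace T \<tau> v) = normal_trace S \<tau> v"
proof -
  have "normal_trace T \<tau> v = L2_inner T (wgrad S v) \<tau> + L2_inner T (wdiv S \<tau>) v" if T: "T \<in> Ts" for T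
  proof -
    interpret T: bounded_open T by (rule cell(1)[OF T])
    note Rv = H1_restrict[OF cell(2,3)[OF T] v] and R\<tau> = Hdiv_restrict[OF cell(2,3)[OF T] \<tau>]
    have "L2_inner T \<tau> (wgrad T v) = L2_inner T \<tau> (wgrad S v)"
      by (rule L2_inner_cong[OF ae_eq_refl Rv(2) T.Hdiv_L2[OF R\<tau>(1)] T.Hdiv_L2[OF R\<tau>(1)]
          T.wgrad_L2[OF Rv(1)] L2_cell[OF wgrad_L2[OF v] T]])
    then show ?thesis
      using normal_trace_div[OF \<tau> ae_eq_refl wdiv_L2[OF \<tau>] T Rv(1)] by (simp add: L2_inner_commute)
  qed
  then have "(\<Sum>T\<in>Ts. normal_trace T \<tau> v) = (\<Sum>T\<in>Ts. L2_inner T (wgrad S v) \<tau>) + (\<Sum>T\<in>Ts. L2_inner T (wdiv S \<tau>) v)"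
    by (simp add: sum.distrib)
  then show ?thesis
    by (simp add: sum_cells wgrad_L2[OF v] wdiv_L2[OF \<tau>] H1_L2[OF v] Hdiv_L2[OF \<tau>] normal_trace_def L2_inner_commute)
qed

lemma tr_div_apply: "v \<in> H1_mesh Ts \<Longrightarrow> tr_div Ts (\<lambda>T. \<tau>) v = (\<Sum>T\<in>Ts. normal_trace T \<tau> (v T))"
  by (simp add: tr_div_def mesh_inner_def mesh_div_def mesh_grad_def normal_trace_def sum.distrib)

lemma tr_grad_apply: "\<sigma> \<in> Hdiv_mesh Ts \<Longrightarrow> tr_grad Ts (\<lambda>T. v) \<sigma> = (\<Sum>T\<in>Ts. normal_trace T (\<sigma> T) v)"
  by (simp add: tr_grad_def mesh_inner_def mesh_div_def mesh_grad_def normal_trace_def sum.distrib)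

lemma tr_div_eqI:
  assumes "\<And>v. v \<in> H1_mesh Ts \<Longrightarrow> (\<Sum>T\<in>Ts. normal_trace T \<tau> (v T)) = (\<Sum>T\<in>Ts. normal_trace T \<sigma> (v T))"
  shows "tr_div Ts (\<lambda>T. \<tau>) = tr_div Ts (\<lambda>T. \<sigma>)"
proof
  fix v show "tr_div Ts (\<lambda>T. \<tau>) v = tr_div Ts (\<lambda>T. \<sigma>) v"
    using assms[of v] tr_div_apply[of v] by (cases "v \<in> H1_mesh Ts") (auto simp: tr_div_def)
qed

lemma tr_grad_eqI:
  assumes "\<And>\<sigma>. \<sigma> \<in> Hdiv_mesh Ts \<Longrightarrow> (\<Sum>T\<in>Ts. normal_trace T (\<sigma> T) v) = (\<Sum>T\<in>Ts. normal_trace T (\<sigma> T) w)"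
  shows "tr_grad Ts (\<lambda>T. v) = tr_grad Ts (\<lambda>T. w)"
proof
  fix \<sigma> show "tr_grad Ts (\<lambda>T. v) \<sigma> = tr_grad Ts (\<lambda>T. w) \<sigma>"
    using assms[of \<sigma>] tr_grad_apply[of \<sigma>] by (cases "\<sigma> \<in> Hdiv_mesh Ts") (auto simp: tr_grad_def)
qed

lemma H1_mesh_const: "v \<in> H1 S \<Longrightarrow> (\<lambda>T. v) \<in> H1_mesh Ts"
  unfolding H1_mesh_def using H1_restrict cell by auto

lemma Hdiv_mesh_const: "\<tau> \<in> Hdiv S \<Longrightarrow> (\<lambda>T. \<tau>) \<in> Hdiv_mesh Ts"
  unfolding Hdiv_mesh_def using Hdiv_restrict cell by auto

text \<open>\<open>U_eq\<close> compares volume components almost everywhere but skeleton components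
  as HOL functions; this passes from the first kind of equality to the second.\<close>

lemma tr_div_cong:
  assumes "u \<in> Hdiv S" "ae_eq S u w" "w \<in> Hdiv S"
  shows "tr_div Ts (\<lambda>T. u) = tr_div Ts (\<lambda>T. w)"
proof (rule tr_div_eqI)
  fix v assume v: "v \<in> H1_mesh Ts"
  have "normal_trace T u (v T) = normal_trace T w (v T)" if T: "T \<in> Ts" for T
  proof -
    interpret T: bounded_open T by (rule cell(1)[OF T])
    have vT: "v T \<in> H1 T" using v T by (auto simp: H1_mesh_def)
    have "ae_eq S (wdiv S u) (wdiv S w)"
      using Hdiv_cong(2)[OF assms(1,2) Hdiv_L2[OF assms(3)]] by (rule ae_eq_sym)
    moreover have "L2_inner T u (wgrad T (v T)) = L2_inner T w (wgrad T (v T))"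
      by (rule L2_inner_cong[OF ae_eq_cell[OF assms(2) T] ae_eq_refl L2_cell[OF Hdiv_L2[OF assms(1)] T]
          L2_cell[OF Hdiv_L2[OF assms(3)] T] T.wgrad_L2[OF vT] T.wgrad_L2[OF vT]])
    ultimately show ?thesis
      using normal_trace_div[OF assms(1) _ wdiv_L2[OF assms(3)] T vT]
        normal_trace_div[OF assms(3) ae_eq_refl wdiv_L2[OF assms(3)] T vT] by simp
  qed
  then show "(\<Sum>T\<in>Ts. normal_trace T u (v T)) = (\<Sum>T\<in>Ts. normal_trace T w (v T))" by simp
qed

lemma tr_grad_cong:
  assumes "u \<in> H1 S" "ae_eq S u w" "w \<in> H1 S"
  shows "tr_grad Ts (\<lambda>T. u) = tr_grad Ts (\<lambda>T. w)"
proof (rule tr_grad_eqI)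
  fix \<sigma> assume \<sigma>: "\<sigma> \<in> Hdiv_mesh Ts"
  have "normal_trace T (\<sigma> T) u = normal_trace T (\<sigma> T) w" if T: "T \<in> Ts" for T
  proof -
    interpret T: bounded_open T by (rule cell(1)[OF T])
    have \<sigma>T: "\<sigma> T \<in> Hdiv T" using \<sigma> T by (auto simp: Hdiv_mesh_def)
    have "ae_eq S (wgrad S u) (wgrad S w)"
      using H1_cong(2)[OF assms(1,2) H1_L2[OF assms(3)]] by (rule ae_eq_sym)
    moreover have "L2_inner T u (wdiv T (\<sigma> T)) = L2_inner T w (wdiv T (\<sigma> T))"
      by (rule L2_inner_cong[OF ae_eq_cell[OF assms(2) T] ae_eq_refl L2_cell[OF H1_L2[OF assms(1)] T]
          L2_cell[OF H1_L2[OF assms(3)] T] T.wdiv_L2[OF \<sigma>T] T.wdiv_L2[OF \<sigma>T]])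
    ultimately show ?thesis
      using normal_trace_grad[OF assms(1) _ wgrad_L2[OF assms(3)] T \<sigma>T]
        normal_trace_grad[OF assms(3) ae_eq_refl wgrad_L2[OF assms(3)] T \<sigma>T] by simp
  qed
  then show "(\<Sum>T\<in>Ts. normal_trace T (\<sigma> T) u) = (\<Sum>T\<in>Ts. normal_trace T (\<sigma> T) w)" by simp
qed

text \<open>The residual of \<open>div u = q\<close> tested with a broken function, where the
  skeleton unknown is the trace of a field \<tau> that is not assumed to equal
  \<open>u\<close>.\<close>

definition div_residual :: "('a \<Rightarrow> 'a) \<Rightarrow> ('a \<Rightarrow> 'a) \<Rightarrow> ('a \<Rightarrow> real) \<Rightarrow> ('a set \<Rightarrow> 'a \<Rightarrow> real) \<Rightarrow> real" where
  "div_residual \<tau> u q v = (\<Sum>T\<in>Ts. normal_trace T \<tau> (v T)) -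
     (\<Sum>T\<in>Ts. L2_inner T u (wgrad T (v T)) + L2_inner T q (v T))"

definition grad_residual :: "('a \<Rightarrow> real) \<Rightarrow> ('a \<Rightarrow> real) \<Rightarrow> ('a \<Rightarrow> 'a) \<Rightarrow> ('a set \<Rightarrow> 'a \<Rightarrow> 'a) \<Rightarrow> real" where
  "grad_residual p u g \<sigma> = (\<Sum>T\<in>Ts. normal_trace T (\<sigma> T) p) -
     (\<Sum>T\<in>Ts. L2_inner T u (wdiv T (\<sigma> T)) + L2_inner T g (\<sigma> T))"

text \<open>The ultraweak form decouples: regrouped by test component, each of the four residuals
  contains exactly one of \<open>v1\<close> to \<open>v4\<close>.\<close>

lemma b_form_residual:
  assumes u: "u1 \<in> L2 S" "u2 \<in> L2 S" "u3 \<in> L2 S" "u4 \<in> L2 S" and f: "f \<in> L2 S"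
    and v: "v1 \<in> Hdiv_mesh Ts" "v2 \<in> H1_mesh Ts" "v3 \<in> Hdiv_mesh Ts" "v4 \<in> H1_mesh Ts"
  shows "b_form Ts (u1, u2, u3, u4, tr_div Ts (\<lambda>T. \<tau>1), tr_grad Ts (\<lambda>T. p2), tr_div Ts (\<lambda>T. \<tau>3), tr_grad Ts (\<lambda>T. p4))
      (v1, v2, v3, v4) - L_form Ts f (v1, v2, v3, v4) =
    div_residual \<tau>1 u1 u2 v4 + grad_residual p2 u2 u3 v3 + div_residual \<tau>3 u3 u4 v2 +
    grad_residual p4 u4 (\<lambda>x. f x - u1 x) v1"
proof -
  have split: "L2_inner T u1 (\<lambda>x. v1 T x - wgrad T (v4 T) x) = L2_inner T u1 (v1 T) - L2_inner T u1 (wgrad T (v4 T))"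
    "L2_inner T u2 (\<lambda>x. v4 T x + wdiv T (v3 T) x) = L2_inner T u2 (v4 T) + L2_inner T u2 (wdiv T (v3 T))"
    "L2_inner T u3 (\<lambda>x. v3 T x + wgrad T (v2 T) x) = L2_inner T u3 (v3 T) + L2_inner T u3 (wgrad T (v2 T))"
    "L2_inner T u4 (\<lambda>x. v2 T x + wdiv T (v1 T) x) = L2_inner T u4 (v2 T) + L2_inner T u4 (wdiv T (v1 T))"
    "L2_inner T (\<lambda>x. f x - u1 x) (v1 T) = L2_inner T f (v1 T) - L2_inner T u1 (v1 T)"
    if T: "T \<in> Ts" for T
  proof -
    interpret T: bounded_open T by (rule cell(1)[OF T])
    have V: "v1 T \<in> Hdiv T" "v2 T \<in> H1 T" "v3 T \<in> Hdiv T" "v4 T \<in> H1 T"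
      using v T by (auto simp: Hdiv_mesh_def H1_mesh_def)
    note uT = u[THEN L2_cell[OF _ T]] L2_cell[OF f T]
    note VL = V(1)[THEN T.Hdiv_L2] V(2)[THEN T.H1_L2] V(3)[THEN T.Hdiv_L2] V(4)[THEN T.H1_L2]
      V(1)[THEN T.wdiv_L2] V(2)[THEN T.wgrad_L2] V(3)[THEN T.wdiv_L2] V(4)[THEN T.wgrad_L2]
    show "L2_inner T u1 (\<lambda>x. v1 T x - wgrad T (v4 T) x) = L2_inner T u1 (v1 T) - L2_inner T u1 (wgrad T (v4 T))"
      by (rule L2_inner_diff2[OF VL(1) VL(8) uT(1)])
    show "L2_inner T u2 (\<lambda>x. v4 T x + wdiv T (v3 T) x) = L2_inner T u2 (v4 T) + L2_inner T u2 (wdiv T (v3 T))"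
      by (rule L2_inner_add2[OF VL(4) VL(7) uT(2)])
    show "L2_inner T u3 (\<lambda>x. v3 T x + wgrad T (v2 T) x) = L2_inner T u3 (v3 T) + L2_inner T u3 (wgrad T (v2 T))"
      by (rule L2_inner_add2[OF VL(3) VL(6) uT(3)])
    show "L2_inner T u4 (\<lambda>x. v2 T x + wdiv T (v1 T) x) = L2_inner T u4 (v2 T) + L2_inner T u4 (wdiv T (v1 T))"
      by (rule L2_inner_add2[OF VL(2) VL(5) uT(4)])
    show "L2_inner T (\<lambda>x. f x - u1 x) (v1 T) = L2_inner T f (v1 T) - L2_inner T u1 (v1 T)"
      by (rule L2_inner_diff[OF uT(5) uT(1) VL(1)])
  qed
  show ?thesis
    by (simp add: div_residual_def grad_residual_def mesh_inner_def mesh_grad_def mesh_div_def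
        tr_div_apply[OF v(2)] tr_div_apply[OF v(4)] tr_grad_apply[OF v(1)] tr_grad_apply[OF v(3)]
        split sum.distrib sum_subtractf)
qed

section \<open>Recovering the system and its boundary conditions from the formulation\<close>

lemma zero_H1_mesh: "(\<lambda>T x. 0) \<in> H1_mesh Ts"
  using H1_mesh_const[OF G.zero] .

lemma zero_Hdiv_mesh: "(\<lambda>T x. 0) \<in> Hdiv_mesh Ts"
  using Hdiv_mesh_const[OF test_Hdiv[OF test_fun_zero]] .

text \<open>Allows three of the four test components to be switched off.\<close>

lemma div_residual_zero:
  assumes "\<tau> \<in> L2 S" "u \<in> L2 S"
  shows "div_residual \<tau> u q (\<lambda>T x. 0) = 0"
proof -
  have "normal_trace T \<tau> (\<lambda>x. 0) = 0" "L2_inner T u (wgrad T (\<lambda>x. 0)) = 0" if T: "T \<in> Ts" for T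
    using bounded_open.normal_trace_zero(1)[OF cell(1)[OF T] L2_cell[OF assms(1) T]]
      bounded_open.normal_trace_zero(1)[OF cell(1)[OF T] L2_cell[OF assms(2) T]]
    by (simp_all add: normal_trace_def L2_inner_commute)
  then show ?thesis by (simp add: div_residual_def)
qed

lemma grad_residual_zero:
  assumes "p \<in> L2 S" "u \<in> L2 S"
  shows "grad_residual p u g (\<lambda>T x. 0) = 0"
proof -
  have "normal_trace T (\<lambda>x. 0) p = 0" "L2_inner T u (wdiv T (\<lambda>x. 0)) = 0" if T: "T \<in> Ts" for T
    using bounded_open.normal_trace_zero(2)[OF cell(1)[OF T] L2_cell[OF assms(1) T]]
      bounded_open.normal_trace_zero(2)[OF cell(1)[OF T] L2_cell[OF assms(2) T]]
    by (simp_all add: normal_trace_def L2_inner_commute)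
  then show ?thesis by (simp add: grad_residual_def)
qed

lemma div_residual_vanishes:
  assumes "u \<in> Hdiv S" "ae_eq S (wdiv S u) q" "q \<in> L2 S" and v: "v \<in> H1_mesh Ts"
  shows "div_residual u u q v = 0"
  using normal_trace_div[OF assms(1-3)] v by (simp add: div_residual_def H1_mesh_def Pi_iff)

lemma grad_residual_vanishes:
  assumes "u \<in> H1 S" "ae_eq S (wgrad S u) g" "g \<in> L2 S" and \<sigma>: "\<sigma> \<in> Hdiv_mesh Ts"
  shows "grad_residual u u g \<sigma> = 0"
  using normal_trace_grad[OF assms(1-3)] \<sigma> by (simp add: grad_residual_def Hdiv_mesh_def Pi_iff)

text \<open>For a global test function the skeleton terms add up to a trace on the outer boundary,
  which vanishes; what remains is the definition of the weak divergence. Broken test functions then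
  identify the skeleton unknown with the trace of \<open>u\<close>.\<close>

lemma div_from_residual:
  assumes u: "u \<in> L2 S" and q: "q \<in> L2 S" and \<tau>: "\<tau> \<in> Hdiv S"
    and res: "\<And>v. v \<in> H1_mesh Ts \<Longrightarrow> div_residual \<tau> u q v = 0"
  shows "u \<in> Hdiv S" "ae_eq S (wdiv S u) q" "tr_div Ts (\<lambda>T. \<tau>) = tr_div Ts (\<lambda>T. u)"
proof -
  have "is_weak_div S u q"
    unfolding is_weak_div_def
  proof (intro conjI q ballI)
    fix \<phi> :: "'a \<Rightarrow> real" assume \<phi>: "\<phi> \<in> test_fun S"
    have \<phi>H: "\<phi> \<in> H1 S" by (rule test_H1[OF \<phi>])
    have "(\<Sum>T\<in>Ts. normal_trace T \<tau> \<phi>) = 0"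
      using sum_normal_trace[OF \<tau> \<phi>H] green_H1_0[OF test_H1_0[OF \<phi>] \<tau>]
      by (simp add: normal_trace_def[of S])
    moreover have "L2_inner T u (wgrad T \<phi>) = L2_inner T u (cgrad \<phi>)" if T: "T \<in> Ts" for T
    proof -
      interpret T: bounded_open T by (rule cell(1)[OF T])
      show ?thesis
        by (rule L2_inner_cong[OF ae_eq_refl T.test_wgrad[OF \<phi>] L2_cell[OF u T] L2_cell[OF u T]
            T.wgrad_L2[OF T.test_H1[OF \<phi>]] T.test_L2[OF test_fun_cgrad[OF \<phi>]]])
    qed
    ultimately have "(\<Sum>T\<in>Ts. L2_inner T u (cgrad \<phi>)) + (\<Sum>T\<in>Ts. L2_inner T q \<phi>) = 0"
      using res[OF H1_mesh_const[OF \<phi>H]] by (simp add: div_residual_def sum.distrib)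
    then show "L2_inner S q \<phi> = - L2_inner S u (cgrad \<phi>)"
      by (simp add: sum_cells u q test_L2[OF \<phi>] test_L2[OF test_fun_cgrad[OF \<phi>]])
  qed
  then show H: "u \<in> Hdiv S" and eq: "ae_eq S (wdiv S u) q"
    by (rule Hdiv_I[OF u], rule wdiv_eqI[OF u])
  show "tr_div Ts (\<lambda>T. \<tau>) = tr_div Ts (\<lambda>T. u)"
    using res div_residual_vanishes[OF H eq q] by (intro tr_div_eqI) (simp add: div_residual_def)
qed

text \<open>As for the divergence; with a smooth test field the skeleton terms add up to zero by the
  definition of the weak gradient of \<open>p\<close>.\<close>

lemma grad_from_residual:
  assumes u: "u \<in> L2 S" and g: "g \<in> L2 S" and p: "p \<in> H1 S"
    and res: "\<And>\<sigma>. \<sigma> \<in> Hdiv_mesh Ts \<Longrightarrow> grad_residual p u g \<sigma> = 0"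
  shows "u \<in> H1 S" "ae_eq S (wgrad S u) g" "tr_grad Ts (\<lambda>T. p) = tr_grad Ts (\<lambda>T. u)"
proof -
  have "is_weak_grad S u g"
    unfolding is_weak_grad_def
  proof (intro conjI g ballI)
    fix \<phi> :: "'a \<Rightarrow> 'a" assume \<phi>: "\<phi> \<in> test_fun S"
    have \<phi>H: "\<phi> \<in> Hdiv S" by (rule test_Hdiv[OF \<phi>])
    have cong: "L2_inner S w (wdiv S \<phi>) = L2_inner S w (cdiv \<phi>)" if "w \<in> L2 S" for w
      by (rule L2_inner_cong[OF ae_eq_refl test_wdiv[OF \<phi>] that that wdiv_L2[OF \<phi>H] test_L2[OF test_fun_cdiv[OF \<phi>]]])
    have "(\<Sum>T\<in>Ts. normal_trace T \<phi> p) = 0"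
      using sum_normal_trace[OF \<phi>H p] wgrad_test[OF p \<phi>] cong[OF H1_L2[OF p]]
      by (simp add: normal_trace_def[of S])
    moreover have "L2_inner T u (wdiv T \<phi>) = L2_inner T u (wdiv S \<phi>)" if T: "T \<in> Ts" for T
    proof -
      interpret T: bounded_open T by (rule cell(1)[OF T])
      note R = Hdiv_restrict[OF cell(2,3)[OF T] \<phi>H]
      show ?thesis
        by (rule L2_inner_cong[OF ae_eq_refl R(2) L2_cell[OF u T] L2_cell[OF u T]
            T.wdiv_L2[OF R(1)] L2_cell[OF wdiv_L2[OF \<phi>H] T]])
    qed
    ultimately have "(\<Sum>T\<in>Ts. L2_inner T u (wdiv S \<phi>)) + (\<Sum>T\<in>Ts. L2_inner T g \<phi>) = 0"
      using res[OF Hdiv_mesh_const[OF \<phi>H]] by (simp add: grad_residual_def sum.distrib)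
    then show "L2_inner S g \<phi> = - L2_inner S u (cdiv \<phi>)"
      by (simp add: sum_cells u g test_L2[OF \<phi>] wdiv_L2[OF \<phi>H] cong[OF u])
  qed
  then show H: "u \<in> H1 S" and eq: "ae_eq S (wgrad S u) g"
    by (rule H1_I[OF u], rule wgrad_eqI[OF u])
  show "tr_grad Ts (\<lambda>T. p) = tr_grad Ts (\<lambda>T. u)"
    using res grad_residual_vanishes[OF H eq g] by (intro tr_grad_eqI) (simp add: grad_residual_def)
qed

text \<open>The skeleton unknown carries the boundary condition: applied to conforming functions,
  the trace on the mesh is the normal trace on the outer boundary.\<close>

lemma Hdiv_0_tr_div:
  assumes \<tau>: "\<tau> \<in> Hdiv_0 S" and u: "u \<in> Hdiv S" and tr: "tr_div Ts (\<lambda>T. \<tau>) = tr_div Ts (\<lambda>T. u)"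
  shows "u \<in> Hdiv_0 S"
proof -
  have "normal_trace S u v = 0" if v: "v \<in> H1 S" for v
  proof -
    have "normal_trace S u v = tr_div Ts (\<lambda>T. u) (\<lambda>T. v)"
      using tr_div_apply[OF H1_mesh_const[OF v]] sum_normal_trace[OF u v] by simp
    also have "\<dots> = normal_trace S \<tau> v"
      using tr_div_apply[OF H1_mesh_const[OF v]] sum_normal_trace[OF Hdiv_0_Hdiv[OF \<tau>] v] by (simp flip: tr)
    also have "\<dots> = 0" using \<tau> v by (simp add: Hdiv_0_def)
    finally show ?thesis .
  qed
  then show ?thesis using u by (simp add: Hdiv_0_def)
qed

text \<open>Equal mesh traces make the trace of \<open>u - p\<close> vanish on all of
  \<open>Hdiv S\<close>, so that \<open>trace_kernel\<close> applies to the difference.\<close>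

lemma H1_0_tr_grad:
  assumes p: "p \<in> H1_0 S" and u: "u \<in> H1 S" and tr: "tr_grad Ts (\<lambda>T. p) = tr_grad Ts (\<lambda>T. u)"
  shows "u \<in> H1_0 S"
proof -
  interpret Z: pre_hilbert "H1_0 S" H1_inner by (rule pre_hilbert_H1_0)
  note pH = H1_0_H1[OF p]
  have "(\<lambda>x. u x - p x) \<in> H1_0 S"
  proof (rule trace_kernel)
    show D: "(\<lambda>x. u x - p x) \<in> H1 S" by (rule H1_diff[OF u pH])
    fix \<tau> assume \<tau>: "\<tau> \<in> Hdiv S"
    have "normal_trace S \<tau> u = normal_trace S \<tau> p"
      using tr_grad_apply[OF Hdiv_mesh_const[OF \<tau>], of u] tr_grad_apply[OF Hdiv_mesh_const[OF \<tau>], of p] tr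
      by (simp add: sum_normal_trace \<tau> u pH)
    moreover have "L2_inner S (wgrad S (\<lambda>x. u x - p x)) \<tau> = L2_inner S (\<lambda>x. wgrad S u x - wgrad S p x) \<tau>"
      by (rule L2_inner_cong[OF wgrad_diff[OF u pH] ae_eq_refl wgrad_L2[OF D]
          L2_diff[OF wgrad_L2[OF u] wgrad_L2[OF pH]] Hdiv_L2[OF \<tau>] Hdiv_L2[OF \<tau>]])
    ultimately show "L2_inner S (\<lambda>x. u x - p x) (wdiv S \<tau>) + L2_inner S (wgrad S (\<lambda>x. u x - p x)) \<tau> = 0"
      by (simp add: normal_trace_def L2_inner_diff u pH \<tau> H1_L2 wgrad_L2 wdiv_L2 Hdiv_L2)
  qed
  from Z.add[OF this p] show ?thesis by simp
qed

lemma system_solves_formulation: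
  assumes sys: "solves_system f u1 u2 u3 u4" and f: "f \<in> L2 S" and v: "v \<in> V_space Ts"
  shows "b_form Ts (u1, u2, u3, u4, tr_div Ts (\<lambda>T. u1), tr_grad Ts (\<lambda>T. u2), tr_div Ts (\<lambda>T. u3), tr_grad Ts (\<lambda>T. u4)) v
    = L_form Ts f v"
proof -
  obtain v1 v2 v3 v4 where v_eq: "v = (v1, v2, v3, v4)" by (cases v) auto
  have V: "v1 \<in> Hdiv_mesh Ts" "v2 \<in> H1_mesh Ts" "v3 \<in> Hdiv_mesh Ts" "v4 \<in> H1_mesh Ts"
    using v by (auto simp: v_eq V_space_def)
  note L = solves_system_L2[OF sys]
  have s: "u1 \<in> Hdiv S" "u2 \<in> H1 S" "u3 \<in> Hdiv S" "u4 \<in> H1 S"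
    "ae_eq S (wdiv S u1) u2" "ae_eq S (wgrad S u2) u3" "ae_eq S (wdiv S u3) u4"
    "ae_eq S (wgrad S u4) (\<lambda>x. f x - u1 x)"
    using sys by (auto simp: solves_system_def Hdiv_0_Hdiv H1_0_H1)
  show ?thesis
    using b_form_residual[OF L f V, of u1 u2 u3 u4] div_residual_vanishes[OF s(1,5) L(2) V(4)]
      grad_residual_vanishes[OF s(2,6) L(3) V(3)] div_residual_vanishes[OF s(3,7) L(4) V(2)]
      grad_residual_vanishes[OF s(4,8) L2_diff[OF f L(1)] V(1)]
    unfolding v_eq by linarith
qed

lemma formulation_solves_system:
  assumes w: "w \<in> U_space S Ts" and f: "f \<in> L2 S"
    and eq: "\<And>v. v \<in> V_space Ts \<Longrightarrow> b_form Ts w v = L_form Ts f v"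
  obtains w1 w2 w3 w4 where "solves_system f w1 w2 w3 w4"
    "w = (w1, w2, w3, w4, tr_div Ts (\<lambda>T. w1), tr_grad Ts (\<lambda>T. w2), tr_div Ts (\<lambda>T. w3), tr_grad Ts (\<lambda>T. w4))"
proof -
  obtain w1 w2 w3 w4 \<tau>1 p2 \<tau>3 p4 where
    w_eq: "w = (w1, w2, w3, w4, tr_div Ts (\<lambda>T. \<tau>1), tr_grad Ts (\<lambda>T. p2), tr_div Ts (\<lambda>T. \<tau>3), tr_grad Ts (\<lambda>T. p4))"
    and L: "w1 \<in> L2 S" "w2 \<in> L2 S" "w3 \<in> L2 S" "w4 \<in> L2 S"
    and tr: "\<tau>1 \<in> Hdiv_0 S" "p2 \<in> H1_0 S" "\<tau>3 \<in> Hdiv S" "p4 \<in> H1 S"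
    using w unfolding U_space_def Hmhalf_0_def Hhalf_0_def Hmhalf_def Hhalf_def by (auto elim!: imageE)
  note trL = Hdiv_L2[OF Hdiv_0_Hdiv[OF tr(1)]] H1_L2[OF H1_0_H1[OF tr(2)]] Hdiv_L2[OF tr(3)] H1_L2[OF tr(4)]
  have res: "div_residual \<tau>1 w1 w2 v4 + grad_residual p2 w2 w3 v3 + div_residual \<tau>3 w3 w4 v2 +
      grad_residual p4 w4 (\<lambda>x. f x - w1 x) v1 = 0"
    if "v1 \<in> Hdiv_mesh Ts" "v2 \<in> H1_mesh Ts" "v3 \<in> Hdiv_mesh Ts" "v4 \<in> H1_mesh Ts" for v1 v2 v3 v4
    using b_form_residual[OF L f that, of \<tau>1 p2 \<tau>3 p4] eq[of "(v1, v2, v3, v4)"] that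
    by (simp add: w_eq V_space_def)
  note zero = div_residual_zero[OF trL(1) L(1)] grad_residual_zero[OF trL(2) L(2)]
    div_residual_zero[OF trL(3) L(3)] grad_residual_zero[OF trL(4) L(4)]
  \<comment> \<open>Setting the other three test components to zero isolates one equation at a
    time.\<close>
  have "div_residual \<tau>1 w1 w2 v = 0" if "v \<in> H1_mesh Ts" for v
    using res[OF zero_Hdiv_mesh zero_H1_mesh zero_Hdiv_mesh that] by (simp add: zero)
  note R1 = div_from_residual[OF L(1,2) Hdiv_0_Hdiv[OF tr(1)] this]
  have "grad_residual p2 w2 w3 v = 0" if "v \<in> Hdiv_mesh Ts" for v
    using res[OF zero_Hdiv_mesh zero_H1_mesh that zero_H1_mesh] by (simp add: zero)
  note R2 = grad_from_residual[OF L(2,3) H1_0_H1[OF tr(2)] this]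
  have "div_residual \<tau>3 w3 w4 v = 0" if "v \<in> H1_mesh Ts" for v
    using res[OF zero_Hdiv_mesh that zero_Hdiv_mesh zero_H1_mesh] by (simp add: zero)
  note R3 = div_from_residual[OF L(3,4) tr(3) this]
  have "grad_residual p4 w4 (\<lambda>x. f x - w1 x) v = 0" if "v \<in> Hdiv_mesh Ts" for v
    using res[OF that zero_H1_mesh zero_Hdiv_mesh zero_H1_mesh] by (simp add: zero)
  note R4 = grad_from_residual[OF L(4) L2_diff[OF f L(1)] tr(4) this]
  have "solves_system f w1 w2 w3 w4"
    unfolding solves_system_def
    using Hdiv_0_tr_div[OF tr(1) R1(1,3)] H1_0_tr_grad[OF tr(2) R2(1,3)] R1(2) R2(2) R3(1,2) R4(1,2) by blast
  then show thesis using that w_eq R1(3) R2(3) R3(3) R4(3) by simp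
qed

text \<open>The volume field is itself a competitor in the infimum; the lower bound 0 is needed for
  squaring the estimate.\<close>

lemma Hmhalf_norm_bound:
  assumes "\<tau> \<in> Hdiv S"
  shows "0 \<le> Hmhalf_norm S Ts (tr_div Ts (\<lambda>T. \<tau>))" "Hmhalf_norm S Ts (tr_div Ts (\<lambda>T. \<tau>)) \<le> Hdiv_norm S \<tau>"
proof -
  have nn: "0 \<le> Hdiv_norm S \<sigma>" for \<sigma> by (simp add: Hdiv_norm_def)
  show "0 \<le> Hmhalf_norm S Ts (tr_div Ts (\<lambda>T. \<tau>))"
    unfolding Hmhalf_norm_def using assms nn by (intro cInf_greatest) auto
  show "Hmhalf_norm S Ts (tr_div Ts (\<lambda>T. \<tau>)) \<le> Hdiv_norm S \<tau>"
    unfolding Hmhalf_norm_def using assms nn by (intro cInf_lower bdd_belowI[of _ 0]) auto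
qed

lemma Hhalf_norm_bound:
  assumes "v \<in> H1 S"
  shows "0 \<le> Hhalf_norm S Ts (tr_grad Ts (\<lambda>T. v))" "Hhalf_norm S Ts (tr_grad Ts (\<lambda>T. v)) \<le> H1_norm S v"
proof -
  have nn: "0 \<le> H1_norm S w" for w by (simp add: H1_norm_def)
  show "0 \<le> Hhalf_norm S Ts (tr_grad Ts (\<lambda>T. v))"
    unfolding Hhalf_norm_def using assms nn by (intro cInf_greatest) auto
  show "Hhalf_norm S Ts (tr_grad Ts (\<lambda>T. v)) \<le> H1_norm S v"
    unfolding Hhalf_norm_def using assms nn by (intro cInf_lower bdd_belowI[of _ 0]) auto
qed

lemma U_norm_bound:
  assumes sys: "solves_system f u1 u2 u3 u4"
    and B: "L2_norm S u1 \<le> b" "L2_norm S u2 \<le> b" "L2_norm S u3 \<le> b" "L2_norm S u4 \<le> b" "L2_norm S (wgrad S u4) \<le> b"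
  shows "U_norm S Ts (u1, u2, u3, u4, tr_div Ts (\<lambda>T. u1), tr_grad Ts (\<lambda>T. u2), tr_div Ts (\<lambda>T. u3), tr_grad Ts (\<lambda>T. u4))
    \<le> 4 * b"
proof -
  note L = solves_system_L2[OF sys]
  have s: "u1 \<in> Hdiv S" "u2 \<in> H1 S" "u3 \<in> Hdiv S" "u4 \<in> H1 S"
    "ae_eq S (wdiv S u1) u2" "ae_eq S (wgrad S u2) u3" "ae_eq S (wdiv S u3) u4"
    using sys by (auto simp: solves_system_def Hdiv_0_Hdiv H1_0_H1)
  have N: "L2_norm S (wdiv S u1) = L2_norm S u2" "L2_norm S (wgrad S u2) = L2_norm S u3" "L2_norm S (wdiv S u3) = L2_norm S u4"
    by (rule L2_norm_cong[OF s(5) wdiv_L2[OF s(1)] L(2)] L2_norm_cong[OF s(6) wgrad_L2[OF s(2)] L(3)]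
        L2_norm_cong[OF s(7) wdiv_L2[OF s(3)] L(4)])+
  have sq: "(L2_norm S u1)\<^sup>2 \<le> b\<^sup>2" "(L2_norm S u2)\<^sup>2 \<le> b\<^sup>2" "(L2_norm S u3)\<^sup>2 \<le> b\<^sup>2" "(L2_norm S u4)\<^sup>2 \<le> b\<^sup>2"
    "(L2_norm S (wgrad S u4))\<^sup>2 \<le> b\<^sup>2"
    using B L wgrad_L2[OF s(4)] by (auto intro!: power_mono L2_norm_nonneg)
  \<comment> \<open>Four volume terms of at most \<open>b^2\<close> and four skeleton terms of at
    most \<open>2 * b^2\<close> add up to \<open>12 * b^2\<close>; 16 is the next perfect
    square.\<close>
  have b16: "(4 * b)\<^sup>2 = 16 * b\<^sup>2" by (simp add: power_mult_distrib)
  have b: "b \<ge> 0" using order_trans[OF L2_norm_nonneg[OF L(1)] B(1)] .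
  have "(Hmhalf_norm S Ts (tr_div Ts (\<lambda>T. u1)))\<^sup>2 \<le> (Hdiv_norm S u1)\<^sup>2"
    "(Hhalf_norm S Ts (tr_grad Ts (\<lambda>T. u2)))\<^sup>2 \<le> (H1_norm S u2)\<^sup>2"
    "(Hmhalf_norm S Ts (tr_div Ts (\<lambda>T. u3)))\<^sup>2 \<le> (Hdiv_norm S u3)\<^sup>2"
    "(Hhalf_norm S Ts (tr_grad Ts (\<lambda>T. u4)))\<^sup>2 \<le> (H1_norm S u4)\<^sup>2"
    using Hmhalf_norm_bound[OF s(1)] Hhalf_norm_bound[OF s(2)] Hmhalf_norm_bound[OF s(3)] Hhalf_norm_bound[OF s(4)]
    by (auto intro: power_mono)
  moreover have "(Hdiv_norm S u1)\<^sup>2 \<le> 2 * b\<^sup>2" "(H1_norm S u2)\<^sup>2 \<le> 2 * b\<^sup>2" "(Hdiv_norm S u3)\<^sup>2 \<le> 2 * b\<^sup>2" "(H1_norm S u4)\<^sup>2 \<le> 2 * b\<^sup>2"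
    using sq by (simp_all add: Hdiv_norm_def H1_norm_def N)
  ultimately have "U_norm S Ts (u1, u2, u3, u4, tr_div Ts (\<lambda>T. u1), tr_grad Ts (\<lambda>T. u2), tr_div Ts (\<lambda>T. u3), tr_grad Ts (\<lambda>T. u4))
      \<le> sqrt ((4 * b)\<^sup>2)"
    unfolding U_norm.simps b16 using sq zero_le_power2[of b]
    by (intro real_sqrt_le_mono) linarith
  also have "sqrt ((4 * b)\<^sup>2) = 4 * b" unfolding real_sqrt_abs using b by simp
  finally show ?thesis .
qed

end

theorem theorem7:
  fixes \<Omega> :: "'a::euclidean_space set"
  assumes "DIM('a) \<ge> 2"
    and "bounded \<Omega>" and "simply_connected \<Omega>" and "lipschitz_domain \<Omega>"
  shows "\<exists>C>0. \<forall>\<T> f. mesh \<Omega> \<T> \<longrightarrow> f \<in> L2 \<Omega> \<longrightarrow>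
    (\<exists>u\<in>U_space \<Omega> \<T>.
       (\<forall>v\<in>V_space \<T>. b_form \<T> u v = L_form \<T> f v) \<and>
       (\<forall>w\<in>U_space \<Omega> \<T>. (\<forall>v\<in>V_space \<T>. b_form \<T> w v = L_form \<T> f v) \<longrightarrow> U_eq \<Omega> w u) \<and>
       U_norm \<Omega> \<T> u \<le> C * L2_norm \<Omega> f \<and>
       solves_bvp \<Omega> f (fst u))"
proof -
  have lip: "lipschitz_boundary \<Omega>" using assms(4) by (simp add: lipschitz_domain_def)
  interpret bounded_open \<Omega>
    using assms(2,4) by unfold_locales (auto simp: lipschitz_domain_def)
  \<comment> \<open>The constant is fixed before any mesh or right-hand side is introduced.\<close>
  obtain C where C: "C > 0" "\<And>f. f \<in> L2 \<Omega> \<Longrightarrow> \<exists>u1 u2 u3 u4. solves_system f u1 u2 u3 u4 \<and>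
      L2_norm \<Omega> u1 \<le> C * L2_norm \<Omega> f \<and> L2_norm \<Omega> u2 \<le> C * L2_norm \<Omega> f \<and>
      L2_norm \<Omega> u3 \<le> C * L2_norm \<Omega> f \<and> L2_norm \<Omega> u4 \<le> C * L2_norm \<Omega> f \<and>
      L2_norm \<Omega> (wgrad \<Omega> u4) \<le> C * L2_norm \<Omega> f"
    using system_solvable[OF lip] by blast
  show ?thesis
  proof (intro exI[of _ "4 * C"] conjI allI impI)
    fix \<T> and f :: "'a \<Rightarrow> 'a" assume mesh: "mesh \<Omega> \<T>" and f: "f \<in> L2 \<Omega>"
    interpret meshed \<Omega> \<T> using mesh by unfold_locales
    obtain u1 u2 u3 u4 where sys: "solves_system f u1 u2 u3 u4"
      and B: "L2_norm \<Omega> u1 \<le> C * L2_norm \<Omega> f" "L2_norm \<Omega> u2 \<le> C * L2_norm \<Omega> f"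
        "L2_norm \<Omega> u3 \<le> C * L2_norm \<Omega> f" "L2_norm \<Omega> u4 \<le> C * L2_norm \<Omega> f"
        "L2_norm \<Omega> (wgrad \<Omega> u4) \<le> C * L2_norm \<Omega> f"
      using C(2)[OF f] by (elim exE conjE) (rule that)
    let ?u = "(u1, u2, u3, u4, tr_div \<T> (\<lambda>T. u1), tr_grad \<T> (\<lambda>T. u2), tr_div \<T> (\<lambda>T. u3), tr_grad \<T> (\<lambda>T. u4))"
    have s: "u1 \<in> Hdiv_0 \<Omega>" "u2 \<in> H1_0 \<Omega>" "u3 \<in> Hdiv \<Omega>" "u4 \<in> H1 \<Omega>"
      using sys by (auto simp: solves_system_def)
    show "\<exists>u\<in>U_space \<Omega> \<T>. (\<forall>v\<in>V_space \<T>. b_form \<T> u v = L_form \<T> f v) \<and>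
       (\<forall>w\<in>U_space \<Omega> \<T>. (\<forall>v\<in>V_space \<T>. b_form \<T> w v = L_form \<T> f v) \<longrightarrow> U_eq \<Omega> w u) \<and>
       U_norm \<Omega> \<T> u \<le> 4 * C * L2_norm \<Omega> f \<and> solves_bvp \<Omega> f (fst u)"
    proof (intro bexI[of _ ?u] conjI ballI impI)
      show "b_form \<T> ?u v = L_form \<T> f v" if "v \<in> V_space \<T>" for v
        by (rule system_solves_formulation[OF sys f that])
      show "U_norm \<Omega> \<T> ?u \<le> 4 * C * L2_norm \<Omega> f"
        using U_norm_bound[OF sys B] by simp
      show "solves_bvp \<Omega> f (fst ?u)" using system_solves_bvp[OF sys f] by simp
      show "?u \<in> U_space \<Omega> \<T>"
        using solves_system_L2[OF sys] s
        by (auto simp: U_space_def Hmhalf_0_def Hhalf_0_def Hmhalf_def Hhalf_def)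
      fix w assume w: "w \<in> U_space \<Omega> \<T>" and eq: "\<forall>v\<in>V_space \<T>. b_form \<T> w v = L_form \<T> f v"
      obtain w1 w2 w3 w4 where sys_w: "solves_system f w1 w2 w3 w4"
        and w_eq: "w = (w1, w2, w3, w4, tr_div \<T> (\<lambda>T. w1), tr_grad \<T> (\<lambda>T. w2), tr_div \<T> (\<lambda>T. w3), tr_grad \<T> (\<lambda>T. w4))"
        by (rule formulation_solves_system[OF w f eq[rule_format]])
      have s_w: "w1 \<in> Hdiv_0 \<Omega>" "w2 \<in> H1_0 \<Omega>" "w3 \<in> Hdiv \<Omega>" "w4 \<in> H1 \<Omega>"
        using sys_w by (auto simp: solves_system_def)
      note E = system_unique[OF sys_w sys]
      show "U_eq \<Omega> w ?u"
        unfolding w_eq U_eq.simps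
        using E tr_div_cong[OF Hdiv_0_Hdiv[OF s_w(1)] E(1) Hdiv_0_Hdiv[OF s(1)]]
          tr_grad_cong[OF H1_0_H1[OF s_w(2)] E(2) H1_0_H1[OF s(2)]]
          tr_div_cong[OF s_w(3) E(3) s(3)] tr_grad_cong[OF s_w(4) E(4) s(4)] by blast
    qed
  qed (use C(1) in simp)
qed

end
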